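(* Let $R,P>0$, $S=\{|y|\le R\}\subset\mathbb{R}^2$, $\alpha\in(0,1)$, and suppose $\phi^\pm_{a,b}\in C^{3,\alpha}(\mathbb{R})$ are given for all $a,b\in\mathbb{R}$ such that: (i) $\phi^\pm_{a,b}$ depend continuously in $C^{3,\alpha}(\mathbb{R})$ on $(a,b)$; (ii) $\phi^\pm_{a,b}(x+P)=\phi^\pm_{a,b}(x)$; (iii) $\int_0^P\phi^+_{a,b}dx=\int_0^P\phi^-_{a,b}dx$; (iv) if $b<b'$ then $\phi^\pm_{a,b}(x)<\phi^\pm_{a,b'}(x)$ for all $a,x$; (v) for all $a,x$, $\phi^\pm_{a,b}(x)\to\pm\infty$ as $b\to\pm\infty$ (i.e. both $\phi^+_{a,b}(x)$ and $\phi^-_{a,b}(x)$ tend to $+\infty$ as $b\to+\infty$ and to $-\infty$ as $b\to-\infty$). Let $(u_{a,b},v_{a,b})$ be the solution associated to $\phi^\pm_{a,b}$, let $\mathbb{Z}$ act on $\mathbb{C}^3$ by $n:(z_1,z_2,z_3)\mapsto(z_1,z_2,z_3+nP)$, and define $$N_{a,b,c}=\bigl\{(z_1,z_2,z_3)\in\mathbb{C}^3:|z_1|^2-|z_2|^2=2a,\ x\in\mathbb{R},\ y\in(-R,R),\ z_1z_2=v_{a,b}(x,y)+iy,\ z_3=x+iu_{a,b}(x,y)+ic\bigr\}/\mathbb{Z}.$$ Then distinct $N_{a,b,c}$ are disjoint, and with $V=\{(z_1,z_2,z_3)\in\mathbb{C}^3:|\operatorname{Im}z_1z_2|<R\}/\mathbb{Z}$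 there exists a continuous surjective $F:V\to\mathbb{R}^3$ with $F^{-1}(a,b,c)=N_{a,b,c}$ for all $(a,b,c)\in\mathbb{R}^3$; thus $F$ is a special Lagrangian fibration of $V$.
   Context: For $a\in\mathbb{R}$ let $(\dagger_a)$ denote $\frac{\partial u}{\partial x}=\frac{\partial v}{\partial y}$, $\frac{\partial v}{\partial x}=-2(v^2+y^2+a^2)^{1/2}\frac{\partial u}{\partial y}$. Given $P$-periodic $\phi^\pm\in C^{3,\alpha}(\mathbb{R})$ with equal integrals over $[0,P]$, the associated solution $(u,v)$ is the unique pair on $S$, $P$-periodic in $x$, with $u(0,0)=0$, $v(x,\pm R)=\phi^\pm(x)$, which is a $C^{3,\alpha}$ solution of $(\dagger_a)$ if $a\ne0$ and a singular solution of $(\dagger_0)$ if $a=0$ (existence and uniqueness hold). Singular solution of $(\dagger_0)$: continuous, weakly differentiable $u,v$ whose weak derivatives satisfy $(\dagger_0)$, with $v$ a weak solution of $\partial_x[(v^2+y^2)^{-1/2}\partial_xv]+2\partial_y^2v=0$, classical and real analytic away from points $(x,0)$ with $v(x,0)=0$, and a $C^0$ limit of $C^2$ solutions of $(\dagger_b)$ as $b\to0_+$. The sets $N_{a,b,c}$ are special Lagrangian 3-folds (possibly singular when $a=0$) in $\mathbb{C}^3/\mathbb{Z}$ with respect to $\omega'=\frac i2\sum dz_j\wedge d\bar z_j$, $\Omega'=dz_1\wedge dz_2\wedge dz_3$. *)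

theory Defs
  imports "HOL-Analysis.Analysis"
begin

definition C3a :: "real \<Rightarrow> (real \<Rightarrow> real) \<Rightarrow> bool" where
  "C3a \<alpha> f \<longleftrightarrow>
     (\<forall>k<3. \<forall>x. ((deriv ^^ k) f has_real_derivative (deriv ^^ Suc k) f x) (at x)) \<and>
     continuous_on UNIV ((deriv ^^ 3) f) \<and>
     (\<forall>k\<le>3. bounded (range ((deriv ^^ k) f))) \<and>
     (\<exists>C. \<forall>x y. \<bar>(deriv ^^ 3) f x - (deriv ^^ 3) f y\<bar> \<le> C * \<bar>x - y\<bar> powr \<alpha>)"

definition c3a_norm :: "real \<Rightarrow> (real \<Rightarrow> real) \<Rightarrow> real" where
  "c3a_norm \<alpha> f =
     (\<Sum>k\<le>3. (SUP x. \<bar>(deriv ^^ k) f x\<bar>)) +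
     (SUP xy \<in> {xy::real\<times>real. fst xy \<noteq> snd xy}.
        \<bar>(deriv ^^ 3) f (fst xy) - (deriv ^^ 3) f (snd xy)\<bar> / \<bar>fst xy - snd xy\<bar> powr \<alpha>)"

definition strip :: "real \<Rightarrow> (real \<times> real) set" where
  "strip R = {p. \<bar>snd p\<bar> \<le> R}"

definition open_strip :: "real \<Rightarrow> (real \<times> real) set" where
  "open_strip R = {p. \<bar>snd p\<bar> < R}"

text \<open>Classical partial derivatives. The x-derivative is taken along the whole horizontal
  line; on the closed strip the y-derivative is taken within [-R,R] (one-sided at the boundary).\<close>
definition px :: "(real \<times> real \<Rightarrow> real) \<Rightarrow> real \<times> real \<Rightarrow> real" where
  "px f p = deriv (\<lambda>t. f (t, snd p)) (fst p)"

definition py :: "(real \<times> real \<Rightarrow> real) \<Rightarrow> real \<times> real \<Rightarrow> real" where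
  "py f p = deriv (\<lambda>t. f (fst p, t)) (snd p)"

definition pyS :: "real \<Rightarrow> (real \<times> real \<Rightarrow> real) \<Rightarrow> real \<times> real \<Rightarrow> real" where
  "pyS R f p = vector_derivative (\<lambda>t. f (fst p, t)) (at (snd p) within {-R..R})"

fun pdS :: "real \<Rightarrow> bool list \<Rightarrow> (real \<times> real \<Rightarrow> real) \<Rightarrow> real \<times> real \<Rightarrow> real" where
  "pdS R [] f = f"
| "pdS R (d # ds) f = (if d then pyS R (pdS R ds f) else px (pdS R ds f))"

fun pd :: "bool list \<Rightarrow> (real \<times> real \<Rightarrow> real) \<Rightarrow> real \<times> real \<Rightarrow> real" where
  "pd [] f = f"
| "pd (d # ds) f = (if d then py (pd ds f) else px (pd ds f))"

definition Ck_strip :: "real \<Rightarrow> nat \<Rightarrow> (real \<times> real \<Rightarrow> real) \<Rightarrow> bool" where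
  "Ck_strip R k f \<longleftrightarrow>
     (\<forall>ds. length ds < k \<longrightarrow> (\<forall>p\<in>strip R.
        (\<lambda>t. pdS R ds f (t, snd p)) differentiable (at (fst p)) \<and>
        (\<lambda>t. pdS R ds f (fst p, t)) differentiable (at (snd p) within {-R..R}))) \<and>
     (\<forall>ds. length ds \<le> k \<longrightarrow> continuous_on (strip R) (pdS R ds f))"

definition Cka_strip :: "real \<Rightarrow> nat \<Rightarrow> real \<Rightarrow> (real \<times> real \<Rightarrow> real) \<Rightarrow> bool" where
  "Cka_strip R k \<alpha> f \<longleftrightarrow> Ck_strip R k f \<and>
     (\<forall>ds. length ds \<le> k \<longrightarrow> bounded (pdS R ds f ` strip R)) \<and>
     (\<forall>ds. length ds = k \<longrightarrow> (\<exists>C. \<forall>p\<in>strip R. \<forall>q\<in>strip R.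
        \<bar>pdS R ds f p - pdS R ds f q\<bar> \<le> C * dist p q powr \<alpha>))"

definition dagger_on_strip :: "real \<Rightarrow> real \<Rightarrow> (real \<times> real \<Rightarrow> real) \<Rightarrow> (real \<times> real \<Rightarrow> real) \<Rightarrow> bool" where
  "dagger_on_strip R a u v \<longleftrightarrow> (\<forall>p\<in>strip R.
     px u p = pyS R v p \<and>
     px v p = - 2 * sqrt ((v p)\<^sup>2 + (snd p)\<^sup>2 + a\<^sup>2) * pyS R u p)"

definition smooth_plane :: "(real \<times> real \<Rightarrow> real) \<Rightarrow> bool" where
  "smooth_plane \<psi> \<longleftrightarrow> (\<forall>ds. (\<forall>p.
      (\<lambda>t. pd ds \<psi> (t, snd p)) differentiable (at (fst p)) \<and>
      (\<lambda>t. pd ds \<psi> (fst p, t)) differentiable (at (snd p))) \<and>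
      continuous_on UNIV (pd ds \<psi>))"

definition test_fn :: "(real \<times> real) set \<Rightarrow> (real \<times> real \<Rightarrow> real) \<Rightarrow> bool" where
  "test_fn U \<psi> \<longleftrightarrow> smooth_plane \<psi> \<and>
     compact (closure {p. \<psi> p \<noteq> 0}) \<and> closure {p. \<psi> p \<noteq> 0} \<subseteq> U"

definition loc_int :: "(real \<times> real) set \<Rightarrow> (real \<times> real \<Rightarrow> real) \<Rightarrow> bool" where
  "loc_int U f \<longleftrightarrow> f \<in> borel_measurable lborel \<and>
     (\<forall>K. compact K \<and> K \<subseteq> U \<longrightarrow> set_integrable lborel K f)"

definition weak_dx :: "(real \<times> real) set \<Rightarrow> (real \<times> real \<Rightarrow> real) \<Rightarrow> (real \<times> real \<Rightarrow> real) \<Rightarrow> bool" where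
  "weak_dx U f g \<longleftrightarrow> loc_int U f \<and> loc_int U g \<and>
     (\<forall>\<psi>. test_fn U \<psi> \<longrightarrow>
        integral\<^sup>L lborel (\<lambda>p. f p * px \<psi> p) = - integral\<^sup>L lborel (\<lambda>p. g p * \<psi> p))"

definition weak_dy :: "(real \<times> real) set \<Rightarrow> (real \<times> real \<Rightarrow> real) \<Rightarrow> (real \<times> real \<Rightarrow> real) \<Rightarrow> bool" where
  "weak_dy U f g \<longleftrightarrow> loc_int U f \<and> loc_int U g \<and>
     (\<forall>\<psi>. test_fn U \<psi> \<longrightarrow>
        integral\<^sup>L lborel (\<lambda>p. f p * py \<psi> p) = - integral\<^sup>L lborel (\<lambda>p. g p * \<psi> p))"

definition real_analytic_at :: "(real \<times> real \<Rightarrow> real) \<Rightarrow> real \<times> real \<Rightarrow> bool" where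
  "real_analytic_at f p \<longleftrightarrow> (\<exists>c :: nat \<Rightarrow> nat \<Rightarrow> real. \<exists>r>0. \<forall>q. dist q p < r \<longrightarrow>
     ((\<lambda>ij. c (fst ij) (snd ij) * (fst q - fst p) ^ fst ij * (snd q - snd p) ^ snd ij)
        has_sum f q) UNIV)"

definition singular_sol :: "real \<Rightarrow> (real \<times> real \<Rightarrow> real) \<Rightarrow> (real \<times> real \<Rightarrow> real) \<Rightarrow> bool" where
  "singular_sol R u v \<longleftrightarrow>
     continuous_on (strip R) u \<and> continuous_on (strip R) v \<and>
     (\<exists>ux uy vx vy.
        weak_dx (open_strip R) u ux \<and> weak_dy (open_strip R) u uy \<and>
        weak_dx (open_strip R) v vx \<and> weak_dy (open_strip R) v vy \<and>
        (AE p in lborel. p \<in> open_strip R \<longrightarrow>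
           ux p = vy p \<and> vx p = - 2 * sqrt ((v p)\<^sup>2 + (snd p)\<^sup>2) * uy p) \<and>
        loc_int (open_strip R) (\<lambda>p. vx p / sqrt ((v p)\<^sup>2 + (snd p)\<^sup>2)) \<and>
        (\<forall>\<psi>. test_fn (open_strip R) \<psi> \<longrightarrow>
           integral\<^sup>L lborel (\<lambda>p. vx p / sqrt ((v p)\<^sup>2 + (snd p)\<^sup>2) * px \<psi> p
                                  + 2 * vy p * py \<psi> p) = 0)) \<and>
     (\<forall>p \<in> open_strip R - {(x, 0) | x. v (x, 0) = 0}.
        real_analytic_at u p \<and> real_analytic_at v p \<and>
        px u p = py v p \<and> px v p = - 2 * sqrt ((v p)\<^sup>2 + (snd p)\<^sup>2) * py u p) \<and>
     (\<exists>U V :: real \<Rightarrow> real \<times> real \<Rightarrow> real.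
        (\<forall>b>0. Ck_strip R 2 (U b) \<and> Ck_strip R 2 (V b) \<and> dagger_on_strip R b (U b) (V b)) \<and>
        uniform_limit (strip R) U u (at_right 0) \<and>
        uniform_limit (strip R) V v (at_right 0))"

definition assoc_sol :: "real \<Rightarrow> real \<Rightarrow> real \<Rightarrow> real \<Rightarrow> (real \<Rightarrow> real) \<Rightarrow> (real \<Rightarrow> real)
    \<Rightarrow> (real \<times> real \<Rightarrow> real) \<Rightarrow> (real \<times> real \<Rightarrow> real) \<Rightarrow> bool" where
  "assoc_sol R P \<alpha> a \<phi>p \<phi>m u v \<longleftrightarrow>
     (\<forall>p\<in>strip R. u (fst p + P, snd p) = u p \<and> v (fst p + P, snd p) = v p) \<and>
     u (0, 0) = 0 \<and>
     (\<forall>x. v (x, R) = \<phi>p x \<and> v (x, -R) = \<phi>m x) \<and>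
     (if a \<noteq> 0
      then Cka_strip R 3 \<alpha> u \<and> Cka_strip R 3 \<alpha> v \<and> dagger_on_strip R a u v
      else singular_sol R u v)"

text \<open>Lift to C^3 of N_{a,b,c}; this set is invariant under the Z-action
  (z1,z2,z3) -> (z1,z2,z3+nP) because u is P-periodic in x.\<close>
definition N_lift :: "real \<Rightarrow> (real \<times> real \<Rightarrow> real) \<Rightarrow> (real \<times> real \<Rightarrow> real) \<Rightarrow> real \<Rightarrow> real
    \<Rightarrow> (complex \<times> complex \<times> complex) set" where
  "N_lift R u v a c = {(z1, z2, z3). (cmod z1)\<^sup>2 - (cmod z2)\<^sup>2 = 2 * a \<and>
     (\<exists>x y. -R < y \<and> y < R \<and>
        z1 * z2 = complex_of_real (v (x, y)) + \<i> * complex_of_real y \<and>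
        z3 = complex_of_real x + \<i> * complex_of_real (u (x, y)) + \<i> * complex_of_real c)}"

definition V_lift :: "real \<Rightarrow> (complex \<times> complex \<times> complex) set" where
  "V_lift R = {(z1, z2, z3). \<bar>Im (z1 * z2)\<bar> < R}"

definition Zshift :: "real \<Rightarrow> int \<Rightarrow> complex \<times> complex \<times> complex \<Rightarrow> complex \<times> complex \<times> complex" where
  "Zshift P n z = (fst z, fst (snd z), snd (snd z) + of_int n * complex_of_real P)"

end

theory Submission
  imports Defs
begin

text \<open>
  The map is \<open>F(z) = (a, b, Im z\<^sub>3 - u\<^bsub>a,b\<^esub>(x, y))\<close> with \<open>a = (|z\<^sub>1|\<^sup>2 - |z\<^sub>2|\<^sup>2)/2\<close>, \<open>x = Re z\<^sub>3\<close>,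
  \<open>y = Im z\<^sub>1z\<^sub>2\<close> and \<open>b\<close> the unique solution of \<open>v\<^bsub>a,b\<^esub>(x, y) = Re z\<^sub>1z\<^sub>2\<close>. So one needs that
  \<open>v\<^bsub>a,b\<^esub>(x, y)\<close> is a strictly increasing bijection in \<open>b\<close> and that \<open>u\<close>, \<open>v\<close> are jointly continuous in
  \<open>(a, b, x, y)\<close>, both also at \<open>a = 0\<close> and at the singular points.

  Continuity. Two solutions with the same \<open>a \<noteq> 0\<close> differ by the gradient of a potential \<open>h\<close> that solves a
  linear divergence form equation; a weighted integral of \<open>h\<^sup>2\<close> in \<open>x\<close> is an almost convex function of \<open>y\<close>,
  uniformly in \<open>a\<close>, so \<open>h\<close> is small if the boundary values of \<open>v\<close> are close. Hence line averages of \<open>u\<close> and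
  \<open>v\<close> are close, and the maximum principle together with energy bounds uniform in \<open>a\<close> turns this into
  pointwise closeness. At \<open>a = 0\<close> one compares with the regular solutions that approximate the singular one.

  Strict monotonicity. Weak monotonicity follows from an \<open>L\<^sup>1\<close> comparison principle, which applies to
  translates in \<open>x\<close> as well. Therefore equality at one point for two values of \<open>b\<close> forces equality on
  a horizontal segment for the values in between. There the weighted average \<open>M\<close> of the
  difference vanishes together with its \<open>y\<close>-derivative, and \<open>M'' \<le> c M / |y|\<close> forces \<open>M = 0\<close> up
  to the boundary, where the data differ.
\<close>

section \<open>Calculus on intervals and rectangles\<close>

lemma integral_real_derivative:
  fixes f f' :: "real \<Rightarrow> real"
  assumes "a \<le> b" "\<And>x. x \<in> {a..b} \<Longrightarrow> (f has_real_derivative f' x) (at x)"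
  shows "integral {a..b} f' = f b - f a"
  by (rule integral_unique, rule fundamental_theorem_of_calculus)
    (use assms in \<open>auto simp: has_real_derivative_iff_has_vector_derivative[symmetric]
      intro: has_field_derivative_at_within\<close>)

lemma integral_by_parts_vanishing:
  fixes f g f' g' :: "real \<Rightarrow> real"
  assumes "a \<le> b" "\<And>x. x \<in> {a..b} \<Longrightarrow> (f has_real_derivative f' x) (at x)"
    "\<And>x. x \<in> {a..b} \<Longrightarrow> (g has_real_derivative g' x) (at x)"
    "continuous_on {a..b} f'" "continuous_on {a..b} g'" "f a * g a = f b * g b"
  shows "integral {a..b} (\<lambda>x. f x * g' x) = - integral {a..b} (\<lambda>x. f' x * g x)"
proof -
  have cont: "continuous_on {a..b} f" "continuous_on {a..b} g"
    using assms(2,3) by (meson DERIV_isCont continuous_at_imp_continuous_on)+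
  have "integral {a..b} (\<lambda>x. f' x * g x + f x * g' x) = f b * g b - f a * g a"
    by (rule integral_real_derivative[where f = "\<lambda>x. f x * g x"])
      (use assms in \<open>auto intro!: derivative_eq_intros\<close>)
  moreover have "integral {a..b} (\<lambda>x. f' x * g x + f x * g' x)
      = integral {a..b} (\<lambda>x. f' x * g x) + integral {a..b} (\<lambda>x. f x * g' x)"
    by (rule Henstock_Kurzweil_Integration.integral_add)
      (auto intro!: integrable_continuous_real continuous_intros assms cont)
  ultimately show ?thesis using assms(6) by linarith
qed

lemma abs_diff_le_of_bounded_derivative:
  fixes f f' :: "real \<Rightarrow> real"
  assumes "convex S" "\<And>z. z \<in> S \<Longrightarrow> (f has_real_derivative f' z) (at z)" "\<And>z. z \<in> S \<Longrightarrow> \<bar>f' z\<bar> \<le> K"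
    "x \<in> S" "y \<in> S"
  shows "\<bar>f x - f y\<bar> \<le> K * \<bar>x - y\<bar>"
  using field_differentiable_bound[of S f f' K x y] assms
  by (simp add: has_field_derivative_at_within)

lemma continuous_on_Pair_compose:
  assumes "continuous_on T f" "continuous_on S X" "continuous_on S Y" "\<And>z. z \<in> S \<Longrightarrow> (X z, Y z) \<in> T"
  shows "continuous_on S (\<lambda>z. f (X z, Y z))"
  by (rule continuous_on_compose2[OF assms(1)]) (use assms in \<open>auto intro!: continuous_intros\<close>)

lemma continuous_on_Times_lines:
  fixes f :: "real \<times> real \<Rightarrow> real"
  assumes "continuous_on (X \<times> Y) f"
  shows "x \<in> X \<Longrightarrow> continuous_on Y (\<lambda>y. f (x, y))" "y \<in> Y \<Longrightarrow> continuous_on X (\<lambda>x. f (x, y))"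
  by (auto intro!: continuous_on_Pair_compose[OF assms] continuous_intros)

lemma continuous_on_integral_snd:
  fixes f :: "real \<times> real \<Rightarrow> real"
  assumes "continuous_on (U \<times> {c..d}) f"
  shows "continuous_on U (\<lambda>x. integral {c..d} (\<lambda>y. f (x, y)))"
  using integral_continuous_on_param[of U c d "\<lambda>x y. f (x, y)"] assms
  by (simp add: case_prod_unfold)

lemma continuous_on_integral_fst:
  fixes f :: "real \<times> real \<Rightarrow> real"
  assumes "continuous_on ({c..d} \<times> U) f"
  shows "continuous_on U (\<lambda>y. integral {c..d} (\<lambda>x. f (x, y)))"
proof -
  have "continuous_on (U \<times> {c..d}) (\<lambda>z. f (snd z, fst z))"
    by (rule continuous_on_Pair_compose[OF assms]) (auto intro!: continuous_intros)
  then show ?thesis using continuous_on_integral_snd[of U c d "\<lambda>z. f (snd z, fst z)"] by simp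
qed

lemma has_real_derivative_integral_fst:
  fixes f fy :: "real \<times> real \<Rightarrow> real"
  assumes "\<And>x y. y \<in> {c<..<d} \<Longrightarrow> x \<in> {x1..x2} \<Longrightarrow> ((\<lambda>t. f (x, t)) has_real_derivative fy (x, y)) (at y)"
    and "\<And>y. y \<in> {c<..<d} \<Longrightarrow> continuous_on {x1..x2} (\<lambda>x. f (x, y))"
    and "continuous_on ({x1..x2} \<times> {c<..<d}) fy" and "y0 \<in> {c<..<d}"
  shows "((\<lambda>y. integral {x1..x2} (\<lambda>x. f (x, y))) has_real_derivative
           integral {x1..x2} (\<lambda>x. fy (x, y0))) (at y0)"
proof -
  have "((\<lambda>y. integral (cbox x1 x2) (\<lambda>x. f (x, y))) has_real_derivative
           integral (cbox x1 x2) (\<lambda>x. fy (x, y0))) (at y0 within {c<..<d})"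
  proof (rule leibniz_rule_field_derivative)
    show "((\<lambda>y. f (x, y)) has_real_derivative fy (x, y)) (at y within {c<..<d})"
      if "y \<in> {c<..<d}" "x \<in> cbox x1 x2" for x y
      using assms(1) that by (simp add: has_field_derivative_at_within)
    show "(\<lambda>x. f (x, y)) integrable_on cbox x1 x2" if "y \<in> {c<..<d}" for y
      using assms(2)[OF that] by (simp add: integrable_continuous_real)
    show "continuous_on ({c<..<d} \<times> cbox x1 x2) (\<lambda>(y, x). fy (x, y))"
      unfolding case_prod_unfold
      by (rule continuous_on_Pair_compose[OF assms(3)]) (auto intro!: continuous_intros)
  qed (use assms in simp_all)
  then show ?thesis using at_within_open[OF assms(4)] by simp
qed

lemma has_real_derivative_integral_snd:
  fixes f fx :: "real \<times> real \<Rightarrow> real"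
  assumes "\<And>x y. x \<in> {c<..<d} \<Longrightarrow> y \<in> {y1..y2} \<Longrightarrow> ((\<lambda>t. f (t, y)) has_real_derivative fx (x, y)) (at x)"
    and "\<And>x. x \<in> {c<..<d} \<Longrightarrow> continuous_on {y1..y2} (\<lambda>y. f (x, y))"
    and "continuous_on ({c<..<d} \<times> {y1..y2}) fx" and "x0 \<in> {c<..<d}"
  shows "((\<lambda>x. integral {y1..y2} (\<lambda>y. f (x, y))) has_real_derivative
           integral {y1..y2} (\<lambda>y. fx (x0, y))) (at x0)"
proof -
  have "continuous_on ({y1..y2} \<times> {c<..<d}) (\<lambda>z. fx (snd z, fst z))"
    by (rule continuous_on_Pair_compose[OF assms(3)]) (auto intro!: continuous_intros)
  then show ?thesis
    using has_real_derivative_integral_fst[of c d y1 y2 "\<lambda>z. f (snd z, fst z)" "\<lambda>z. fx (snd z, fst z)" x0]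
      assms by simp
qed

lemma mixed_partials_eq:
  fixes f fx fy fxy fyx :: "real \<times> real \<Rightarrow> real"
  assumes dx: "\<And>x y. \<bar>y\<bar> < R \<Longrightarrow> ((\<lambda>t. f (t, y)) has_real_derivative fx (x, y)) (at x)"
    and dy: "\<And>x y. \<bar>y\<bar> < R \<Longrightarrow> ((\<lambda>t. f (x, t)) has_real_derivative fy (x, y)) (at y)"
    and dxy: "\<And>x y. \<bar>y\<bar> < R \<Longrightarrow> ((\<lambda>t. fx (x, t)) has_real_derivative fxy (x, y)) (at y)"
    and dyx: "\<And>x y. \<bar>y\<bar> < R \<Longrightarrow> ((\<lambda>t. fy (t, y)) has_real_derivative fyx (x, y)) (at x)"
    and cont: "continuous_on (open_strip R) fx" "continuous_on (open_strip R) fxy"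
    and y: "\<bar>y\<bar> < R"
  shows "fxy (x, y) = fyx (x, y)"
proof -
  have lines: "continuous_on A (\<lambda>t. fx (t, y))" "continuous_on A (\<lambda>t. fxy (t, y))" if "\<bar>y\<bar> < R" for A y
    by (rule continuous_on_Pair_compose[OF cont(1)] continuous_on_Pair_compose[OF cont(2)];
        use that in \<open>auto intro!: continuous_intros simp: open_strip_def\<close>)+
  have integral_fxy: "integral {x-1..z} (\<lambda>t. fxy (t, y)) = fy (z, y) - fy (x - 1, y)" if z: "x - 1 \<le> z" for z
  proof (rule DERIV_unique)
    show "((\<lambda>y. integral {x-1..z} (\<lambda>t. fx (t, y))) has_real_derivative
        integral {x-1..z} (\<lambda>t. fxy (t, y))) (at y)"
      by (rule has_real_derivative_integral_fst[where c = "-R" and d = R])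
        (use dxy y lines in \<open>auto intro!: continuous_on_subset[OF cont(2)] simp: open_strip_def\<close>)
    have "((\<lambda>y. f (z, y) - f (x - 1, y)) has_real_derivative fy (z, y) - fy (x - 1, y)) (at y)"
      by (intro derivative_intros dy y)
    then show "((\<lambda>y. integral {x-1..z} (\<lambda>t. fx (t, y))) has_real_derivative fy (z, y) - fy (x - 1, y)) (at y)"
    proof (rule has_field_derivative_transform_within_open[of _ _ _ "{-R<..<R}"])
      show "f (z, t) - f (x - 1, t) = integral {x-1..z} (\<lambda>s. fx (s, t))" if "t \<in> {-R<..<R}" for t
        using integral_real_derivative[OF z, of "\<lambda>s. f (s, t)" "\<lambda>s. fx (s, t)"] dx that by auto
    qed (use y in auto)
  qed
  show ?thesis
  proof (rule DERIV_unique)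
    have "((\<lambda>z. integral {x-1..z} (\<lambda>t. fxy (t, y))) has_real_derivative fxy (x, y)) (at x within {x-1..x+1})"
      by (rule integral_has_real_derivative) (use lines y in auto)
    then show "((\<lambda>z. integral {x-1..z} (\<lambda>t. fxy (t, y))) has_real_derivative fxy (x, y)) (at x)"
      by (simp add: at_within_Icc_at)
    have "((\<lambda>z. fy (z, y) - fy (x - 1, y)) has_real_derivative fyx (x, y)) (at x)"
      by (auto intro!: derivative_eq_intros dyx y)
    then show "((\<lambda>z. integral {x-1..z} (\<lambda>t. fxy (t, y))) has_real_derivative fyx (x, y)) (at x)"
      by (rule has_field_derivative_transform_within_open[of _ _ _ "{x-1<..}"]) (use integral_fxy in auto)
  qed
qed

lemma integrable_continuous_rectangle:
  fixes f :: "real \<times> real \<Rightarrow> real"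
  assumes "continuous_on ({x1..x2} \<times> {y1..y2}) f"
  shows "f integrable_on {x1..x2} \<times> {y1..y2}"
  using integrable_continuous[of "(x1, y1)" "(x2, y2)" f] assms by (simp add: cbox_Pair_eq)

lemma integral_rectangle:
  fixes f :: "real \<times> real \<Rightarrow> real"
  assumes "continuous_on ({x1..x2} \<times> {y1..y2}) f"
  shows integral_rectangle_dydx:
      "integral ({x1..x2} \<times> {y1..y2}) f = integral {x1..x2} (\<lambda>x. integral {y1..y2} (\<lambda>y. f (x, y)))"
    and integral_rectangle_dxdy:
      "integral ({x1..x2} \<times> {y1..y2}) f = integral {y1..y2} (\<lambda>y. integral {x1..x2} (\<lambda>x. f (x, y)))"
proof -
  have cont: "continuous_on (cbox (x1, y1) (x2, y2)) (\<lambda>(x, y). f (x, y))"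
    using assms by (simp add: cbox_Pair_eq case_prod_unfold)
  show dydx: "integral ({x1..x2} \<times> {y1..y2}) f = integral {x1..x2} (\<lambda>x. integral {y1..y2} (\<lambda>y. f (x, y)))"
    using integral_prod_continuous[OF cont] by (simp add: cbox_Pair_eq)
  show "integral ({x1..x2} \<times> {y1..y2}) f = integral {y1..y2} (\<lambda>y. integral {x1..x2} (\<lambda>x. f (x, y)))"
    using integral_swap_continuous[OF cont] by (simp add: dydx)
qed

lemma integral_rectangle_const:
  fixes c :: real
  assumes "x1 \<le> x2" "y1 \<le> y2"
  shows "integral ({x1..x2} \<times> {y1..y2}) (\<lambda>_. c) = c * (x2 - x1) * (y2 - y1)"
  using assms by (simp add: integral_rectangle_dydx)

lemma integral_rectangle_swap:
  fixes f :: "real \<times> real \<Rightarrow> real"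
  assumes "continuous_on ({x1..x2} \<times> {y1..y2}) f"
  shows "integral ({y1..y2} \<times> {x1..x2}) (\<lambda>z. f (snd z, fst z)) = integral ({x1..x2} \<times> {y1..y2}) f"
proof -
  have "continuous_on ({y1..y2} \<times> {x1..x2}) (\<lambda>z. f (snd z, fst z))"
    by (rule continuous_on_Pair_compose[OF assms]) (auto intro!: continuous_intros)
  then show ?thesis by (simp add: integral_rectangle_dydx integral_rectangle_dxdy[OF assms])
qed

lemma continuous_nonneg_integral_rectangle_eq_0:
  fixes f :: "real \<times> real \<Rightarrow> real"
  assumes "continuous_on ({x1..x2} \<times> {y1..y2}) f" "x1 < x2" "y1 < y2"
    and "\<And>z. z \<in> {x1..x2} \<times> {y1..y2} \<Longrightarrow> 0 \<le> f z"
    and "integral ({x1..x2} \<times> {y1..y2}) f \<le> 0" and "z \<in> {x1..x2} \<times> {y1..y2}"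
  shows "f z = 0"
proof -
  have box: "{x1..x2} \<times> {y1..y2} = cbox (x1, y1) (x2, y2)" by (simp add: cbox_Pair_eq)
  have "0 \<le> integral ({x1..x2} \<times> {y1..y2}) f"
    by (intro Henstock_Kurzweil_Integration.integral_nonneg integrable_continuous_rectangle assms)
  with assms(5) have "integral ({x1..x2} \<times> {y1..y2}) f = 0" by linarith
  moreover have "box (x1, y1) (x2, y2) \<noteq> {}"
    using assms(2,3) by (auto simp: box_ne_empty Basis_prod_def)
  ultimately show ?thesis
    using assms integral_cbox_eq_0_iff[of "(x1, y1)" "(x2, y2)" f] by (simp add: box)
qed

lemma green_rectangle_zero:
  fixes A B Ax By :: "real \<times> real \<Rightarrow> real"
  assumes le: "x1 \<le> x2" "y1 \<le> y2"
    and cont: "continuous_on ({x1..x2} \<times> {y1..y2}) Ax" "continuous_on ({x1..x2} \<times> {y1..y2}) By"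
    and dA: "\<And>x y. x \<in> {x1..x2} \<Longrightarrow> y \<in> {y1..y2} \<Longrightarrow> ((\<lambda>t. A (t, y)) has_real_derivative Ax (x, y)) (at x)"
    and dB: "\<And>x y. x \<in> {x1..x2} \<Longrightarrow> y \<in> {y1..y2} \<Longrightarrow> ((\<lambda>t. B (x, t)) has_real_derivative By (x, y)) (at y)"
    and bA: "\<And>y. y \<in> {y1..y2} \<Longrightarrow> A (x1, y) = A (x2, y)"
    and bB: "\<And>x. x \<in> {x1..x2} \<Longrightarrow> B (x, y1) = B (x, y2)"
  shows "integral ({x1..x2} \<times> {y1..y2}) (\<lambda>z. Ax z + By z) = 0"
proof -
  have "integral ({x1..x2} \<times> {y1..y2}) Ax = integral {y1..y2} (\<lambda>y. 0)"
    unfolding integral_rectangle_dxdy[OF cont(1)]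
    by (rule integral_cong) (use integral_real_derivative[OF le(1) dA] bA in auto)
  moreover have "integral ({x1..x2} \<times> {y1..y2}) By = integral {x1..x2} (\<lambda>x. 0)"
    unfolding integral_rectangle_dydx[OF cont(2)]
    by (rule integral_cong) (use integral_real_derivative[OF le(2) dB] bB in auto)
  ultimately show ?thesis
    by (simp add: Henstock_Kurzweil_Integration.integral_add integrable_continuous_rectangle cont)
qed

lemma cauchy_schwarz_integral_weighted:
  fixes f w :: "real \<Rightarrow> real"
  assumes "a \<le> b" and cont: "continuous_on {a..b} f" "continuous_on {a..b} w"
    and w: "\<And>x. x \<in> {a..b} \<Longrightarrow> 0 < w x"
  shows "(integral {a..b} f)\<^sup>2 \<le> integral {a..b} (\<lambda>x. 1 / w x) * integral {a..b} (\<lambda>x. w x * (f x)\<^sup>2)"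
proof (cases "a = b")
  case False
  then have ab: "a < b" using \<open>a \<le> b\<close> by simp
  have cont_inv: "continuous_on {a..b} (\<lambda>x. 1 / w x)"
    using w by (intro continuous_intros cont) (auto simp: less_imp_neq[symmetric])
  define F where "F = integral {a..b} f"
  define G where "G = integral {a..b} (\<lambda>x. 1 / w x)"
  define H where "H = integral {a..b} (\<lambda>x. w x * (f x)\<^sup>2)"
  have inv_nonneg: "0 \<le> 1 / w x" if "x \<in> {a..b}" for x using w[OF that] by simp
  have "G \<noteq> 0" unfolding G_def using integral_eq_0_iff[OF cont_inv ab inv_nonneg] ab w by force
  moreover have "0 \<le> G" unfolding G_def
    by (intro Henstock_Kurzweil_Integration.integral_nonneg integrable_continuous_real cont_inv inv_nonneg)
  ultimately have G: "0 < G" by simp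
  define c where "c = F / G"
  let ?g = "\<lambda>x. w x * (f x)\<^sup>2 - 2 * c * f x + c\<^sup>2 * (1 / w x)"
  note ints = integrable_continuous_real continuous_on_add continuous_on_diff continuous_on_mult
    continuous_on_power continuous_on_const cont cont_inv
  have "integral {a..b} ?g
      = integral {a..b} (\<lambda>x. w x * (f x)\<^sup>2 - 2 * c * f x) + integral {a..b} (\<lambda>x. c\<^sup>2 * (1 / w x))"
    by (intro Henstock_Kurzweil_Integration.integral_add ints)
  also have "integral {a..b} (\<lambda>x. w x * (f x)\<^sup>2 - 2 * c * f x) = H - integral {a..b} (\<lambda>x. 2 * c * f x)"
    unfolding H_def by (intro Henstock_Kurzweil_Integration.integral_diff ints)
  also have "integral {a..b} (\<lambda>x. 2 * c * f x) = 2 * c * F" unfolding F_def by simp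
  also have "integral {a..b} (\<lambda>x. c\<^sup>2 * (1 / w x)) = c\<^sup>2 * G" unfolding G_def by (rule integral_mult_right)
  also have "H - 2 * c * F + c\<^sup>2 * G = H - F\<^sup>2 / G" using G by (simp add: c_def field_simps power2_eq_square)
  finally have "integral {a..b} ?g = H - F\<^sup>2 / G" .
  moreover have "0 \<le> integral {a..b} ?g"
  proof (intro Henstock_Kurzweil_Integration.integral_nonneg ints)
    fix x assume x: "x \<in> {a..b}"
    have "?g x = (w x * f x - c)\<^sup>2 / w x" using w[OF x] by (simp add: field_simps power2_eq_square)
    then show "0 \<le> ?g x" using w[OF x] by simp
  qed
  ultimately have "0 \<le> H - F\<^sup>2 / G" by (simp only:)
  then have "F\<^sup>2 \<le> G * H" using G by (simp add: field_simps)
  then show ?thesis by (simp add: F_def G_def H_def)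
qed simp

lemma has_real_derivative_max0:
  fixes g g' :: "real \<Rightarrow> real"
  assumes deriv: "\<And>t. (g has_real_derivative g' t) (at t)" and g'0: "g' 0 = 0"
  shows "((\<lambda>t. g (max 0 t)) has_real_derivative g' (max 0 t)) (at t)"
proof -
  consider (neg) "t < 0" | (pos) "t > 0" | (zero) "t = 0" by linarith
  then show ?thesis
  proof cases
    case neg
    have "((\<lambda>t. g 0) has_real_derivative g' (max 0 t)) (at t)" using g'0 neg by (simp add: max_def)
    then show ?thesis
      by (rule has_field_derivative_transform_within_open[of _ _ _ "{..<0}"]) (use neg in auto)
  next
    case pos
    have "(g has_real_derivative g' (max 0 t)) (at t)" using deriv[of t] pos by (simp add: max_def)
    then show ?thesis
      by (rule has_field_derivative_transform_within_open[of _ _ _ "{0<..}"]) (use pos in auto)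
  next
    case zero
    have "((\<lambda>h. (g h - g 0) / h) \<longlongrightarrow> 0) (at 0)"
      using deriv[of 0] g'0 by (simp add: has_field_derivative_iff)
    then have "((\<lambda>h. norm ((g h - g 0) / h)) \<longlongrightarrow> 0) (at 0)" by (rule tendsto_norm_zero)
    then have "((\<lambda>h. (g (max 0 h) - g 0) / h) \<longlongrightarrow> 0) (at 0)"
      by (rule Lim_null_comparison[rotated])
        (auto simp: max_def divide_nonneg_neg intro!: always_eventually)
    then show ?thesis using g'0 zero by (simp add: has_field_derivative_iff)
  qed
qed

section \<open>Classical solutions\<close>

definition rad :: "real \<Rightarrow> real \<Rightarrow> real \<Rightarrow> real" where
  "rad a v y = sqrt (v\<^sup>2 + y\<^sup>2 + a\<^sup>2)"

lemma rad_nonneg: "0 \<le> rad a v y" by (simp add: rad_def)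

lemma rad_minus [simp]: "rad a (- v) y = rad a v y" by (simp add: rad_def)

lemma abs_le_rad: "\<bar>a\<bar> \<le> rad a v y"
  unfolding rad_def by (rule real_le_rsqrt) (simp add: power2_eq_square[symmetric])

lemma rad_pos: "a \<noteq> 0 \<Longrightarrow> 0 < rad a v y"
  using abs_le_rad[of a v y] by linarith

lemma rad_lipschitz: "\<bar>rad a v y - rad a v' y\<bar> \<le> \<bar>v - v'\<bar>"
  using norm_triangle_ineq3[of "(v, sqrt (y\<^sup>2 + a\<^sup>2))" "(v', sqrt (y\<^sup>2 + a\<^sup>2))"]
  by (simp add: norm_Pair rad_def add.assoc)

lemma rad_lipschitz_parameter: "\<bar>rad a v y - rad a' v y\<bar> \<le> \<bar>a - a'\<bar>"
  using norm_triangle_ineq3[of "(sqrt (v\<^sup>2 + y\<^sup>2), a)" "(sqrt (v\<^sup>2 + y\<^sup>2), a')"]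
  by (simp add: norm_Pair rad_def)

lemma continuous_on_rad [continuous_intros]:
  "continuous_on S f \<Longrightarrow> continuous_on S g \<Longrightarrow> continuous_on S (\<lambda>z. rad a (f z) (g z))"
  unfolding rad_def by (intro continuous_intros)

lemma open_open_strip: "open (open_strip R)"
  unfolding open_strip_def by (intro open_Collect_less continuous_intros)

lemma open_strip_subset_strip: "open_strip R \<subseteq> strip R"
  by (auto simp: open_strip_def strip_def)

lemma Times_subset_open_strip:
  "\<bar>y1\<bar> < R \<Longrightarrow> \<bar>y2\<bar> < R \<Longrightarrow> X \<times> {y1..y2} \<subseteq> open_strip R"
  by (auto simp: open_strip_def)

lemma continuous_on_horizontal_line:
  fixes f :: "real \<times> real \<Rightarrow> real"
  assumes "continuous_on (open_strip R) f" "\<bar>y\<bar> < R"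
  shows "continuous_on X (\<lambda>x. f (x, y))"
  by (rule continuous_on_Pair_compose[OF assms(1)])
    (use assms in \<open>auto simp: open_strip_def intro!: continuous_intros\<close>)

lemma continuous_on_vertical_line:
  fixes f :: "real \<times> real \<Rightarrow> real"
  assumes "continuous_on (open_strip R) f" "Y \<subseteq> {-R<..<R}"
  shows "continuous_on Y (\<lambda>y. f (x, y))"
  by (rule continuous_on_Pair_compose[OF assms(1)])
    (use assms in \<open>auto simp: open_strip_def abs_less_iff intro!: continuous_intros\<close>)

text \<open>Since \<open>\<partial>v/\<partial>y = \<partial>u/\<partial>x\<close>, a solution carries only the two first derivatives
  \<open>p = \<partial>u/\<partial>x\<close> and \<open>q = \<partial>u/\<partial>y\<close>.\<close>

locale dagger_C1 =
  fixes R a :: real and u v p q :: "real \<times> real \<Rightarrow> real"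
  assumes continuous: "continuous_on (open_strip R) u" "continuous_on (open_strip R) v"
      "continuous_on (open_strip R) p" "continuous_on (open_strip R) q"
    and u_dx: "\<bar>y\<bar> < R \<Longrightarrow> ((\<lambda>t. u (t, y)) has_real_derivative p (x, y)) (at x)"
    and u_dy: "\<bar>y\<bar> < R \<Longrightarrow> ((\<lambda>t. u (x, t)) has_real_derivative q (x, y)) (at y)"
    and v_dx: "\<bar>y\<bar> < R \<Longrightarrow> ((\<lambda>t. v (t, y)) has_real_derivative - 2 * rad a (v (x, y)) y * q (x, y)) (at x)"
    and v_dy: "\<bar>y\<bar> < R \<Longrightarrow> ((\<lambda>t. v (x, t)) has_real_derivative p (x, y)) (at y)"
begin

lemma continuous_on: "S \<subseteq> open_strip R \<Longrightarrow> continuous_on S u" "S \<subseteq> open_strip R \<Longrightarrow> continuous_on S v"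
  "S \<subseteq> open_strip R \<Longrightarrow> continuous_on S p" "S \<subseteq> open_strip R \<Longrightarrow> continuous_on S q"
  by (fact continuous_on_subset[OF continuous(1)] continuous_on_subset[OF continuous(2)]
      continuous_on_subset[OF continuous(3)] continuous_on_subset[OF continuous(4)])+

lemmas derivs = u_dx u_dy v_dx v_dy

lemma q_periodic:
  assumes per: "\<And>x y. \<bar>y\<bar> < R \<Longrightarrow> u (x + P, y) = u (x, y)" and y: "\<bar>y\<bar> < R"
  shows "q (x + P, y) = q (x, y)"
proof -
  have "((\<lambda>t. u (x + P, t)) has_real_derivative q (x, y)) (at y)"
    by (rule has_field_derivative_transform_within_open[OF u_dy[OF y], of "{-R<..<R}"])
      (use per y in auto)
  then show ?thesis by (rule DERIV_unique[OF u_dy[OF y]])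
qed

end

locale dagger_C2 = dagger_C1 +
  fixes r s :: "real \<times> real \<Rightarrow> real"
  assumes continuous2: "continuous_on (open_strip R) r" "continuous_on (open_strip R) s"
    and p_dx: "\<bar>y\<bar> < R \<Longrightarrow> ((\<lambda>t. p (t, y)) has_real_derivative s (x, y)) (at x)"
    and p_dy: "\<bar>y\<bar> < R \<Longrightarrow> ((\<lambda>t. p (x, t)) has_real_derivative r (x, y)) (at y)"
    and q_dx: "\<bar>y\<bar> < R \<Longrightarrow> ((\<lambda>t. q (t, y)) has_real_derivative r (x, y)) (at x)"
    and vx_dy: "\<bar>y\<bar> < R \<Longrightarrow>
      ((\<lambda>t. - 2 * rad a (v (x, t)) t * q (x, t)) has_real_derivative s (x, y)) (at y)"
begin

lemma continuous_on2: "S \<subseteq> open_strip R \<Longrightarrow> continuous_on S r" "S \<subseteq> open_strip R \<Longrightarrow> continuous_on S s"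
  by (fact continuous_on_subset[OF continuous2(1)] continuous_on_subset[OF continuous2(2)])+

lemmas derivs2 = p_dx p_dy q_dx vx_dy

lemma minus: "dagger_C2 R a (\<lambda>z. - u z) (\<lambda>z. - v z) (\<lambda>z. - p z) (\<lambda>z. - q z) (\<lambda>z. - r z) (\<lambda>z. - s z)"
proof unfold_locales
  show "((\<lambda>t. - 2 * rad a (- v (x, t)) t * - q (x, t)) has_real_derivative - s (x, y)) (at y)"
    if "\<bar>y\<bar> < R" for x y
    using DERIV_minus[OF vx_dy[OF that]] by simp
qed (auto intro!: continuous_intros continuous continuous2 derivative_eq_intros derivs derivs2)

lemma translate:
  "dagger_C2 R a (\<lambda>z. u (fst z + t, snd z)) (\<lambda>z. v (fst z + t, snd z)) (\<lambda>z. p (fst z + t, snd z))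
    (\<lambda>z. q (fst z + t, snd z)) (\<lambda>z. r (fst z + t, snd z)) (\<lambda>z. s (fst z + t, snd z))"
proof -
  have cont: "continuous_on (open_strip R) (\<lambda>z. f (fst z + t, snd z))"
    if "continuous_on (open_strip R) f" for f :: "real \<times> real \<Rightarrow> real"
    by (rule continuous_on_Pair_compose[OF that]) (auto simp: open_strip_def intro!: continuous_intros)
  have shift: "((\<lambda>x. f (x + t)) has_real_derivative D) (at x)"
    if "(f has_real_derivative D) (at (x + t))" for f D x
    using that DERIV_shift by blast
  show ?thesis
    by (unfold_locales, unfold fst_conv snd_conv)
      (fact cont[OF continuous(1)] cont[OF continuous(2)] cont[OF continuous(3)] cont[OF continuous(4)]
        cont[OF continuous2(1)] cont[OF continuous2(2)] shift[OF u_dx] shift[OF v_dx] shift[OF p_dx]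
        shift[OF q_dx] u_dy v_dy p_dy vx_dy)+
qed

end

lemma Ck_strip_continuous:
  "Ck_strip R k f \<Longrightarrow> length ds \<le> k \<Longrightarrow> continuous_on (strip R) (pdS R ds f)"
  by (simp add: Ck_strip_def)

lemma Ck_strip_deriv_x:
  assumes "Ck_strip R k f" "length ds < k" "\<bar>y\<bar> < R"
  shows "((\<lambda>t. pdS R ds f (t, y)) has_real_derivative px (pdS R ds f) (x, y)) (at x)"
proof -
  have "(x, y) \<in> strip R" using assms by (simp add: strip_def)
  then have "(\<lambda>t. pdS R ds f (t, y)) differentiable (at x)"
    using assms(1,2) unfolding Ck_strip_def by fastforce
  then show ?thesis by (simp add: px_def DERIV_deriv_iff_real_differentiable)
qed

lemma Ck_strip_deriv_y:
  assumes "Ck_strip R k f" "length ds < k" "\<bar>y\<bar> < R"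
  shows "((\<lambda>t. pdS R ds f (x, t)) has_real_derivative pyS R (pdS R ds f) (x, y)) (at y)"
proof -
  have "(x, y) \<in> strip R" using assms by (simp add: strip_def)
  then have "(\<lambda>t. pdS R ds f (x, t)) differentiable (at y within {-R..R})"
    using assms(1,2) unfolding Ck_strip_def by fastforce
  moreover have "at y within {-R..R} = at y" using assms by (intro at_within_Icc_at) auto
  ultimately show ?thesis
    by (simp add: pyS_def vector_derivative_works has_real_derivative_iff_has_vector_derivative)
qed

lemma Ck_strip_mixed_partials:
  assumes "Ck_strip R 2 f" "\<bar>y\<bar> < R"
  shows "pyS R (px f) (x, y) = px (pyS R f) (x, y)"
proof (rule mixed_partials_eq[of R f "px f" "pyS R f"])
  note cont = continuous_on_subset[OF Ck_strip_continuous[OF assms(1)] open_strip_subset_strip]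
  show "continuous_on (open_strip R) (px f)" "continuous_on (open_strip R) (pyS R (px f))"
    using cont[of "[False]"] cont[of "[True, False]"] by simp_all
qed (use Ck_strip_deriv_x[OF assms(1), of "[]"] Ck_strip_deriv_y[OF assms(1), of "[]"]
    Ck_strip_deriv_x[OF assms(1), of "[True]"] Ck_strip_deriv_y[OF assms(1), of "[False]"] assms(2) in simp_all)

theorem dagger_on_strip_imp_dagger_C2:
  assumes u: "Ck_strip R 2 u" and v: "Ck_strip R 2 v" and dagger: "dagger_on_strip R a u v"
  shows "dagger_C2 R a u v (px u) (pyS R u) (px (pyS R u)) (px (px u))"
proof -
  note cont_u = continuous_on_subset[OF Ck_strip_continuous[OF u] open_strip_subset_strip]
    and cont_v = continuous_on_subset[OF Ck_strip_continuous[OF v] open_strip_subset_strip]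
  have vy: "pyS R v (x, y) = px u (x, y)" and vx: "px v (x, y) = - 2 * rad a (v (x, y)) y * pyS R u (x, y)"
    if "\<bar>y\<bar> < R" for x y
    using dagger that by (auto simp: dagger_on_strip_def strip_def rad_def)
  show ?thesis
  proof
    show "continuous_on (open_strip R) u" "continuous_on (open_strip R) v"
      "continuous_on (open_strip R) (px u)" "continuous_on (open_strip R) (pyS R u)"
      "continuous_on (open_strip R) (px (pyS R u))" "continuous_on (open_strip R) (px (px u))"
      using cont_u[of "[]"] cont_v[of "[]"] cont_u[of "[False]"] cont_u[of "[True]"]
        cont_u[of "[False, True]"] cont_u[of "[False, False]"] by simp_all
    fix x y assume y: "\<bar>y\<bar> < R"
    show "((\<lambda>t. u (t, y)) has_real_derivative px u (x, y)) (at x)"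
      "((\<lambda>t. u (x, t)) has_real_derivative pyS R u (x, y)) (at y)"
      "((\<lambda>t. px u (t, y)) has_real_derivative px (px u) (x, y)) (at x)"
      "((\<lambda>t. pyS R u (t, y)) has_real_derivative px (pyS R u) (x, y)) (at x)"
      using Ck_strip_deriv_x[OF u _ y, of "[]"] Ck_strip_deriv_y[OF u _ y, of "[]"]
        Ck_strip_deriv_x[OF u _ y, of "[False]"] Ck_strip_deriv_x[OF u _ y, of "[True]"] by simp_all
    show "((\<lambda>t. px u (x, t)) has_real_derivative px (pyS R u) (x, y)) (at y)"
      using Ck_strip_deriv_y[OF u _ y, of "[False]" x] Ck_strip_mixed_partials[OF u y] by simp
    show "((\<lambda>t. v (t, y)) has_real_derivative - 2 * rad a (v (x, y)) y * pyS R u (x, y)) (at x)"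
      using Ck_strip_deriv_x[OF v _ y, of "[]" x] vx[OF y] by simp
    show "((\<lambda>t. v (x, t)) has_real_derivative px u (x, y)) (at y)"
      using Ck_strip_deriv_y[OF v _ y, of "[]" x] vy[OF y] by simp
    have "px (pyS R v) (x, y) = px (px u) (x, y)"
      by (simp add: px_def[of "pyS R v"] px_def[of "px u"] vy[OF y])
    then have "((\<lambda>t. px v (x, t)) has_real_derivative px (px u) (x, y)) (at y)"
      using Ck_strip_deriv_y[OF v _ y, of "[False]" x] Ck_strip_mixed_partials[OF v y] by simp
    then show "((\<lambda>t. - 2 * rad a (v (x, t)) t * pyS R u (x, t)) has_real_derivative px (px u) (x, y)) (at y)"
      by (rule has_field_derivative_transform_within_open[of _ _ _ "{-R<..<R}"]) (use y vx in auto)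
  qed
qed

section \<open>The maximum principle\<close>

definition max_principle_on :: "real set \<Rightarrow> real set \<Rightarrow> (real \<times> real \<Rightarrow> real) \<Rightarrow> bool" where
  "max_principle_on X Y f \<longleftrightarrow> (\<forall>x1 x2 y1 y2 c. x1 < x2 \<longrightarrow> y1 < y2 \<longrightarrow> {x1..x2} \<subseteq> X \<longrightarrow> {y1..y2} \<subseteq> Y \<longrightarrow>
     (\<forall>x\<in>{x1..x2}. f (x, y1) \<le> c \<and> f (x, y2) \<le> c) \<longrightarrow>
     (\<forall>y\<in>{y1..y2}. f (x1, y) \<le> c \<and> f (x2, y) \<le> c) \<longrightarrow>
     (\<forall>x\<in>{x1..x2}. \<forall>y\<in>{y1..y2}. f (x, y) \<le> c))"

lemma max_principle_onD:
  assumes "max_principle_on X Y f" "x1 < x2" "y1 < y2" "{x1..x2} \<subseteq> X" "{y1..y2} \<subseteq> Y"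
    "\<And>x. x \<in> {x1..x2} \<Longrightarrow> f (x, y1) \<le> c \<and> f (x, y2) \<le> c"
    "\<And>y. y \<in> {y1..y2} \<Longrightarrow> f (x1, y) \<le> c \<and> f (x2, y) \<le> c"
    "x \<in> {x1..x2}" "y \<in> {y1..y2}"
  shows "f (x, y) \<le> c"
  using assms unfolding max_principle_on_def by blast

lemma max_principle_on_swap:
  assumes "max_principle_on X Y f" shows "max_principle_on Y X (\<lambda>z. f (snd z, fst z))"
  unfolding max_principle_on_def fst_conv snd_conv
proof (intro allI impI ballI)
  fix y1 y2 x1 x2 c y x
  assume "y1 < y2" "x1 < x2" "{y1..y2} \<subseteq> Y" "{x1..x2} \<subseteq> X" "y \<in> {y1..y2}" "x \<in> {x1..x2}"
    "\<forall>y\<in>{y1..y2}. f (x1, y) \<le> c \<and> f (x2, y) \<le> c" "\<forall>x\<in>{x1..x2}. f (x, y1) \<le> c \<and> f (x, y2) \<le> c"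
  then show "f (x, y) \<le> c" by (intro max_principle_onD[OF assms, of x1 x2 y1 y2]) auto
qed

lemma max_principle_on_subset:
  assumes f: "max_principle_on X Y f" and sub: "X' \<subseteq> X" "Y' \<subseteq> Y"
  shows "max_principle_on X' Y' f"
  unfolding max_principle_on_def
  by (intro allI impI ballI; rule max_principle_onD[OF f]) (use sub in auto)

lemma positive_part_square_has_derivative:
  "((\<lambda>t. (max 0 (t - c))\<^sup>2) has_real_derivative 2 * max 0 (t - c)) (at t)" for c t :: real
proof -
  have "((\<lambda>t. (max 0 t)\<^sup>2) has_real_derivative 2 * max 0 (t - c)) (at (t - c))"
    by (rule has_real_derivative_max0) (auto intro!: derivative_eq_intros)
  then have "((\<lambda>t. (max 0 (t - c))\<^sup>2) has_real_derivative 2 * max 0 (t - c) * 1) (at t)"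
    by (rule DERIV_chain2) (auto intro!: derivative_eq_intros)
  then show ?thesis by simp
qed

text \<open>Testing \<open>div (A, B) = 0\<close> with the square of the positive part of \<open>f - c\<close> shows that this positive
  part is constant on vertical lines.\<close>

context
  fixes f fx fy A B Ax By :: "real \<times> real \<Rightarrow> real" and x1 x2 y1 y2 c :: real
  assumes less: "x1 < x2" "y1 < y2"
    and cont: "\<And>g. g \<in> {f, fx, fy, A, B, Ax, By} \<Longrightarrow> continuous_on ({x1..x2} \<times> {y1..y2}) g"
    and df: "\<And>x y. y \<in> {y1..y2} \<Longrightarrow> ((\<lambda>t. f (t, y)) has_real_derivative fx (x, y)) (at x)"
      "\<And>x y. y \<in> {y1..y2} \<Longrightarrow> ((\<lambda>t. f (x, t)) has_real_derivative fy (x, y)) (at y)"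
    and dA: "\<And>x y. y \<in> {y1..y2} \<Longrightarrow> ((\<lambda>t. A (t, y)) has_real_derivative Ax (x, y)) (at x)"
    and dB: "\<And>x y. y \<in> {y1..y2} \<Longrightarrow> ((\<lambda>t. B (x, t)) has_real_derivative By (x, y)) (at y)"
    and div: "\<And>z. Ax z + By z = 0"
    and elliptic: "\<And>z. 0 \<le> fx z * A z + fy z * B z" "\<And>z. fx z * A z + fy z * B z = 0 \<Longrightarrow> fy z = 0"
    and boundary: "\<And>x. x \<in> {x1..x2} \<Longrightarrow> f (x, y1) \<le> c \<and> f (x, y2) \<le> c"
      "\<And>y. y \<in> {y1..y2} \<Longrightarrow> f (x1, y) \<le> c \<and> f (x2, y) \<le> c"
begin

lemma divergence_form_dissipation_eq_0:
  assumes z: "z \<in> {x1..x2} \<times> {y1..y2}"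
  shows "2 * max 0 (f z - c) * (fx z * A z + fy z * B z) = 0"
proof -
  let ?Q = "{x1..x2} \<times> {y1..y2}" and ?F = "\<lambda>z. (max 0 (f z - c))\<^sup>2" and ?F' = "\<lambda>z. 2 * max 0 (f z - c)"
  note chain = DERIV_chain2[OF positive_part_square_has_derivative]
  have conts: "continuous_on ?Q fx" "continuous_on ?Q fy" "continuous_on ?Q A" "continuous_on ?Q B"
    "continuous_on ?Q Ax" "continuous_on ?Q By" "continuous_on ?Q ?F" "continuous_on ?Q ?F'"
    by (intro continuous_intros cont; simp)+
  let ?Ax = "\<lambda>z. ?F' z * fx z * A z + ?F z * Ax z" and ?By = "\<lambda>z. ?F' z * fy z * B z + ?F z * By z"
  have "integral ?Q (\<lambda>z. ?Ax z + ?By z) = 0"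
  proof (rule green_rectangle_zero[where A = "\<lambda>z. ?F z * A z" and B = "\<lambda>z. ?F z * B z"])
    fix x y assume "x \<in> {x1..x2}" and y: "y \<in> {y1..y2}"
    show "((\<lambda>t. ?F (t, y) * A (t, y)) has_real_derivative ?Ax (x, y)) (at x)"
      by (rule DERIV_cong[OF DERIV_mult[OF chain[OF df(1)[OF y]] dA[OF y]]]) (simp add: algebra_simps)
    show "((\<lambda>t. ?F (x, t) * B (x, t)) has_real_derivative ?By (x, y)) (at y)"
      by (rule DERIV_cong[OF DERIV_mult[OF chain[OF df(2)[OF y]] dB[OF y]]]) (simp add: algebra_simps)
  qed (use less boundary in \<open>auto intro!: continuous_intros conts\<close>)
  moreover have "?Ax z + ?By z = ?F' z * (fx z * A z + fy z * B z)" for z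
    using div[of z] by (simp add: algebra_simps add_eq_0_iff)
  ultimately have integral_0: "integral ?Q (\<lambda>z. ?F' z * (fx z * A z + fy z * B z)) = 0"
    by (simp only:)
  show ?thesis
  proof (rule continuous_nonneg_integral_rectangle_eq_0[OF _ less _ eq_refl[OF integral_0] z])
    show "continuous_on ?Q (\<lambda>z. ?F' z * (fx z * A z + fy z * B z))" by (intro continuous_intros conts)
  qed (simp add: elliptic)
qed

lemma divergence_form_max_principle:
  assumes x: "x \<in> {x1..x2}" and y: "y \<in> {y1..y2}"
  shows "f (x, y) \<le> c"
proof -
  have "(max 0 (f (x, y) - c))\<^sup>2 - (max 0 (f (x, y1) - c))\<^sup>2
      = integral {y1..y} (\<lambda>t. 2 * max 0 (f (x, t) - c) * fy (x, t))"
    by (rule integral_real_derivative[symmetric])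
      (use y in \<open>auto intro!: DERIV_chain2[OF positive_part_square_has_derivative] df\<close>)
  also have "\<dots> = integral {y1..y} (\<lambda>t. 0)"
  proof (rule integral_cong)
    show "2 * max 0 (f (x, t) - c) * fy (x, t) = 0" if "t \<in> {y1..y}" for t
      using divergence_form_dissipation_eq_0[of "(x, t)"] elliptic(2)[of "(x, t)"] that x y by auto
  qed
  finally have "(max 0 (f (x, y) - c))\<^sup>2 = 0" using boundary(1)[OF x] by simp
  then show ?thesis by (simp add: max_def split: if_splits)
qed

end

context dagger_C2
begin

lemma max_principle_v:
  assumes "a \<noteq> 0" shows "max_principle_on UNIV {-R<..<R} v"
  unfolding max_principle_on_def
proof (intro allI impI ballI)
  fix x1 x2 y1 y2 c x y
  assume rect: "x1 < x2" "y1 < y2" "{y1..y2} \<subseteq> {-R<..<R}" "x \<in> {x1..x2}" "y \<in> {y1..y2}"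
    and boundary: "\<forall>x\<in>{x1..x2}. v (x, y1) \<le> c \<and> v (x, y2) \<le> c" "\<forall>y\<in>{y1..y2}. v (x1, y) \<le> c \<and> v (x2, y) \<le> c"
  have sub: "{x1..x2} \<times> {y1..y2} \<subseteq> open_strip R" and inside: "\<And>y. y \<in> {y1..y2} \<Longrightarrow> \<bar>y\<bar> < R"
    using rect by (auto simp: open_strip_def abs_less_iff)
  note conts = continuous_on[OF sub] continuous_on2[OF sub]
  show "v (x, y) \<le> c"
  proof (rule divergence_form_max_principle[where A = "\<lambda>z. - q z" and B = p and Ax = "\<lambda>z. - r z" and By = r
        and fx = "\<lambda>z. - 2 * rad a (v z) (snd z) * q z" and fy = p])
    fix z
    have dissip: "- 2 * rad a (v z) (snd z) * q z * - q z + p z * p z = 2 * rad a (v z) (snd z) * (q z)\<^sup>2 + (p z)\<^sup>2"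
      by (simp add: power2_eq_square)
    show "0 \<le> - 2 * rad a (v z) (snd z) * q z * - q z + p z * p z"
      unfolding dissip by (simp add: rad_nonneg)
    show "p z = 0" if "- 2 * rad a (v z) (snd z) * q z * - q z + p z * p z = 0"
      using that unfolding dissip by (simp add: add_nonneg_eq_0_iff rad_nonneg)
    show "((\<lambda>t. v (t, y)) has_real_derivative - 2 * rad a (v (x, y)) (snd (x, y)) * q (x, y)) (at x)"
      if "y \<in> {y1..y2}" for x y using v_dx[OF inside[OF that]] by simp
  qed (use rect boundary inside in \<open>auto intro!: conts continuous_intros derivs derivative_intros derivs2\<close>)
qed

lemma max_principle_u:
  assumes "a \<noteq> 0" shows "max_principle_on UNIV {-R<..<R} u"
  unfolding max_principle_on_def
proof (intro allI impI ballI)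
  fix x1 x2 y1 y2 c x y
  assume rect: "x1 < x2" "y1 < y2" "{y1..y2} \<subseteq> {-R<..<R}" "x \<in> {x1..x2}" "y \<in> {y1..y2}"
    and boundary: "\<forall>x\<in>{x1..x2}. u (x, y1) \<le> c \<and> u (x, y2) \<le> c" "\<forall>y\<in>{y1..y2}. u (x1, y) \<le> c \<and> u (x2, y) \<le> c"
  have sub: "{x1..x2} \<times> {y1..y2} \<subseteq> open_strip R" and inside: "\<And>y. y \<in> {y1..y2} \<Longrightarrow> \<bar>y\<bar> < R"
    using rect by (auto simp: open_strip_def abs_less_iff)
  note conts = continuous_on[OF sub] continuous_on2[OF sub]
  show "u (x, y) \<le> c"
  proof (rule divergence_form_max_principle[where A = p and B = "\<lambda>z. - (- 2 * rad a (v z) (snd z) * q z)"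
        and Ax = s and By = "\<lambda>z. - s z" and fx = p and fy = q])
    fix z
    have dissip: "p z * p z + q z * - (- 2 * rad a (v z) (snd z) * q z) = (p z)\<^sup>2 + 2 * rad a (v z) (snd z) * (q z)\<^sup>2"
      by (simp add: power2_eq_square)
    show "0 \<le> p z * p z + q z * - (- 2 * rad a (v z) (snd z) * q z)"
      unfolding dissip by (simp add: rad_nonneg)
    show "q z = 0" if "p z * p z + q z * - (- 2 * rad a (v z) (snd z) * q z) = 0"
      using that rad_pos[OF assms, of "v z" "snd z"] unfolding dissip
      by (simp add: add_nonneg_eq_0_iff rad_nonneg)
    show "((\<lambda>t. - (- 2 * rad a (v (x, t)) (snd (x, t)) * q (x, t))) has_real_derivative - s (x, y)) (at y)"
      if "y \<in> {y1..y2}" for x y using DERIV_minus[OF vx_dy[OF inside[OF that]]] by simp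
  qed (use rect boundary inside in \<open>auto intro!: conts continuous_intros derivs p_dx\<close>)
qed

end

section \<open>The comparison principle\<close>

definition soft_step :: "real \<Rightarrow> real \<Rightarrow> real" where
  "soft_step e t = (max 0 t)\<^sup>2 / ((max 0 t)\<^sup>2 + e\<^sup>2)"

definition soft_step_deriv :: "real \<Rightarrow> real \<Rightarrow> real" where
  "soft_step_deriv e t = 2 * max 0 t * e\<^sup>2 / ((max 0 t)\<^sup>2 + e\<^sup>2)\<^sup>2"

definition soft_step_primitive :: "real \<Rightarrow> real \<Rightarrow> real" where
  "soft_step_primitive e t = max 0 t - e * arctan (max 0 t / e)"

lemma soft_step_nonpos: "t \<le> 0 \<Longrightarrow> soft_step e t = 0"
  by (simp add: soft_step_def max_def)

lemma soft_step_primitive_nonpos: "t \<le> 0 \<Longrightarrow> soft_step_primitive e t = 0"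
  by (simp add: soft_step_primitive_def max_def)

lemma soft_step_deriv_nonneg: "0 \<le> soft_step_deriv e t"
  by (simp add: soft_step_deriv_def)

lemma soft_step_has_derivative:
  assumes "e \<noteq> 0"
  shows "(soft_step e has_real_derivative soft_step_deriv e t) (at t)"
proof -
  have "((\<lambda>t. t\<^sup>2 / (t\<^sup>2 + e\<^sup>2)) has_real_derivative 2 * t * e\<^sup>2 / (t\<^sup>2 + e\<^sup>2)\<^sup>2) (at t)" for t
    using assms by (auto intro!: derivative_eq_intros simp: field_simps power2_eq_square add_nonneg_eq_0_iff)
  from has_real_derivative_max0[OF this] show ?thesis
    by (simp add: soft_step_def[abs_def] soft_step_deriv_def)
qed

lemma soft_step_primitive_has_derivative:
  assumes "e \<noteq> 0"
  shows "(soft_step_primitive e has_real_derivative soft_step e t) (at t)"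
proof -
  have "((\<lambda>t. t - e * arctan (t / e)) has_real_derivative t\<^sup>2 / (t\<^sup>2 + e\<^sup>2)) (at t)" for t
  proof -
    have pos: "t\<^sup>2 + e\<^sup>2 \<noteq> 0" using assms by (simp add: add_nonneg_eq_0_iff)
    have inner: "1 + (t / e)\<^sup>2 = (t\<^sup>2 + e\<^sup>2) / e\<^sup>2" using assms by (simp add: field_simps)
    have "1 - e\<^sup>2 / (t\<^sup>2 + e\<^sup>2) = t\<^sup>2 / (t\<^sup>2 + e\<^sup>2)" using pos by (simp add: field_simps)
    then have slope: "1 - e * (inverse (1 + (t / e)\<^sup>2) * (1 / e)) = t\<^sup>2 / (t\<^sup>2 + e\<^sup>2)"
      using assms unfolding inner by simp
    have "((\<lambda>t. arctan (t / e)) has_real_derivative inverse (1 + (t / e)\<^sup>2) * (1 / e)) (at t)"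
      by (rule DERIV_chain2[OF DERIV_arctan]) (use assms in \<open>auto intro!: derivative_eq_intros\<close>)
    from DERIV_diff[OF DERIV_ident DERIV_cmult[OF this, of e]] show ?thesis unfolding slope .
  qed
  from has_real_derivative_max0[OF this] show ?thesis
    by (simp add: soft_step_def[abs_def] soft_step_primitive_def[abs_def])
qed

lemma continuous_on_soft_step:
  assumes "e \<noteq> 0"
  shows "continuous_on S (soft_step e)" "continuous_on S (soft_step_deriv e)"
    "continuous_on S (soft_step_primitive e)"
  unfolding soft_step_def[abs_def] soft_step_deriv_def[abs_def] soft_step_primitive_def[abs_def]
  using assms by (auto intro!: continuous_intros simp: add_nonneg_eq_0_iff)

lemma soft_step_deriv_mult_square_le:
  assumes "e > 0" shows "soft_step_deriv e t * t\<^sup>2 \<le> 2 * e"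
proof -
  define m where "m = max 0 t"
  have m: "0 \<le> m" by (simp add: m_def)
  have pos: "0 < m\<^sup>2 + e\<^sup>2" using assms by (simp add: add_nonneg_pos)
  have "2 * (m * e) \<le> m\<^sup>2 + e\<^sup>2" using sum_squares_bound[of m e] by (simp add: mult.assoc)
  then have "m * e \<le> m\<^sup>2 + e\<^sup>2" using zero_le_power2[of m] zero_le_power2[of e] by linarith
  then have "(m * e) * m\<^sup>2 \<le> (m\<^sup>2 + e\<^sup>2) * (m\<^sup>2 + e\<^sup>2)" using m assms by (intro mult_mono) auto
  then have "2 * e * ((m * e) * m\<^sup>2) \<le> 2 * e * (m\<^sup>2 + e\<^sup>2)\<^sup>2"
    using assms unfolding power2_eq_square[of "m\<^sup>2 + e\<^sup>2"] by (intro mult_left_mono) auto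
  moreover have "soft_step_deriv e t * m\<^sup>2 = 2 * e * ((m * e) * m\<^sup>2) / (m\<^sup>2 + e\<^sup>2)\<^sup>2"
    by (simp add: soft_step_deriv_def m_def[symmetric] power2_eq_square[of e])
  ultimately have "soft_step_deriv e t * m\<^sup>2 \<le> 2 * e" using pos by (simp add: divide_le_eq)
  moreover have "soft_step_deriv e t * t\<^sup>2 = soft_step_deriv e t * m\<^sup>2"
    by (auto simp: soft_step_deriv_def m_def max_def)
  ultimately show ?thesis by linarith
qed

lemma soft_step_primitive_ge:
  assumes "e > 0" shows "max 0 t - 2 * e \<le> soft_step_primitive e t"
proof -
  have "arctan (max 0 t / e) \<le> 2" using arctan_ubound[of "max 0 t / e"] pi_less_4 by linarith
  then show ?thesis using assms by (simp add: soft_step_primitive_def)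
qed

lemma rad_flux_almost_monotone:
  assumes "a \<noteq> 0"
  shows "- ((v1 - v2)\<^sup>2 * q2\<^sup>2 / (2 * \<bar>a\<bar>)) \<le> 2 * (rad a v1 y * q1 - rad a v2 y * q2) * (q1 - q2)"
proof -
  define \<sigma>1 \<sigma>2 where "\<sigma>1 = rad a v1 y" and "\<sigma>2 = rad a v2 y"
  have \<sigma>: "0 < \<sigma>1" "\<bar>a\<bar> \<le> \<sigma>1" "\<bar>\<sigma>1 - \<sigma>2\<bar> \<le> \<bar>v1 - v2\<bar>"
    unfolding \<sigma>1_def \<sigma>2_def by (intro rad_pos[OF assms] abs_le_rad rad_lipschitz)+
  have "(\<sigma>1 - \<sigma>2)\<^sup>2 * q2\<^sup>2 / (2 * \<sigma>1) \<le> (v1 - v2)\<^sup>2 * q2\<^sup>2 / (2 * \<bar>a\<bar>)"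
    using \<sigma> assms by (intro frac_le mult_right_mono) (auto simp: abs_le_square_iff)
  moreover have "2 * (\<sigma>1 * q1 - \<sigma>2 * q2) * (q1 - q2) + (\<sigma>1 - \<sigma>2)\<^sup>2 * q2\<^sup>2 / (2 * \<sigma>1)
      = (2 * \<sigma>1 * (q1 - q2) + (\<sigma>1 - \<sigma>2) * q2)\<^sup>2 / (2 * \<sigma>1)"
    using \<sigma>(1) by (simp add: field_simps power2_eq_square)
  moreover have "0 \<le> (2 * \<sigma>1 * (q1 - q2) + (\<sigma>1 - \<sigma>2) * q2)\<^sup>2 / (2 * \<sigma>1)" using \<sigma>(1) by simp
  ultimately show ?thesis unfolding \<sigma>1_def[symmetric] \<sigma>2_def[symmetric] by linarith
qed

locale ordered_on_edges =
  S1: dagger_C2 R a u1 v1 p1 q1 r1 s1 + S2: dagger_C2 R a u2 v2 p2 q2 r2 s2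
  for R a u1 v1 p1 q1 r1 s1 u2 v2 p2 q2 r2 s2 +
  fixes P R' :: real
  assumes a_nonzero: "a \<noteq> 0" and P_pos: "0 < P" and R': "0 < R'" "R' < R"
    and periodic1: "\<And>x y. \<bar>y\<bar> < R \<Longrightarrow> u1 (x + P, y) = u1 (x, y) \<and> v1 (x + P, y) = v1 (x, y)"
    and periodic2: "\<And>x y. \<bar>y\<bar> < R \<Longrightarrow> u2 (x + P, y) = u2 (x, y) \<and> v2 (x + P, y) = v2 (x, y)"
    and edges: "\<And>x. v1 (x, R') \<le> v2 (x, R') \<and> v1 (x, - R') \<le> v2 (x, - R')"
begin

definition d :: "real \<times> real \<Rightarrow> real" where
  "d z = v1 z - v2 z"

definition dx :: "real \<times> real \<Rightarrow> real" where
  "dx z = - 2 * (rad a (v1 z) (snd z) * q1 z - rad a (v2 z) (snd z) * q2 z)"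

definition dy :: "real \<times> real \<Rightarrow> real" where
  "dy z = p1 z - p2 z"

abbreviation cutoff :: "real \<times> real \<Rightarrow> real" where
  "cutoff z \<equiv> R'\<^sup>2 - (snd z)\<^sup>2"

lemma continuous_on_d:
  assumes "S \<subseteq> open_strip R"
  shows "continuous_on S d" "continuous_on S dx" "continuous_on S dy"
  unfolding d_def dx_def dy_def
  by (intro continuous_intros S1.continuous_on[OF assms] S2.continuous_on[OF assms])+

lemma continuous_on_soft_step_d:
  assumes "e \<noteq> 0" and S: "S \<subseteq> open_strip R"
  shows "continuous_on S (\<lambda>z. soft_step e (d z))" "continuous_on S (\<lambda>z. soft_step_deriv e (d z))"
    "continuous_on S (\<lambda>z. soft_step_primitive e (d z))"
  by (rule continuous_on_compose2[OF continuous_on_soft_step(1)[OF assms(1)] continuous_on_d(1)[OF S] subset_UNIV]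
      continuous_on_compose2[OF continuous_on_soft_step(2)[OF assms(1)] continuous_on_d(1)[OF S] subset_UNIV]
      continuous_on_compose2[OF continuous_on_soft_step(3)[OF assms(1)] continuous_on_d(1)[OF S] subset_UNIV])+

lemma d_derivs:
  assumes "\<bar>y\<bar> < R"
  shows "((\<lambda>t. d (t, y)) has_real_derivative dx (x, y)) (at x)"
    "((\<lambda>t. d (x, t)) has_real_derivative dy (x, y)) (at y)"
  using DERIV_diff[OF S1.v_dx S2.v_dx, OF assms assms, of x] DERIV_diff[OF S1.v_dy S2.v_dy, OF assms assms, of x]
  unfolding d_def dx_def dy_def by (simp_all add: algebra_simps)

text \<open>The equation for the difference \<open>d\<close> is multiplied by the cutoff and by a smoothed Heaviside
  function of \<open>d\<close>. The term with the derivative of the step is nonnegative up to an error that vanishes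
  with the smoothing, and what remains is the integral of the positive part of \<open>d\<close>.\<close>

lemma tested_difference:
  assumes e: "e \<noteq> 0"
  shows "integral ({x..x+P} \<times> {-R'..R'})
    (\<lambda>z. cutoff z * soft_step_deriv e (d z) * ((dy z)\<^sup>2 - dx z * (q1 z - q2 z)) + 2 * soft_step_primitive e (d z)) = 0"
proof -
  let ?Q = "{x..x+P} \<times> {-R'..R'}"
  have Q: "?Q \<subseteq> open_strip R" by (rule Times_subset_open_strip) (use R' in auto)
  have inside: "\<bar>y\<bar> < R" if "y \<in> {-R'..R'}" for y using that R' by auto
  let ?S = "\<lambda>z. soft_step e (d z)" and ?S' = "\<lambda>z. soft_step_deriv e (d z)"
    and ?J = "\<lambda>z. soft_step_primitive e (d z)" and ?k = "\<lambda>z. q1 z - q2 z" and ?r = "\<lambda>z. r1 z - r2 z"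
  let ?Ax = "\<lambda>z. - (cutoff z * (?S' z * dx z * ?k z + ?S z * ?r z))"
  let ?By = "\<lambda>z. cutoff z * (?S' z * (dy z)\<^sup>2 + ?S z * ?r z) + 2 * ?J z"
  have "integral ?Q (\<lambda>z. ?Ax z + ?By z) = 0"
  proof (rule green_rectangle_zero[where A = "\<lambda>z. - (cutoff z * (?S z * ?k z))"
        and B = "\<lambda>z. cutoff z * (?S z * dy z) + 2 * snd z * ?J z"])
    show "continuous_on ?Q ?Ax" "continuous_on ?Q ?By"
      by (intro continuous_intros continuous_on_soft_step_d[OF e Q] continuous_on_d[OF Q] S1.continuous_on[OF Q] S2.continuous_on[OF Q]
          S1.continuous_on2[OF Q] S2.continuous_on2[OF Q])+
  next
    fix x' y assume y: "y \<in> {-R'..R'}"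
    note derivs = d_derivs[OF inside[OF y], of x'] S1.derivs2[OF inside[OF y], of x'] S2.derivs2[OF inside[OF y], of x']
      DERIV_chain2[OF soft_step_has_derivative[OF e]] DERIV_chain2[OF soft_step_primitive_has_derivative[OF e]]
    show "((\<lambda>t. - (cutoff (t, y) * (?S (t, y) * ?k (t, y)))) has_real_derivative ?Ax (x', y)) (at x')"
      by (auto intro!: derivative_eq_intros derivs simp: algebra_simps)
    have "((\<lambda>t. dy (x', t)) has_real_derivative ?r (x', y)) (at y)"
      unfolding dy_def by (intro derivative_intros derivs)
    then show "((\<lambda>t. cutoff (x', t) * (?S (x', t) * dy (x', t)) + 2 * snd (x', t) * ?J (x', t))
        has_real_derivative ?By (x', y)) (at y)"
      by (auto intro!: derivative_eq_intros derivs simp: algebra_simps power2_eq_square)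
  next
    fix y assume "y \<in> {-R'..R'}"
    note y = inside[OF this]
    have "q1 (x + P, y) = q1 (x, y)" "q2 (x + P, y) = q2 (x, y)"
      by (rule S1.q_periodic S2.q_periodic; use periodic1 periodic2 y in simp)+
    then show "- (cutoff (x, y) * (?S (x, y) * ?k (x, y))) = - (cutoff (x + P, y) * (?S (x + P, y) * ?k (x + P, y)))"
      using periodic1[OF y] periodic2[OF y] by (simp add: d_def)
  next
    fix x'
    have "d (x', - R') \<le> 0" "d (x', R') \<le> 0" using edges[of x'] by (simp_all add: d_def)
    then show "cutoff (x', - R') * (?S (x', - R') * dy (x', - R')) + 2 * snd (x', - R') * ?J (x', - R')
        = cutoff (x', R') * (?S (x', R') * dy (x', R')) + 2 * snd (x', R') * ?J (x', R')"
      by (simp add: soft_step_nonpos soft_step_primitive_nonpos)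
  qed (use P_pos R' in auto)
  then show ?thesis by (simp add: algebra_simps)
qed

lemma tested_difference_integrand_ge:
  assumes e: "e > 0" and y: "\<bar>snd z\<bar> \<le> R'" and K: "\<bar>q2 z\<bar> \<le> K"
  shows "2 * max 0 (d z) - (4 + R'\<^sup>2 * K\<^sup>2 / \<bar>a\<bar>) * e
    \<le> cutoff z * soft_step_deriv e (d z) * ((dy z)\<^sup>2 - dx z * (q1 z - q2 z)) + 2 * soft_step_primitive e (d z)"
proof -
  have cutoff: "0 \<le> cutoff z" "cutoff z \<le> R'\<^sup>2" using y R' by (simp_all add: abs_le_square_iff[symmetric])
  have "(d z)\<^sup>2 * (q2 z)\<^sup>2 / (2 * \<bar>a\<bar>) \<le> (d z)\<^sup>2 * K\<^sup>2 / (2 * \<bar>a\<bar>)"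
    using K by (intro divide_right_mono mult_left_mono) (auto simp: abs_le_square_iff[symmetric])
  moreover have "- ((d z)\<^sup>2 * (q2 z)\<^sup>2 / (2 * \<bar>a\<bar>)) \<le> - dx z * (q1 z - q2 z)"
    using rad_flux_almost_monotone[OF a_nonzero, of "v1 z" "v2 z" "q2 z" "snd z" "q1 z"]
    by (simp add: d_def dx_def)
  ultimately have "- ((d z)\<^sup>2 * K\<^sup>2 / (2 * \<bar>a\<bar>)) \<le> (dy z)\<^sup>2 - dx z * (q1 z - q2 z)"
    using zero_le_power2[of "dy z"] by linarith
  then have "cutoff z * soft_step_deriv e (d z) * - ((d z)\<^sup>2 * K\<^sup>2 / (2 * \<bar>a\<bar>))
      \<le> cutoff z * soft_step_deriv e (d z) * ((dy z)\<^sup>2 - dx z * (q1 z - q2 z))"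
    using cutoff by (intro mult_left_mono mult_nonneg_nonneg soft_step_deriv_nonneg)
  moreover have "cutoff z * (soft_step_deriv e (d z) * (d z)\<^sup>2) \<le> R'\<^sup>2 * (2 * e)"
    by (rule mult_mono[OF cutoff(2) soft_step_deriv_mult_square_le[OF e]]) (simp_all add: soft_step_deriv_nonneg)
  then have "cutoff z * (soft_step_deriv e (d z) * (d z)\<^sup>2) * (K\<^sup>2 / (2 * \<bar>a\<bar>)) \<le> R'\<^sup>2 * (2 * e) * (K\<^sup>2 / (2 * \<bar>a\<bar>))"
    by (rule mult_right_mono) simp
  moreover have "R'\<^sup>2 * (2 * e) * (K\<^sup>2 / (2 * \<bar>a\<bar>)) = R'\<^sup>2 * K\<^sup>2 / \<bar>a\<bar> * e" using a_nonzero by (simp add: field_simps)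
  moreover have "cutoff z * soft_step_deriv e (d z) * - ((d z)\<^sup>2 * K\<^sup>2 / (2 * \<bar>a\<bar>))
      = - (cutoff z * (soft_step_deriv e (d z) * (d z)\<^sup>2) * (K\<^sup>2 / (2 * \<bar>a\<bar>)))" by simp
  ultimately show ?thesis
    using soft_step_primitive_ge[OF e, of "d z"] distrib_right[of 4 "R'\<^sup>2 * K\<^sup>2 / \<bar>a\<bar>" e] by linarith
qed

lemma integral_positive_part_le:
  assumes e: "0 < e" and K: "\<And>z. z \<in> {x..x+P} \<times> {-R'..R'} \<Longrightarrow> \<bar>q2 z\<bar> \<le> K"
  shows "integral ({x..x+P} \<times> {-R'..R'}) (\<lambda>z. 2 * max 0 (d z)) \<le> (4 + R'\<^sup>2 * K\<^sup>2 / \<bar>a\<bar>) * e * P * (2 * R')"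
proof -
  let ?Q = "{x..x+P} \<times> {-R'..R'}" and ?c = "(4 + R'\<^sup>2 * K\<^sup>2 / \<bar>a\<bar>) * e"
  have Q: "?Q \<subseteq> open_strip R" by (rule Times_subset_open_strip) (use R' in auto)
  have e': "e \<noteq> 0" using e by simp
  have cont: "continuous_on ?Q (\<lambda>z. 2 * max 0 (d z))" by (intro continuous_intros continuous_on_d[OF Q])
  have area: "integral ?Q (\<lambda>_. ?c) = ?c * P * (2 * R')"
    using P_pos R' integral_rectangle_const[of x "x + P" "- R'" R' ?c] by simp
  have "integral ?Q (\<lambda>z. 2 * max 0 (d z)) - ?c * P * (2 * R') = integral ?Q (\<lambda>z. 2 * max 0 (d z)) - integral ?Q (\<lambda>_. ?c)"
    by (simp only: area)
  also have "\<dots> = integral ?Q (\<lambda>z. 2 * max 0 (d z) - ?c)"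
    by (intro Henstock_Kurzweil_Integration.integral_diff[symmetric] integrable_continuous_rectangle cont continuous_on_const)
  also have "\<dots> \<le> integral ?Q (\<lambda>z. cutoff z * soft_step_deriv e (d z) * ((dy z)\<^sup>2 - dx z * (q1 z - q2 z))
      + 2 * soft_step_primitive e (d z))"
    by (intro integral_le integrable_continuous_rectangle tested_difference_integrand_ge e K continuous_intros cont
        continuous_on_soft_step_d[OF e' Q] continuous_on_d[OF Q] S1.continuous_on[OF Q] S2.continuous_on[OF Q])
      auto
  also have "\<dots> = 0" by (rule tested_difference[OF e'])
  finally show ?thesis by simp
qed

theorem comparison:
  assumes y: "\<bar>y\<bar> \<le> R'" shows "v1 (x, y) \<le> v2 (x, y)"
proof -
  let ?Q = "{x..x+P} \<times> {-R'..R'}"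
  have Q: "?Q \<subseteq> open_strip R" by (rule Times_subset_open_strip) (use R' in auto)
  have "bounded (q2 ` ?Q)"
    by (intro compact_imp_bounded compact_continuous_image S2.continuous_on[OF Q]) (simp add: compact_Times)
  then obtain K where K: "\<And>z. z \<in> ?Q \<Longrightarrow> \<bar>q2 z\<bar> \<le> K" by (auto simp: bounded_iff)
  define C where "C = (4 + R'\<^sup>2 * K\<^sup>2 / \<bar>a\<bar>) * P * (2 * R')"
  have C: "0 < C" unfolding C_def using P_pos R' by (intro mult_pos_pos add_pos_nonneg) auto
  have "integral ?Q (\<lambda>z. 2 * max 0 (d z)) \<le> 0 + \<epsilon>" if "0 < \<epsilon>" for \<epsilon>
  proof -
    have "integral ?Q (\<lambda>z. 2 * max 0 (d z)) \<le> (4 + R'\<^sup>2 * K\<^sup>2 / \<bar>a\<bar>) * (\<epsilon> / C) * P * (2 * R')"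
      by (rule integral_positive_part_le[OF _ K]) (use C that in auto)
    also have "\<dots> = C * (\<epsilon> / C)" by (simp add: C_def)
    also have "\<dots> = 0 + \<epsilon>" using C by simp
    finally show ?thesis .
  qed
  then have "integral ?Q (\<lambda>z. 2 * max 0 (d z)) \<le> 0" by (rule field_le_epsilon)
  then have "2 * max 0 (d (x, y)) = 0"
    by (intro continuous_nonneg_integral_rectangle_eq_0[of x "x + P" "- R'" R' "\<lambda>z. 2 * max 0 (d z)"]
        continuous_intros continuous_on_d[OF Q]) (use P_pos R' y in auto)
  then show ?thesis by (simp add: d_def)
qed

end

section \<open>The energy estimate\<close>

definition quartic_weight :: "real \<Rightarrow> real \<Rightarrow> real" where
  "quartic_weight a t = (t\<^sup>2 + a\<^sup>2) powr (- 1 / 4)"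

definition quartic_slope :: "real \<Rightarrow> real \<Rightarrow> real" where
  "quartic_slope a t = quartic_weight a t * (1 - t\<^sup>2 / (2 * (t\<^sup>2 + a\<^sup>2)))"

lemma sum_squares_pos: "a \<noteq> 0 \<Longrightarrow> 0 < t\<^sup>2 + (a::real)\<^sup>2"
  by (simp add: add_nonneg_pos)

lemma quartic_weight_pos: "a \<noteq> 0 \<Longrightarrow> 0 < quartic_weight a t"
  using sum_squares_pos[of a t] by (simp add: quartic_weight_def)

lemma continuous_on_quartic_weight [continuous_intros]:
  "a \<noteq> 0 \<Longrightarrow> continuous_on S f \<Longrightarrow> continuous_on S (\<lambda>x. quartic_weight a (f x))"
  unfolding quartic_weight_def by (intro continuous_intros) simp_all

lemma continuous_on_quartic_slope [continuous_intros]: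
  "a \<noteq> 0 \<Longrightarrow> continuous_on S f \<Longrightarrow> continuous_on S (\<lambda>x. quartic_slope a (f x))"
  unfolding quartic_slope_def
  by (intro continuous_intros)
    (simp_all add: less_imp_neq[OF sum_squares_pos, symmetric] del: distrib_left_numeral)

lemma mult_quartic_weight_has_derivative:
  assumes "a \<noteq> 0"
  shows "((\<lambda>t. t * quartic_weight a t) has_real_derivative quartic_slope a t) (at t)"
proof -
  note pos = sum_squares_pos[OF assms, of t]
  have "((\<lambda>t. (t\<^sup>2 + a\<^sup>2) powr (- 1 / 4)) has_real_derivative
      (- 1 / 4) * (t\<^sup>2 + a\<^sup>2) powr (- 1 / 4 - 1) * (2 * t)) (at t)"
    by (rule DERIV_chain2[where g = "\<lambda>t. t\<^sup>2 + a\<^sup>2", OF has_real_derivative_powr])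
      (use pos in \<open>auto intro!: derivative_eq_intros\<close>)
  moreover have "(t\<^sup>2 + a\<^sup>2) powr (- 1 / 4 - 1) = quartic_weight a t / (t\<^sup>2 + a\<^sup>2)"
    using pos unfolding quartic_weight_def by (subst powr_diff) simp
  ultimately have weight_deriv: "(quartic_weight a has_real_derivative
      (- 1 / 4) * (quartic_weight a t / (t\<^sup>2 + a\<^sup>2)) * (2 * t)) (at t)"
    by (simp only: quartic_weight_def[abs_def])
  have "1 * w + (- 1 / 4) * (w / D) * (2 * t) * t = w * (1 - t\<^sup>2 / (2 * D))" for w D :: real
    by (cases "D = 0") (simp_all add: field_simps power2_eq_square)
  then show ?thesis
    unfolding quartic_slope_def by (rule DERIV_cong[OF DERIV_mult[OF DERIV_ident weight_deriv]])
qed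

lemma quartic_slope_ge:
  assumes "a \<noteq> 0" shows "quartic_weight a t / 2 \<le> quartic_slope a t"
proof -
  have "t\<^sup>2 / (2 * (t\<^sup>2 + a\<^sup>2)) \<le> 1 / 2" using sum_squares_pos[OF assms, of t] by (simp add: field_simps)
  then have "quartic_weight a t * (1 / 2) \<le> quartic_weight a t * (1 - t\<^sup>2 / (2 * (t\<^sup>2 + a\<^sup>2)))"
    using quartic_weight_pos[OF assms, of t] by (intro mult_left_mono) auto
  then show ?thesis by (simp add: quartic_slope_def)
qed

lemma quartic_weight_eq_inverse_sqrt: "quartic_weight a t = 1 / sqrt (sqrt (t\<^sup>2 + a\<^sup>2))"
proof -
  have "sqrt (sqrt (t\<^sup>2 + a\<^sup>2)) = (t\<^sup>2 + a\<^sup>2) powr (1 / 4)"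
    by (simp add: powr_half_sqrt[symmetric] powr_powr)
  then show ?thesis using powr_minus_divide[of "t\<^sup>2 + a\<^sup>2" "1 / 4"] by (simp add: quartic_weight_def)
qed

lemma inverse_sqrt_rad_le_quartic_weight:
  assumes "a \<noteq> 0" shows "1 / sqrt (rad a v y) \<le> quartic_weight a y"
  unfolding quartic_weight_eq_inverse_sqrt
  using sum_squares_pos[OF assms, of y] rad_pos[OF assms, of v y]
  by (intro divide_left_mono mult_pos_pos) (auto simp: rad_def)

lemma sqrt_rad_le_quartic_weight_mult_rad:
  assumes "a \<noteq> 0" shows "sqrt (rad a v y) \<le> quartic_weight a v * rad a v y"
proof -
  have "rad a v y = rad a y v" by (simp add: rad_def add.commute)
  then have "1 / sqrt (rad a v y) * rad a v y \<le> quartic_weight a v * rad a v y"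
    using inverse_sqrt_rad_le_quartic_weight[OF assms, of y v] by (intro mult_right_mono rad_nonneg) simp
  then show ?thesis using rad_pos[OF assms, of v y] by (simp add: real_div_sqrt)
qed

lemma quartic_weight_le_inverse_sqrt:
  assumes "0 < c" "c \<le> \<bar>t\<bar>" shows "quartic_weight a t \<le> 1 / sqrt c"
proof -
  have "c\<^sup>2 \<le> t\<^sup>2" using assms abs_le_square_iff[of c t] by simp
  then have "c \<le> sqrt (t\<^sup>2 + a\<^sup>2)" by (intro real_le_rsqrt) (simp add: add_increasing2)
  moreover from this have "0 < sqrt (t\<^sup>2 + a\<^sup>2)" using assms(1) by linarith
  ultimately show ?thesis unfolding quartic_weight_eq_inverse_sqrt
    using assms(1) by (intro divide_left_mono mult_pos_pos) auto
qed

context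
  fixes a t T :: real
  assumes a: "a \<noteq> 0" and T: "t\<^sup>2 + a\<^sup>2 \<le> T" "1 \<le> T"
begin

lemma quartic_weight_ge_inverse: "1 / T \<le> quartic_weight a t"
proof -
  have "1 / T = T powr (- 1)" using T by (simp add: powr_minus_divide)
  also have "\<dots> \<le> T powr (- 1 / 4)" using T by (intro powr_mono) auto
  also have "\<dots> \<le> quartic_weight a t"
    unfolding quartic_weight_def using sum_squares_pos[OF a, of t] T by (intro powr_mono2') auto
  finally show ?thesis .
qed

lemma square_mult_quartic_weight_le: "t\<^sup>2 * quartic_weight a t \<le> T"
proof -
  note pos = sum_squares_pos[OF a, of t]
  have "t\<^sup>2 * quartic_weight a t \<le> (t\<^sup>2 + a\<^sup>2) * quartic_weight a t"
    using quartic_weight_pos[OF a, of t] by (intro mult_right_mono) auto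
  also have "\<dots> = (t\<^sup>2 + a\<^sup>2) powr (1 + - 1 / 4)"
    using pos unfolding quartic_weight_def by (subst powr_add) simp
  also have "\<dots> \<le> T powr (3 / 4)" using pos T by (simp add: powr_mono2)
  also have "\<dots> \<le> T powr 1" using T by (intro powr_mono) auto
  finally show ?thesis using T by simp
qed

lemma square_div_quartic_slope_le: "(t * quartic_weight a t)\<^sup>2 / quartic_slope a t \<le> 2 * T"
proof -
  note w = quartic_weight_pos[OF a, of t]
  have "(t * quartic_weight a t)\<^sup>2 / quartic_slope a t \<le> (t * quartic_weight a t)\<^sup>2 / (quartic_weight a t / 2)"
    using quartic_slope_ge[OF a, of t] w by (intro divide_left_mono) auto
  also have "\<dots> = 2 * (t\<^sup>2 * quartic_weight a t)" using w by (simp add: field_simps power2_eq_square)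
  finally show ?thesis using square_mult_quartic_weight_le by simp
qed

lemma energy_le_dissipation:
  "\<eta>\<^sup>2 * (p\<^sup>2 + sqrt (rad a t y) * q\<^sup>2) - 64 * T\<^sup>2 * y\<^sup>2
    \<le> 4 * T * (\<eta>\<^sup>2 * (quartic_slope a t * (2 * rad a t y * q\<^sup>2 + p\<^sup>2)) - 4 * y * \<eta> * (t * quartic_weight a t * p))"
proof -
  let ?w = "quartic_weight a t" and ?s = "quartic_slope a t" and ?\<sigma> = "rad a t y"
  have w: "0 < ?w" by (rule quartic_weight_pos[OF a])
  then have s: "0 < ?s" using quartic_slope_ge[OF a, of t] by linarith
  have "p\<^sup>2 + sqrt ?\<sigma> * q\<^sup>2 \<le> 4 * T * (?s * (2 * ?\<sigma> * q\<^sup>2 + p\<^sup>2 / 2))"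
  proof -
    have "1 / T * (p\<^sup>2 / 4) + sqrt ?\<sigma> * q\<^sup>2 \<le> ?w * (p\<^sup>2 / 4) + ?w * ?\<sigma> * q\<^sup>2"
      by (intro add_mono mult_right_mono quartic_weight_ge_inverse sqrt_rad_le_quartic_weight_mult_rad a) auto
    also have "\<dots> = ?w / 2 * (2 * ?\<sigma> * q\<^sup>2 + p\<^sup>2 / 2)" by (simp add: algebra_simps)
    also have "\<dots> \<le> ?s * (2 * ?\<sigma> * q\<^sup>2 + p\<^sup>2 / 2)"
      by (intro mult_right_mono quartic_slope_ge a) (simp add: rad_nonneg)
    finally have "4 * T * (1 / T * (p\<^sup>2 / 4) + sqrt ?\<sigma> * q\<^sup>2) \<le> 4 * T * (?s * (2 * ?\<sigma> * q\<^sup>2 + p\<^sup>2 / 2))"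
      using T by (intro mult_left_mono) auto
    moreover have "1 * (sqrt ?\<sigma> * q\<^sup>2) \<le> 4 * T * (sqrt ?\<sigma> * q\<^sup>2)"
      using T by (intro mult_right_mono) (auto simp: rad_nonneg)
    moreover have "4 * T * (1 / T * (p\<^sup>2 / 4) + sqrt ?\<sigma> * q\<^sup>2) = p\<^sup>2 + 4 * T * (sqrt ?\<sigma> * q\<^sup>2)"
      using T by (simp add: distrib_left)
    ultimately show ?thesis by linarith
  qed
  then have "\<eta>\<^sup>2 * (p\<^sup>2 + sqrt ?\<sigma> * q\<^sup>2) \<le> \<eta>\<^sup>2 * (4 * T * (?s * (2 * ?\<sigma> * q\<^sup>2 + p\<^sup>2 / 2)))"
    by (rule mult_left_mono) simp
  moreover have "- (64 * T\<^sup>2 * y\<^sup>2) \<le> 4 * T * (\<eta>\<^sup>2 * ?s * p\<^sup>2 / 2 - 4 * y * \<eta> * (t * ?w * p))"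
  proof -
    have "0 \<le> (\<eta> * ?s * p - 4 * y * (t * ?w))\<^sup>2 / (2 * ?s)" using s by simp
    also have "\<dots> = \<eta>\<^sup>2 * ?s * p\<^sup>2 / 2 - 4 * y * \<eta> * (t * ?w * p) + 8 * y\<^sup>2 * ((t * ?w)\<^sup>2 / ?s)"
      using s by (simp add: field_simps power2_eq_square)
    also have "\<dots> \<le> \<eta>\<^sup>2 * ?s * p\<^sup>2 / 2 - 4 * y * \<eta> * (t * ?w * p) + 8 * y\<^sup>2 * (2 * T)"
      by (intro add_left_mono mult_left_mono square_div_quartic_slope_le) simp
    finally have "4 * T * - (8 * y\<^sup>2 * (2 * T)) \<le> 4 * T * (\<eta>\<^sup>2 * ?s * p\<^sup>2 / 2 - 4 * y * \<eta> * (t * ?w * p))"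
      using T by (intro mult_left_mono) linarith+
    then show ?thesis by (simp add: power2_eq_square algebra_simps)
  qed
  ultimately show ?thesis by (simp add: algebra_simps)
qed

end

definition (in dagger_C1) energy :: "real \<times> real \<Rightarrow> real" where
  "energy z = (p z)\<^sup>2 + sqrt (rad a (v z) (snd z)) * (q z)\<^sup>2"

lemma (in dagger_C1) energy_nonneg: "0 \<le> energy z"
  by (simp add: energy_def rad_nonneg)

lemma (in dagger_C1) continuous_on_energy: "S \<subseteq> open_strip R \<Longrightarrow> continuous_on S energy"
  unfolding energy_def[abs_def] by (intro continuous_intros continuous_on)

locale bounded_periodic_dagger_C2 = dagger_C2 +
  fixes P M :: real
  assumes a_nonzero: "a \<noteq> 0" and P_pos: "0 < P"
    and periodic: "\<And>x y. \<bar>y\<bar> < R \<Longrightarrow> u (x + P, y) = u (x, y) \<and> v (x + P, y) = v (x, y)"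
    and v_bounded: "\<And>x y. \<bar>y\<bar> < R \<Longrightarrow> \<bar>v (x, y)\<bar> \<le> M"
begin

text \<open>Testing the equation for \<open>v\<close> with \<open>\<eta>\<^sup>2 v (v\<^sup>2 + a\<^sup>2)\<^bsup>-1/4\<^esup>\<close> instead of \<open>\<eta>\<^sup>2 v\<close> gains a power of the
  degenerate weight: \<open>|y|\<^bsup>1/2\<^esup>\<close> in place of \<open>|y|\<close> in front of \<open>(\<partial>u/\<partial>y)\<^sup>2\<close>, and only the former has an
  inverse that is integrable at \<open>y = 0\<close>.\<close>

lemma tested_equation:
  assumes R': "0 < R'" "R' < R"
  defines "\<eta> \<equiv> \<lambda>z::real \<times> real. R'\<^sup>2 - (snd z)\<^sup>2"
  shows "integral ({c..c+P} \<times> {-R'..R'})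
      (\<lambda>z. (\<eta> z)\<^sup>2 * (quartic_slope a (v z) * (2 * rad a (v z) (snd z) * (q z)\<^sup>2 + (p z)\<^sup>2))
        - 4 * snd z * \<eta> z * (v z * quartic_weight a (v z) * p z)) = 0"
proof -
  let ?Q = "{c..c+P} \<times> {-R'..R'}"
  have Q: "?Q \<subseteq> open_strip R" by (rule Times_subset_open_strip) (use R' in auto)
  have inside: "\<bar>y\<bar> < R" if "y \<in> {-R'..R'}" for y using that R' by auto
  define G where "G t = t * quartic_weight a t" for t
  have dG: "(G has_real_derivative quartic_slope a t) (at t)" for t
    unfolding G_def using mult_quartic_weight_has_derivative[OF a_nonzero] .
  let ?F = "\<lambda>z. G (v z)" and ?F' = "\<lambda>z. quartic_slope a (v z)"
  let ?Ax = "\<lambda>z. - ((\<eta> z)\<^sup>2 * (?F' z * (- 2 * rad a (v z) (snd z) * q z) * q z + ?F z * r z))"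
  let ?By = "\<lambda>z. - 4 * snd z * \<eta> z * (?F z * p z) + (\<eta> z)\<^sup>2 * (?F' z * p z * p z + ?F z * r z)"
  have "integral ?Q (\<lambda>z. ?Ax z + ?By z) = 0"
  proof (rule green_rectangle_zero[where A = "\<lambda>z. - ((\<eta> z)\<^sup>2 * (?F z * q z))" and B = "\<lambda>z. (\<eta> z)\<^sup>2 * (?F z * p z)"])
    show "continuous_on ?Q ?Ax" "continuous_on ?Q ?By"
      unfolding \<eta>_def G_def by (intro continuous_intros continuous_on[OF Q] continuous_on2[OF Q] a_nonzero)+
  next
    fix x y assume y: "y \<in> {-R'..R'}"
    note derivs = derivs[OF inside[OF y], of x] derivs2[OF inside[OF y], of x]
      DERIV_chain2[OF dG]
    show "((\<lambda>t. - ((\<eta> (t, y))\<^sup>2 * (?F (t, y) * q (t, y)))) has_real_derivative ?Ax (x, y)) (at x)"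
      unfolding \<eta>_def by (auto intro!: derivative_eq_intros derivs simp: algebra_simps)
    show "((\<lambda>t. (\<eta> (x, t))\<^sup>2 * (?F (x, t) * p (x, t))) has_real_derivative ?By (x, y)) (at y)"
      unfolding \<eta>_def by (auto intro!: derivative_eq_intros derivs simp: algebra_simps)
  next
    fix y assume "y \<in> {-R'..R'}"
    then show "- ((\<eta> (c, y))\<^sup>2 * (?F (c, y) * q (c, y))) = - ((\<eta> (c + P, y))\<^sup>2 * (?F (c + P, y) * q (c + P, y)))"
      using periodic[OF inside, of y c] q_periodic[OF _ inside, of P y c] periodic by (simp add: \<eta>_def)
  qed (use P_pos R' in \<open>auto simp: \<eta>_def\<close>)
  moreover have "?Ax z + ?By z = (\<eta> z)\<^sup>2 * (?F' z * (2 * rad a (v z) (snd z) * (q z)\<^sup>2 + (p z)\<^sup>2))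
      - 4 * snd z * \<eta> z * (?F z * p z)" for z
    by (simp add: algebra_simps power2_eq_square)
  ultimately show ?thesis by (simp only: G_def)
qed

theorem energy_bound:
  assumes T: "1 \<le> T" "M\<^sup>2 + a\<^sup>2 \<le> T" and R': "0 < R'" "R' < R''" "R'' < R"
  shows "integral ({c..c+P} \<times> {-R'..R'}) energy \<le> 64 * T\<^sup>2 * R''\<^sup>2 * P * (2 * R'') / (R''\<^sup>2 - R'\<^sup>2)\<^sup>2"
proof -
  let ?Q = "{c..c+P} \<times> {-R'..R'}" and ?Q2 = "{c..c+P} \<times> {-R''..R''}"
  have Q: "?Q \<subseteq> open_strip R" "?Q2 \<subseteq> open_strip R" using R' by (intro Times_subset_open_strip; simp)+
  define \<eta> where "\<eta> z = R''\<^sup>2 - (snd z)\<^sup>2" for z :: "real \<times> real"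
  define h where "h = R''\<^sup>2 - R'\<^sup>2"
  have h: "0 < h" using R' by (simp add: h_def power_strict_mono)
  have cont: "continuous_on S (\<lambda>z. (\<eta> z)\<^sup>2 * energy z)" if "S \<subseteq> open_strip R" for S
    unfolding \<eta>_def by (intro continuous_intros continuous_on_energy that)
  have "integral ?Q2 (\<lambda>z. (\<eta> z)\<^sup>2 * energy z - 64 * T\<^sup>2 * R''\<^sup>2) \<le> integral ?Q2 (\<lambda>z. 4 * T *
      ((\<eta> z)\<^sup>2 * (quartic_slope a (v z) * (2 * rad a (v z) (snd z) * (q z)\<^sup>2 + (p z)\<^sup>2))
        - 4 * snd z * \<eta> z * (v z * quartic_weight a (v z) * p z)))"
  proof (intro integral_le integrable_continuous_rectangle continuous_intros cont Q)
    fix z assume z: "z \<in> ?Q2"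
    have y: "(snd z)\<^sup>2 \<le> R''\<^sup>2" "\<bar>snd z\<bar> < R" using z R' by (auto simp: abs_le_square_iff[symmetric])
    then have "(v z)\<^sup>2 \<le> M\<^sup>2" using v_bounded[of "snd z" "fst z"] by (simp add: abs_le_square_iff[symmetric])
    then have "(v z)\<^sup>2 + a\<^sup>2 \<le> T" using T by linarith
    moreover have "64 * T\<^sup>2 * (snd z)\<^sup>2 \<le> 64 * T\<^sup>2 * R''\<^sup>2" using y(1) by (intro mult_left_mono) auto
    ultimately show "(\<eta> z)\<^sup>2 * energy z - 64 * T\<^sup>2 * R''\<^sup>2 \<le> 4 * T *
      ((\<eta> z)\<^sup>2 * (quartic_slope a (v z) * (2 * rad a (v z) (snd z) * (q z)\<^sup>2 + (p z)\<^sup>2))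
        - 4 * snd z * \<eta> z * (v z * quartic_weight a (v z) * p z))"
      using energy_le_dissipation[OF a_nonzero _ T(1), of "v z" "\<eta> z" "p z" "snd z" "q z"]
      unfolding energy_def by linarith
  qed (auto simp: \<eta>_def intro!: continuous_intros continuous_on[OF Q(2)] continuous_on_energy[OF Q(2)] a_nonzero)
  also have "\<dots> = 0" using tested_equation[of R'' c] R' by (simp add: \<eta>_def)
  finally have "integral ?Q2 (\<lambda>z. (\<eta> z)\<^sup>2 * energy z) - integral ?Q2 (\<lambda>_. 64 * T\<^sup>2 * R''\<^sup>2) \<le> 0"
    by (subst (asm) Henstock_Kurzweil_Integration.integral_diff)
      (intro integrable_continuous_rectangle cont[OF Q(2)] continuous_on_const | assumption)+
  then have weighted: "integral ?Q2 (\<lambda>z. (\<eta> z)\<^sup>2 * energy z) \<le> 64 * T\<^sup>2 * R''\<^sup>2 * P * (2 * R'')"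
    using integral_rectangle_const[of c "c + P" "- R''" R''] P_pos R' by (simp add: mult_ac)
  have "h\<^sup>2 * integral ?Q energy = integral ?Q (\<lambda>z. h\<^sup>2 * energy z)" by simp
  also have "\<dots> \<le> integral ?Q (\<lambda>z. (\<eta> z)\<^sup>2 * energy z)"
  proof (intro integral_le integrable_continuous_rectangle cont continuous_intros continuous_on_energy Q)
    fix z assume "z \<in> ?Q"
    then have "(snd z)\<^sup>2 \<le> R'\<^sup>2" using R' by (auto simp: abs_le_square_iff[symmetric])
    then have "h\<^sup>2 \<le> (\<eta> z)\<^sup>2" using h by (intro power_mono) (auto simp: h_def \<eta>_def)
    then show "h\<^sup>2 * energy z \<le> (\<eta> z)\<^sup>2 * energy z" by (intro mult_right_mono energy_nonneg)
  qed
  also have "\<dots> \<le> integral ?Q2 (\<lambda>z. (\<eta> z)\<^sup>2 * energy z)"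
    by (intro integral_subset_le integrable_continuous_rectangle cont Q) (use R' energy_nonneg in auto)
  finally show ?thesis using weighted h unfolding h_def[symmetric] by (simp add: field_simps)
qed

end

section \<open>From averages to pointwise bounds\<close>

lemma exists_small_value:
  fixes E :: "real \<Rightarrow> real"
  assumes cont: "continuous_on {a..b} E" and nonneg: "\<And>t. t \<in> {a..b} \<Longrightarrow> 0 \<le> E t"
    and sub: "{c..c+r} \<subseteq> {a..b}" and r: "r > 0" and C: "integral {a..b} E \<le> C" "C > 0"
  shows "\<exists>t\<in>{c..c+r}. E t \<le> 2 * C / r"
proof (rule ccontr)
  assume "\<not> ?thesis"
  then have large: "2 * C / r \<le> E t" if "t \<in> {c..c+r}" for t using that by force
  have integrable: "E integrable_on {c..c+r}" "E integrable_on {a..b}"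
    using cont continuous_on_subset[OF cont sub] by (auto intro: integrable_continuous_real)
  have "2 * C = integral {c..c+r} (\<lambda>t. 2 * C / r)" using r by simp
  also have "\<dots> \<le> integral {c..c+r} E" by (rule integral_le) (use integrable large in auto)
  also have "\<dots> \<le> integral {a..b} E" by (rule integral_subset_le) (use integrable sub nonneg in auto)
  finally show False using C by simp
qed

definition segment_integrals_le :: "real set \<Rightarrow> real set \<Rightarrow> real \<Rightarrow> (real \<times> real \<Rightarrow> real) \<Rightarrow> bool" where
  "segment_integrals_le X Y \<eta> f \<longleftrightarrow>
     (\<forall>s s' t. s \<le> s' \<longrightarrow> {s..s'} \<subseteq> X \<longrightarrow> t \<in> Y \<longrightarrow> \<bar>integral {s..s'} (\<lambda>x. f (x, t))\<bar> \<le> \<eta>)"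

lemma segment_integrals_leD:
  "segment_integrals_le X Y \<eta> f \<Longrightarrow> s \<le> s' \<Longrightarrow> {s..s'} \<subseteq> X \<Longrightarrow> t \<in> Y \<Longrightarrow>
    \<bar>integral {s..s'} (\<lambda>x. f (x, t))\<bar> \<le> \<eta>"
  by (simp add: segment_integrals_le_def)

lemma segment_integrals_le_minus:
  "segment_integrals_le X Y \<eta> f \<Longrightarrow> segment_integrals_le X Y \<eta> (\<lambda>z. - f z)"
  by (simp add: segment_integrals_le_def)

lemma exists_le_of_segment_integrals_le:
  fixes f f0 :: "real \<times> real \<Rightarrow> real"
  assumes "segment_integrals_le X Y (\<gamma> * \<delta>) (\<lambda>z. f z - f0 z)" and s: "{s..s+\<delta>} \<subseteq> X" "t \<in> Y"
    and cont: "continuous_on {s..s+\<delta>} (\<lambda>x. f (x, t))" "continuous_on {s..s+\<delta>} (\<lambda>x. f0 (x, t))"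
    and pos: "\<delta> > 0" "\<gamma> > 0"
  shows "\<exists>x\<in>{s..s+\<delta>}. f (x, t) \<le> f0 (x, t) + 2 * \<gamma>"
proof (rule ccontr)
  assume "\<not> ?thesis"
  then have "2 * \<gamma> \<le> f (x, t) - f0 (x, t)" if "x \<in> {s..s+\<delta>}" for x using that by force
  then have "integral {s..s+\<delta>} (\<lambda>x. 2 * \<gamma>) \<le> integral {s..s+\<delta>} (\<lambda>x. f (x, t) - f0 (x, t))"
    by (intro integral_le integrable_continuous_real continuous_intros cont) auto
  moreover have "integral {s..s+\<delta>} (\<lambda>x. 2 * \<gamma>) = 2 * (\<gamma> * \<delta>)" using pos by simp
  moreover have "\<bar>integral {s..s+\<delta>} (\<lambda>x. f (x, t) - f0 (x, t))\<bar> \<le> \<gamma> * \<delta>"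
    using segment_integrals_leD[OF assms(1) _ s] pos by simp
  moreover have "0 < \<gamma> * \<delta>" using pos by simp
  ultimately show False by linarith
qed

locale finite_energy_rectangle =
  fixes f fs ft w :: "real \<times> real \<Rightarrow> real" and s0 t0 \<rho> \<delta> \<kappa> C :: real
  assumes pos: "0 < \<rho>" "0 < \<delta>" "4 * \<delta> \<le> \<rho>" "0 < C"
    and cont: "continuous_on ({s0-\<rho>..s0+\<rho>} \<times> {t0-\<rho>..t0+\<rho>}) fs"
      "continuous_on ({s0-\<rho>..s0+\<rho>} \<times> {t0-\<rho>..t0+\<rho>}) ft"
      "continuous_on ({s0-\<rho>..s0+\<rho>} \<times> {t0-\<rho>..t0+\<rho>}) w"
    and f_ds: "\<And>s t. s \<in> {s0-\<rho>..s0+\<rho>} \<Longrightarrow> t \<in> {t0-\<rho>..t0+\<rho>} \<Longrightarrow>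
      ((\<lambda>x. f (x, t)) has_real_derivative fs (s, t)) (at s)"
    and f_dt: "\<And>s t. s \<in> {s0-\<rho>..s0+\<rho>} \<Longrightarrow> t \<in> {t0-\<rho>..t0+\<rho>} \<Longrightarrow>
      ((\<lambda>x. f (s, x)) has_real_derivative ft (s, t)) (at t)"
    and w_pos: "\<And>z. 0 < w z"
    and w_inverse: "\<And>s s' t. s \<le> s' \<Longrightarrow> s' - s \<le> \<delta> \<Longrightarrow> {s..s'} \<subseteq> {s0-\<rho>..s0+\<rho>} \<Longrightarrow> t \<in> {t0-\<rho>..t0+\<rho>} \<Longrightarrow>
      integral {s..s'} (\<lambda>x. 1 / w (x, t)) \<le> \<kappa>"
    and energy: "integral ({s0-\<rho>..s0+\<rho>} \<times> {t0-\<rho>..t0+\<rho>}) (\<lambda>z. w z * (fs z)\<^sup>2) \<le> C"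
      "integral ({s0-\<rho>..s0+\<rho>} \<times> {t0-\<rho>..t0+\<rho>}) (\<lambda>z. (ft z)\<^sup>2) \<le> C"
    and max_principle: "max_principle_on {s0-\<rho>..s0+\<rho>} {t0-\<rho>..t0+\<rho>} f"
      "max_principle_on {s0-\<rho>..s0+\<rho>} {t0-\<rho>..t0+\<rho>} (\<lambda>z. - f z)"
begin

abbreviation S :: "real set" where "S \<equiv> {s0-\<rho>..s0+\<rho>}"

abbreviation T :: "real set" where "T \<equiv> {t0-\<rho>..t0+\<rho>}"

definition row_energy :: "real \<Rightarrow> real" where
  "row_energy t = integral S (\<lambda>s. w (s, t) * (fs (s, t))\<^sup>2)"

definition column_energy :: "real \<Rightarrow> real" where
  "column_energy s = integral T (\<lambda>t. (ft (s, t))\<^sup>2)"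

lemma cont_energy: "continuous_on (S \<times> T) (\<lambda>z. w z * (fs z)\<^sup>2)" "continuous_on (S \<times> T) (\<lambda>z. (ft z)\<^sup>2)"
  by (intro continuous_intros cont)+

lemma cont_row: "t \<in> T \<Longrightarrow> continuous_on S (\<lambda>s. w (s, t) * (fs (s, t))\<^sup>2)"
  by (rule continuous_on_Times_lines(2)[OF cont_energy(1)])

lemma cont_column: "s \<in> S \<Longrightarrow> continuous_on T (\<lambda>t. (ft (s, t))\<^sup>2)"
  by (rule continuous_on_Times_lines(1)[OF cont_energy(2)])

lemma continuous_on_row_energy: "continuous_on T row_energy"
  unfolding row_energy_def using continuous_on_integral_fst[OF cont_energy(1)] .

lemma continuous_on_column_energy: "continuous_on S column_energy"
  unfolding column_energy_def using continuous_on_integral_snd[OF cont_energy(2)] .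

lemma row_energy_nonneg: "t \<in> T \<Longrightarrow> 0 \<le> row_energy t"
  unfolding row_energy_def
  by (intro Henstock_Kurzweil_Integration.integral_nonneg integrable_continuous_real cont_row)
    (simp_all add: less_imp_le[OF w_pos])

lemma column_energy_nonneg: "s \<in> S \<Longrightarrow> 0 \<le> column_energy s"
  unfolding column_energy_def
  by (intro Henstock_Kurzweil_Integration.integral_nonneg integrable_continuous_real cont_column) simp_all

lemma exists_low_energy_row:
  assumes "0 < r" "{t..t+r} \<subseteq> T" shows "\<exists>\<tau>\<in>{t..t+r}. row_energy \<tau> \<le> 2 * C / r"
proof (rule exists_small_value[OF continuous_on_row_energy row_energy_nonneg assms(2,1) _ pos(4)])
  show "integral T row_energy \<le> C"
    using energy(1) unfolding integral_rectangle_dxdy[OF cont_energy(1)] row_energy_def .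
qed

lemma exists_low_energy_column:
  assumes "0 < r" "{s..s+r} \<subseteq> S" shows "\<exists>x\<in>{s..s+r}. column_energy x \<le> 2 * C / r"
proof (rule exists_small_value[OF continuous_on_column_energy column_energy_nonneg assms(2,1) _ pos(4)])
  show "integral S column_energy \<le> C"
    using energy(2) unfolding integral_rectangle_dydx[OF cont_energy(2)] column_energy_def .
qed

lemma row_increment:
  assumes s: "s \<le> s'" "s' - s \<le> \<delta>" "{s..s'} \<subseteq> S" and t: "t \<in> T"
  shows "(f (s', t) - f (s, t))\<^sup>2 \<le> \<kappa> * row_energy t"
proof -
  have lines: "continuous_on {s..s'} (\<lambda>x. fs (x, t))" "continuous_on {s..s'} (\<lambda>x. w (x, t))"
    using continuous_on_Times_lines(2)[OF cont(1) t] continuous_on_Times_lines(2)[OF cont(3) t] s(3)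
    by (auto intro: continuous_on_subset)
  have cont_sub: "continuous_on {s..s'} (\<lambda>x. w (x, t) * (fs (x, t))\<^sup>2)" by (intro continuous_intros lines)
  have nonneg: "0 \<le> integral {s..s'} (\<lambda>x. w (x, t) * (fs (x, t))\<^sup>2)"
    by (intro Henstock_Kurzweil_Integration.integral_nonneg integrable_continuous_real cont_sub)
      (simp add: less_imp_le[OF w_pos])
  have "f (s', t) - f (s, t) = integral {s..s'} (\<lambda>x. fs (x, t))"
    by (rule integral_real_derivative[symmetric]) (use s f_ds t in auto)
  then have "(f (s', t) - f (s, t))\<^sup>2
      \<le> integral {s..s'} (\<lambda>x. 1 / w (x, t)) * integral {s..s'} (\<lambda>x. w (x, t) * (fs (x, t))\<^sup>2)"
    using cauchy_schwarz_integral_weighted[OF s(1) lines w_pos] by simp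
  also have "\<dots> \<le> \<kappa> * integral {s..s'} (\<lambda>x. w (x, t) * (fs (x, t))\<^sup>2)"
    by (intro mult_right_mono w_inverse s t nonneg)
  also have "\<dots> \<le> \<kappa> * row_energy t"
  proof (rule mult_left_mono)
    show "integral {s..s'} (\<lambda>x. w (x, t) * (fs (x, t))\<^sup>2) \<le> row_energy t"
      unfolding row_energy_def
      by (intro integral_subset_le integrable_continuous_real cont_sub cont_row s t)
        (simp add: less_imp_le[OF w_pos])
    show "0 \<le> \<kappa>" using w_inverse[of s0 s0 t0] pos by simp
  qed
  finally show ?thesis .
qed

lemma column_increment:
  assumes t: "t \<le> t'" "{t..t'} \<subseteq> T" and s: "s \<in> S"
  shows "(f (s, t') - f (s, t))\<^sup>2 \<le> (t' - t) * column_energy s"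
proof -
  have line: "continuous_on {t..t'} (\<lambda>x. ft (s, x))"
    using continuous_on_Times_lines(1)[OF cont(2) s] t(2) by (auto intro: continuous_on_subset)
  have "f (s, t') - f (s, t) = integral {t..t'} (\<lambda>x. ft (s, x))"
    by (rule integral_real_derivative[symmetric]) (use s t f_dt in auto)
  then have "(f (s, t') - f (s, t))\<^sup>2 \<le> (t' - t) * integral {t..t'} (\<lambda>x. (ft (s, x))\<^sup>2)"
    using cauchy_schwarz_integral_weighted[OF t(1) line, of "\<lambda>_. 1"] t(1) by simp
  also have "\<dots> \<le> (t' - t) * column_energy s"
    unfolding column_energy_def
    by (intro mult_left_mono integral_subset_le integrable_continuous_real continuous_intros line
        cont_column s t) (use t in auto)
  finally show ?thesis .
qed

text \<open>If \<open>f\<close> exceeded the bound at a point, the maximum principle would force a curve of large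
  values to run from that point to a far away vertical side, while \<open>f\<close> is small on two good
  horizontal lines close to it; crossing from the curve to these lines costs too much energy.\<close>

context
  fixes r \<gamma> A :: real
  assumes r: "0 < r" "2 * r \<le> \<rho>" and \<gamma>: "0 < \<gamma>"
    and small: "\<kappa> * (2 * C) \<le> \<gamma>\<^sup>2 * r" "32 * r * C \<le> \<rho> * \<gamma>\<^sup>2"
    and segments: "\<And>s t. {s..s+\<delta>} \<subseteq> S \<Longrightarrow> t \<in> T \<Longrightarrow> \<exists>x\<in>{s..s+\<delta>}. f (x, t) \<le> A"
begin

lemma low_energy_row_le:
  assumes s: "s \<in> {s0-\<rho>/2..s0+\<rho>/2}" and t: "t \<in> T" "row_energy t \<le> 2 * C / r"
  shows "f (s, t) \<le> A + \<gamma>"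
proof -
  have sub: "{s..s+\<delta>} \<subseteq> S" using s pos by auto
  obtain x where x: "x \<in> {s..s+\<delta>}" "f (x, t) \<le> A" using segments[OF sub t(1)] by blast
  have "0 \<le> \<kappa>" using w_inverse[of s0 s0 t0] pos by simp
  have "(f (x, t) - f (s, t))\<^sup>2 \<le> \<kappa> * row_energy t" by (rule row_increment) (use x sub t in auto)
  also have "\<dots> \<le> \<kappa> * (2 * C / r)" by (rule mult_left_mono[OF t(2) \<open>0 \<le> \<kappa>\<close>])
  also have "\<dots> \<le> \<gamma>\<^sup>2" using small(1) r by (simp add: field_simps)
  finally have "\<bar>f (x, t) - f (s, t)\<bar> \<le> \<gamma>" using \<gamma> by (simp add: abs_le_square_iff[symmetric])
  then show ?thesis using x by linarith
qed

lemma low_energy_column_le: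
  assumes s: "s \<in> {s0-\<rho>/2..s0+\<rho>/2}" "column_energy s \<le> 2 * C / (\<rho> / 4)"
    and t1: "t1 \<in> T" "row_energy t1 \<le> 2 * C / r" and t: "t \<in> {t1..t1+4*r}" "t \<in> T"
  shows "f (s, t) \<le> A + 2 * \<gamma>"
proof -
  have sS: "s \<in> S" using s pos by auto
  have "(f (s, t) - f (s, t1))\<^sup>2 \<le> (t - t1) * column_energy s"
    by (rule column_increment) (use sS t t1 in auto)
  also have "\<dots> \<le> (4 * r) * (2 * C / (\<rho> / 4))"
    using t s column_energy_nonneg[OF sS] r by (intro mult_mono) auto
  also have "\<dots> \<le> \<gamma>\<^sup>2" using small(2) pos by (simp add: field_simps)
  finally have "\<bar>f (s, t) - f (s, t1)\<bar> \<le> \<gamma>" using \<gamma> by (simp add: abs_le_square_iff[symmetric])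
  then show ?thesis using low_energy_row_le[OF s(1) t1] by linarith
qed

lemma pointwise_le:
  assumes st: "\<bar>s - s0\<bar> \<le> \<rho> / 4" "\<bar>t - t0\<bar> \<le> r"
  shows "f (s, t) \<le> A + 2 * \<gamma>"
proof -
  have quarter: "0 < \<rho> / 4" using pos by simp
  obtain t1 where t1: "t1 \<in> {t0-2*r..t0-2*r+r}" "row_energy t1 \<le> 2 * C / r"
    using exists_low_energy_row[of r "t0-2*r"] r by auto
  obtain t2 where t2: "t2 \<in> {t0+r..t0+r+r}" "row_energy t2 \<le> 2 * C / r"
    using exists_low_energy_row[of r "t0+r"] r by auto
  obtain s1 where s1: "s1 \<in> {s-\<rho>/4..s-\<rho>/4+\<rho>/4}" "column_energy s1 \<le> 2 * C / (\<rho> / 4)"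
    using exists_low_energy_column[OF quarter, of "s-\<rho>/4"] st pos unfolding abs_le_iff by auto
  obtain s2 where s2: "s2 \<in> {s..s+\<rho>/4}" "column_energy s2 \<le> 2 * C / (\<rho> / 4)"
    using exists_low_energy_column[OF quarter, of s] st pos unfolding abs_le_iff by auto
  have ranges: "t1 \<in> T" "t2 \<in> T" "s1 \<in> {s0-\<rho>/2..s0+\<rho>/2}" "s2 \<in> {s0-\<rho>/2..s0+\<rho>/2}"
      "t1 < t2" "t \<in> {t1..t2}" "s \<in> {s1..s2}" "t2 \<le> t1 + 4 * r"
    using t1(1) t2(1) s1(1) s2(1) st pos r unfolding abs_le_iff by auto
  have sides: "f (s1, \<tau>) \<le> A + 2 * \<gamma>" "f (s2, \<tau>) \<le> A + 2 * \<gamma>" if "\<tau> \<in> {t1..t2}" for \<tau>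
    using low_energy_column_le[OF ranges(3) s1(2) ranges(1) t1(2), of \<tau>]
      low_energy_column_le[OF ranges(4) s2(2) ranges(1) t1(2), of \<tau>] that ranges by auto
  show ?thesis
  proof (cases "s1 < s2")
    case True
    show ?thesis
    proof (rule max_principle_onD[OF max_principle(1) True ranges(5)])
      fix x assume "x \<in> {s1..s2}"
      then have "x \<in> {s0-\<rho>/2..s0+\<rho>/2}" using ranges by auto
      then show "f (x, t1) \<le> A + 2 * \<gamma> \<and> f (x, t2) \<le> A + 2 * \<gamma>"
        using low_energy_row_le[of x t1] low_energy_row_le[of x t2] ranges t1 t2 \<gamma> by force
    qed (use ranges sides pos in auto)
  next
    case False
    then have "s = s1" using ranges by auto
    then show ?thesis using sides(1)[OF ranges(6)] by simp
  qed
qed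

end

lemma upper_deviation_le:
  assumes r: "0 < r" "2 * r \<le> \<rho>" and \<gamma>: "0 < \<gamma>"
    and small: "\<kappa> * (2 * C) \<le> \<gamma>\<^sup>2 * r" "32 * r * C \<le> \<rho> * \<gamma>\<^sup>2"
    and f0: "continuous_on (S \<times> T) f0" "\<And>z. z \<in> S \<times> T \<Longrightarrow> f0 z \<le> c + \<gamma>"
    and segments: "segment_integrals_le S T (\<gamma> * \<delta>) (\<lambda>z. f z - f0 z)"
    and st: "\<bar>s - s0\<bar> \<le> \<rho> / 4" "\<bar>t - t0\<bar> \<le> r"
  shows "f (s, t) \<le> c + 5 * \<gamma>"
proof -
  have "\<exists>x\<in>{s..s+\<delta>}. f (x, t) \<le> c + 3 * \<gamma>" if st: "{s..s+\<delta>} \<subseteq> S" "t \<in> T" for s t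
  proof -
    have "continuous_on {s..s+\<delta>} (\<lambda>x. f (x, t))"
      by (rule DERIV_continuous_on[OF has_field_derivative_at_within[OF f_ds[OF _ st(2)]]]) (use st(1) in blast)
    moreover have "continuous_on {s..s+\<delta>} (\<lambda>x. f0 (x, t))"
      using continuous_on_Times_lines(2)[OF f0(1) st(2)] st(1) by (rule continuous_on_subset)
    ultimately obtain x where x: "x \<in> {s..s+\<delta>}" "f (x, t) \<le> f0 (x, t) + 2 * \<gamma>"
      using exists_le_of_segment_integrals_le[OF segments st _ _ pos(2) \<gamma>] by blast
    moreover have "f0 (x, t) \<le> c + \<gamma>" by (rule f0(2)) (use x st in blast)
    ultimately show ?thesis by (intro bexI[of _ x]) auto
  qed
  then have "f (s, t) \<le> c + 3 * \<gamma> + 2 * \<gamma>" by (rule pointwise_le[OF r \<gamma> small _ st])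
  then show ?thesis by simp
qed

lemma minus:
  "finite_energy_rectangle (\<lambda>z. - f z) (\<lambda>z. - fs z) (\<lambda>z. - ft z) w s0 t0 \<rho> \<delta> \<kappa> C"
  by unfold_locales
    (use pos w_pos w_inverse energy max_principle in \<open>auto intro!: continuous_intros cont DERIV_minus f_ds f_dt\<close>)

theorem deviation_le:
  assumes r: "0 < r" "2 * r \<le> \<rho>" and \<gamma>: "0 < \<gamma>"
    and small: "\<kappa> * (2 * C) \<le> \<gamma>\<^sup>2 * r" "32 * r * C \<le> \<rho> * \<gamma>\<^sup>2"
    and f0: "continuous_on (S \<times> T) f0" "\<And>z. z \<in> S \<times> T \<Longrightarrow> \<bar>f0 z - c\<bar> \<le> \<gamma>"
    and segments: "segment_integrals_le S T (\<gamma> * \<delta>) (\<lambda>z. f z - f0 z)"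
    and st: "\<bar>s - s0\<bar> \<le> \<rho> / 4" "\<bar>t - t0\<bar> \<le> r"
  shows "\<bar>f (s, t) - c\<bar> \<le> 5 * \<gamma>"
proof -
  have "f0 z \<le> c + \<gamma>" "- f0 z \<le> - c + \<gamma>" if "z \<in> S \<times> T" for z
    using f0(2)[OF that] by linarith+
  moreover have "segment_integrals_le S T (\<gamma> * \<delta>) (\<lambda>z. - f z - - f0 z)"
    using segment_integrals_le_minus[OF segments] by simp
  ultimately have "f (s, t) \<le> c + 5 * \<gamma>" "- f (s, t) \<le> - c + 5 * \<gamma>"
    using upper_deviation_le[OF r \<gamma> small f0(1) _ segments st]
      finite_energy_rectangle.upper_deviation_le[OF minus r \<gamma> small continuous_on_minus[OF f0(1)] _ _ st]
    by blast+
  then show ?thesis by linarith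
qed

end

lemma integral_quartic_weight_le:
  assumes a: "a \<noteq> 0" and y: "y \<le> y'" "y' - y \<le> \<delta>" "0 < \<delta>"
  shows "integral {y..y'} (quartic_weight a) \<le> 6 * sqrt \<delta>"
proof (cases "\<bar>y\<bar> \<le> 2 * \<delta> \<and> \<bar>y'\<bar> \<le> 2 * \<delta>")
  case True
  have primitive_le: "\<bar>t * quartic_weight a t\<bar> \<le> 3 / 2 * sqrt \<delta>" if t: "\<bar>t\<bar> \<le> 2 * \<delta>" for t
  proof (cases "t = 0")
    case False
    have "\<bar>t * quartic_weight a t\<bar> \<le> \<bar>t\<bar> * (1 / sqrt \<bar>t\<bar>)"
      using False quartic_weight_pos[OF a, of t] unfolding abs_mult
      by (intro mult_left_mono) (simp_all add: quartic_weight_le_inverse_sqrt)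
    also have "\<dots> = sqrt \<bar>t\<bar>" using False by (simp add: real_div_sqrt)
    also have "\<dots> \<le> sqrt 2 * sqrt \<delta>" using t by (simp add: real_sqrt_mult[symmetric])
    also have "\<dots> \<le> 3 / 2 * sqrt \<delta>"
      using y by (intro mult_right_mono real_le_lsqrt) (auto simp: power2_eq_square)
    finally show ?thesis .
  qed (use y in simp)
  have "integral {y..y'} (quartic_weight a) \<le> integral {y..y'} (\<lambda>t. 2 * quartic_slope a t)"
    using quartic_slope_ge[OF a]
    by (intro integral_le integrable_continuous_real continuous_intros a) (simp add: field_simps)
  also have "\<dots> = 2 * (y' * quartic_weight a y' - y * quartic_weight a y)"
    using integral_real_derivative[OF y(1) mult_quartic_weight_has_derivative[OF a]] by simp
  also have "\<dots> \<le> 6 * sqrt \<delta>"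
  proof -
    have "y' * quartic_weight a y' \<le> 3 / 2 * sqrt \<delta>" "- (y * quartic_weight a y) \<le> 3 / 2 * sqrt \<delta>"
      using primitive_le[of y] primitive_le[of y'] True by (auto simp: abs_le_iff)
    then show ?thesis by simp
  qed
  finally show ?thesis .
next
  case False
  then have "\<delta> \<le> \<bar>t\<bar>" if "t \<in> {y..y'}" for t using that y by auto
  then have "integral {y..y'} (quartic_weight a) \<le> integral {y..y'} (\<lambda>t. 1 / sqrt \<delta>)"
    using y by (intro integral_le integrable_continuous_real continuous_intros a quartic_weight_le_inverse_sqrt) auto
  also have "\<dots> = (y' - y) / sqrt \<delta>" using y by simp
  also have "\<dots> \<le> \<delta> / sqrt \<delta>" using y by (intro divide_right_mono) auto
  also have "\<dots> \<le> 6 * sqrt \<delta>" using y by (simp add: real_div_sqrt)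
  finally show ?thesis .
qed

lemma rad_mult_sqrt_rad_le:
  assumes "\<bar>v\<bar> \<le> M" "\<bar>y\<bar> \<le> R"
  shows "rad a v y * sqrt (rad a v y) \<le> 1 + M\<^sup>2 + R\<^sup>2 + a\<^sup>2"
proof -
  let ?\<sigma> = "rad a v y"
  have "?\<sigma> * sqrt ?\<sigma> \<le> 1 + ?\<sigma>\<^sup>2"
  proof (cases "?\<sigma> \<le> 1")
    case True
    then have "?\<sigma> * sqrt ?\<sigma> \<le> 1 * 1" by (intro mult_mono) (auto simp: rad_nonneg)
    then show ?thesis using zero_le_power2[of ?\<sigma>] by linarith
  next
    case False
    then have "sqrt ?\<sigma> \<le> ?\<sigma>" by (intro real_le_lsqrt) (auto simp: power2_eq_square)
    then have "?\<sigma> * sqrt ?\<sigma> \<le> ?\<sigma>\<^sup>2" unfolding power2_eq_square by (intro mult_left_mono rad_nonneg)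
    then show ?thesis by simp
  qed
  moreover have "v\<^sup>2 \<le> M\<^sup>2" "y\<^sup>2 \<le> R\<^sup>2" using assms by (simp_all add: abs_le_square_iff[symmetric])
  ultimately show ?thesis by (simp add: rad_def)
qed

lemma inverse_rad_weight_mult_square:
  assumes "a \<noteq> 0"
  shows "1 / (4 * (rad a v y * sqrt (rad a v y))) * (- 2 * rad a v y * q)\<^sup>2 = sqrt (rad a v y) * q\<^sup>2"
proof -
  have "1 / (4 * (rad a v y * sqrt (rad a v y))) * (- 2 * rad a v y * q)\<^sup>2
      = (rad a v y)\<^sup>2 / (rad a v y * sqrt (rad a v y)) * q\<^sup>2"
    by (simp add: power_mult_distrib)
  also have "(rad a v y)\<^sup>2 / (rad a v y * sqrt (rad a v y)) = sqrt (rad a v y)"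
    using rad_pos[OF assms, of v y] by (simp add: power2_eq_square real_div_sqrt)
  finally show ?thesis .
qed

context bounded_periodic_dagger_C2
begin

lemma integral_rad_mult_sqrt_rad_le:
  assumes y: "\<bar>y\<bar> < R" and x: "x \<le> x'" "x' - x \<le> \<delta>"
  shows "integral {x..x'} (\<lambda>t. 4 * (rad a (v (t, y)) y * sqrt (rad a (v (t, y)) y))) \<le> 4 * (1 + M\<^sup>2 + R\<^sup>2 + a\<^sup>2) * \<delta>"
proof -
  let ?B = "1 + M\<^sup>2 + R\<^sup>2 + a\<^sup>2"
  have "rad a (v (t, y)) y * sqrt (rad a (v (t, y)) y) \<le> ?B" for t
    by (rule rad_mult_sqrt_rad_le) (use v_bounded y in \<open>auto simp: less_imp_le\<close>)
  then have "integral {x..x'} (\<lambda>t. 4 * (rad a (v (t, y)) y * sqrt (rad a (v (t, y)) y))) \<le> integral {x..x'} (\<lambda>t. 4 * ?B)"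
    by (intro integral_le integrable_continuous_real continuous_intros mult_left_mono
        continuous_on_horizontal_line[OF continuous(2) y]) auto
  also have "\<dots> = 4 * ?B * (x' - x)" using x(1) by simp
  also have "\<dots> \<le> 4 * ?B * \<delta>" by (intro mult_left_mono x) simp
  finally show ?thesis .
qed

lemma minus_bounded_periodic:
  "bounded_periodic_dagger_C2 R a (\<lambda>z. - u z) (\<lambda>z. - v z) (\<lambda>z. - p z) (\<lambda>z. - q z) (\<lambda>z. - r z) (\<lambda>z. - s z) P M"
  by (intro bounded_periodic_dagger_C2.intro bounded_periodic_dagger_C2_axioms.intro minus)
    (use a_nonzero P_pos periodic v_bounded in auto)

lemma max_principles:
  assumes "Y \<subseteq> {-R<..<R}"
  shows "max_principle_on X Y v" "max_principle_on X Y (\<lambda>z. - v z)"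
    "max_principle_on Y X (\<lambda>z. u (snd z, fst z))" "max_principle_on Y X (\<lambda>z. - u (snd z, fst z))"
proof -
  interpret minus: bounded_periodic_dagger_C2 R a "\<lambda>z. - u z" "\<lambda>z. - v z" "\<lambda>z. - p z" "\<lambda>z. - q z" "\<lambda>z. - r z" "\<lambda>z. - s z" P M
    by (rule minus_bounded_periodic)
  note restrict = max_principle_on_subset[OF _ subset_UNIV assms]
  show "max_principle_on X Y v" "max_principle_on X Y (\<lambda>z. - v z)"
    by (fact restrict[OF max_principle_v[OF a_nonzero]] restrict[OF minus.max_principle_v[OF a_nonzero]])+
  show "max_principle_on Y X (\<lambda>z. u (snd z, fst z))" "max_principle_on Y X (\<lambda>z. - u (snd z, fst z))"
    by (fact max_principle_on_swap[OF restrict[OF max_principle_u[OF a_nonzero]]]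
        max_principle_on_swap[OF restrict[OF minus.max_principle_u[OF a_nonzero]]])+
qed

lemma v_finite_energy_rectangle:
  assumes pos: "0 < \<rho>" "0 < \<delta>" "4 * \<delta> \<le> \<rho>" "0 < C" and y0: "\<bar>y0\<bar> + \<rho> < R"
    and C: "integral ({x0-\<rho>..x0+\<rho>} \<times> {y0-\<rho>..y0+\<rho>}) energy \<le> C"
  shows "finite_energy_rectangle v (\<lambda>z. - 2 * rad a (v z) (snd z) * q z) p
    (\<lambda>z. 1 / (4 * (rad a (v z) (snd z) * sqrt (rad a (v z) (snd z))))) x0 y0 \<rho> \<delta> (4 * (1 + M\<^sup>2 + R\<^sup>2 + a\<^sup>2) * \<delta>) C"
proof -
  let ?Q = "{x0-\<rho>..x0+\<rho>} \<times> {y0-\<rho>..y0+\<rho>}" and ?\<sigma> = "\<lambda>z. rad a (v z) (snd z)"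
  have inside: "\<bar>y\<bar> < R" if "y \<in> {y0-\<rho>..y0+\<rho>}" for y using that y0 by (auto simp: abs_less_iff abs_le_iff)
  then have Q: "?Q \<subseteq> open_strip R" by (auto simp: open_strip_def)
  have \<sigma>: "0 < ?\<sigma> z" for z by (rule rad_pos[OF a_nonzero])
  have energy_parts: "integral ?Q f \<le> C" if "continuous_on ?Q f" "\<And>z. f z \<le> energy z" for f
  proof -
    have "integral ?Q f \<le> integral ?Q energy"
      by (intro integral_le integrable_continuous_rectangle continuous_on_energy Q that)
    with C show ?thesis by linarith
  qed
  show ?thesis
  proof
    show "continuous_on ?Q (\<lambda>z. 1 / (4 * (?\<sigma> z * sqrt (?\<sigma> z))))"
      using \<sigma> by (intro continuous_intros continuous_on[OF Q]) (auto simp: less_imp_neq[symmetric])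
  next
    fix x x' y assume xx': "x \<le> x'" "x' - x \<le> \<delta>" "{x..x'} \<subseteq> {x0-\<rho>..x0+\<rho>}" and y: "y \<in> {y0-\<rho>..y0+\<rho>}"
    show "integral {x..x'} (\<lambda>t. 1 / (1 / (4 * (?\<sigma> (t, y) * sqrt (?\<sigma> (t, y)))))) \<le> 4 * (1 + M\<^sup>2 + R\<^sup>2 + a\<^sup>2) * \<delta>"
      using integral_rad_mult_sqrt_rad_le[OF inside[OF y] xx'(1,2)] by simp
  next
    show "integral ?Q (\<lambda>z. 1 / (4 * (?\<sigma> z * sqrt (?\<sigma> z))) * (- 2 * ?\<sigma> z * q z)\<^sup>2) \<le> C"
      unfolding inverse_rad_weight_mult_square[OF a_nonzero]
      by (intro energy_parts continuous_intros continuous_on[OF Q]) (simp add: energy_def)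
    show "integral ?Q (\<lambda>z. (p z)\<^sup>2) \<le> C"
      by (intro energy_parts continuous_intros continuous_on[OF Q]) (simp add: energy_def rad_nonneg)
    show "max_principle_on {x0-\<rho>..x0+\<rho>} {y0-\<rho>..y0+\<rho>} v" "max_principle_on {x0-\<rho>..x0+\<rho>} {y0-\<rho>..y0+\<rho>} (\<lambda>z. - v z)"
      by (intro max_principles; use inside in \<open>force simp: abs_less_iff\<close>)+
  qed (use pos \<sigma> inside v_dx v_dy in \<open>auto intro!: continuous_intros continuous_on[OF Q] mult_pos_pos\<close>)
qed

lemma u_finite_energy_rectangle:
  assumes pos: "0 < \<rho>" "0 < \<delta>" "4 * \<delta> \<le> \<rho>" "0 < C" and y0: "\<bar>y0\<bar> + \<rho> < R"
    and C: "integral ({x0-\<rho>..x0+\<rho>} \<times> {y0-\<rho>..y0+\<rho>}) energy \<le> C"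
  shows "finite_energy_rectangle (\<lambda>z. u (snd z, fst z)) (\<lambda>z. q (snd z, fst z)) (\<lambda>z. p (snd z, fst z))
    (\<lambda>z. sqrt (rad a (v (snd z, fst z)) (fst z))) y0 x0 \<rho> \<delta> (6 * sqrt \<delta>) C"
proof -
  let ?Q = "{x0-\<rho>..x0+\<rho>} \<times> {y0-\<rho>..y0+\<rho>}" and ?Q' = "{y0-\<rho>..y0+\<rho>} \<times> {x0-\<rho>..x0+\<rho>}"
  have inside: "\<bar>y\<bar> < R" if "y \<in> {y0-\<rho>..y0+\<rho>}" for y using that y0 by (auto simp: abs_less_iff abs_le_iff)
  then have Q: "?Q \<subseteq> open_strip R" by (auto simp: open_strip_def)
  have swap: "continuous_on ?Q' (\<lambda>z. f (snd z, fst z))" if "continuous_on (open_strip R) f" for f :: "real \<times> real \<Rightarrow> real"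
    by (rule continuous_on_Pair_compose[OF that]) (use Q in \<open>auto intro!: continuous_intros\<close>)
  have energy_parts: "integral ?Q' (\<lambda>z. f (snd z, fst z)) \<le> C" if "continuous_on ?Q f" "\<And>z. f z \<le> energy z" for f
  proof -
    have "integral ?Q f \<le> integral ?Q energy"
      by (intro integral_le integrable_continuous_rectangle continuous_on_energy Q that)
    with C show ?thesis unfolding integral_rectangle_swap[OF that(1)] by linarith
  qed
  show ?thesis
  proof
    show "continuous_on ?Q' (\<lambda>z. q (snd z, fst z))" "continuous_on ?Q' (\<lambda>z. p (snd z, fst z))"
      "continuous_on ?Q' (\<lambda>z. sqrt (rad a (v (snd z, fst z)) (fst z)))"
      by (intro continuous_intros swap continuous)+
  next
    fix y y' x assume yy': "y \<le> y'" "y' - y \<le> \<delta>" "{y..y'} \<subseteq> {y0-\<rho>..y0+\<rho>}"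
    then have sub: "{y..y'} \<subseteq> {-R<..<R}" using inside by (force simp: abs_less_iff)
    have "integral {y..y'} (\<lambda>t. 1 / sqrt (rad a (v (x, t)) t)) \<le> integral {y..y'} (quartic_weight a)"
      by (intro integral_le integrable_continuous_real continuous_intros a_nonzero
          continuous_on_vertical_line[OF continuous(2) sub] inverse_sqrt_rad_le_quartic_weight)
        (use rad_pos[OF a_nonzero] in \<open>auto simp: less_imp_neq[symmetric]\<close>)
    also have "\<dots> \<le> 6 * sqrt \<delta>" by (rule integral_quartic_weight_le[OF a_nonzero yy'(1,2) pos(2)])
    finally show "integral {y..y'} (\<lambda>t. 1 / sqrt (rad a (v (snd (t, x), fst (t, x))) (fst (t, x)))) \<le> 6 * sqrt \<delta>" by simp
  next
    have "continuous_on ?Q (\<lambda>z. sqrt (rad a (v z) (snd z)) * (q z)\<^sup>2)" "continuous_on ?Q (\<lambda>z. (p z)\<^sup>2)"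
      by (intro continuous_intros continuous_on[OF Q])+
    from this[THEN energy_parts]
    show "integral ?Q' (\<lambda>z. sqrt (rad a (v (snd z, fst z)) (fst z)) * (q (snd z, fst z))\<^sup>2) \<le> C"
      "integral ?Q' (\<lambda>z. (p (snd z, fst z))\<^sup>2) \<le> C"
      by (simp_all add: energy_def rad_nonneg)
    show "max_principle_on {y0-\<rho>..y0+\<rho>} {x0-\<rho>..x0+\<rho>} (\<lambda>z. u (snd z, fst z))"
      "max_principle_on {y0-\<rho>..y0+\<rho>} {x0-\<rho>..x0+\<rho>} (\<lambda>z. - u (snd z, fst z))"
      by (intro max_principles; use inside in \<open>force simp: abs_less_iff\<close>)+
  qed (use pos inside u_dx u_dy rad_pos[OF a_nonzero] in auto)
qed

end

text \<open>The scales \<open>r\<close> and \<open>\<delta>\<close> are the ones for which the error terms of \<open>deviation_le\<close> are small enough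
  both for \<open>v\<close>, where \<open>\<kappa> = B \<delta>\<close>, and for \<open>u\<close>, where \<open>\<kappa> = 6 \<delta>\<^bsup>1/2\<^esup>\<close>.\<close>

lemma exists_deviation_scales:
  fixes \<rho> \<gamma> B C :: real
  assumes pos: "0 < \<rho>" "0 < \<gamma>" "0 < B" "0 < C"
  shows "\<exists>r \<delta>. 0 < r \<and> r \<le> \<rho> / 4 \<and> 32 * r * C \<le> \<rho> * \<gamma>\<^sup>2 \<and> 0 < \<delta> \<and> 4 * \<delta> \<le> \<rho> \<and>
    B * \<delta> * (2 * C) \<le> \<gamma>\<^sup>2 * r \<and> 6 * sqrt \<delta> * (2 * C) \<le> \<gamma>\<^sup>2 * r"
proof -
  define r where "r = min (\<rho> / 4) (\<rho> * \<gamma>\<^sup>2 / (32 * C))"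
  have r: "0 < r" "r \<le> \<rho> / 4" "r \<le> \<rho> * \<gamma>\<^sup>2 / (32 * C)" using pos by (auto simp: r_def)
  define \<delta> where "\<delta> = min (\<rho> / 4) (min (\<gamma>\<^sup>2 * r / (2 * C * B)) ((\<gamma>\<^sup>2 * r / (12 * C))\<^sup>2))"
  have \<delta>: "0 < \<delta>" "4 * \<delta> \<le> \<rho>" "\<delta> \<le> \<gamma>\<^sup>2 * r / (2 * C * B)" using pos r by (auto simp: \<delta>_def)
  have "sqrt \<delta> \<le> \<gamma>\<^sup>2 * r / (12 * C)"
    by (rule real_le_lsqrt) (use pos r in \<open>auto simp: \<delta>_def\<close>)
  then show ?thesis
    using pos r \<delta> by (intro exI[of _ r] exI[of _ \<delta>]) (simp add: field_simps)
qed

lemma exists_small_square: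
  fixes f :: "real \<times> real \<Rightarrow> real"
  assumes "continuous_on (open_strip R) f" "\<bar>y0\<bar> < R" "0 < \<gamma>"
  shows "\<exists>\<rho>>0. \<bar>y0\<bar> + \<rho> < R \<and> (\<forall>z\<in>{x0-\<rho>..x0+\<rho>} \<times> {y0-\<rho>..y0+\<rho>}. \<bar>f z - f (x0, y0)\<bar> \<le> \<gamma>)"
proof -
  have "isCont f (x0, y0)"
    using assms open_open_strip by (simp add: continuous_on_eq_continuous_at open_strip_def)
  then obtain d where d: "d > 0" "\<And>z. dist z (x0, y0) < d \<Longrightarrow> dist (f z) (f (x0, y0)) < \<gamma>"
    using assms(3) unfolding continuous_at_eps_delta by blast
  define \<rho> where "\<rho> = min (d / 3) ((R - \<bar>y0\<bar>) / 2)"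
  have \<rho>: "0 < \<rho>" "\<bar>y0\<bar> + \<rho> < R" "\<rho> \<le> d / 3" using d(1) assms(2) by (auto simp: \<rho>_def min_def field_simps)
  have "\<bar>f z - f (x0, y0)\<bar> \<le> \<gamma>" if "z \<in> {x0-\<rho>..x0+\<rho>} \<times> {y0-\<rho>..y0+\<rho>}" for z
  proof -
    have "\<bar>fst z - x0\<bar> \<le> d / 3" "\<bar>snd z - y0\<bar> \<le> d / 3" using that \<rho>(3) unfolding abs_le_iff by auto
    then have "dist z (x0, y0) < d"
      using d(1) sqrt_sum_squares_le_sum_abs[of "fst z - x0" "snd z - y0"]
      by (cases z) (simp add: dist_Pair_Pair dist_real_def)
    then show ?thesis using d(2)[of z] by (simp add: dist_real_def)
  qed
  then show ?thesis using \<rho> by blast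
qed

lemma (in bounded_periodic_dagger_C2) local_energy_bound:
  assumes "\<bar>a\<bar> \<le> A" "0 < R'" "R' < R''" "R'' < R" "\<rho> \<le> P / 2" "\<bar>y0\<bar> + \<rho> \<le> R'"
  shows "integral ({x0-\<rho>..x0+\<rho>} \<times> {y0-\<rho>..y0+\<rho>}) energy
    \<le> 64 * (1 + M\<^sup>2 + A\<^sup>2)\<^sup>2 * R''\<^sup>2 * P * (2 * R'') / (R''\<^sup>2 - R'\<^sup>2)\<^sup>2"
proof -
  let ?Q = "{x0-P/2..x0-P/2+P} \<times> {-R'..R'}"
  have sub: "{x0-\<rho>..x0+\<rho>} \<times> {y0-\<rho>..y0+\<rho>} \<subseteq> ?Q" using assms by (auto simp: abs_le_iff)
  have Q: "?Q \<subseteq> open_strip R" using assms by (intro Times_subset_open_strip) auto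
  have "integral ({x0-\<rho>..x0+\<rho>} \<times> {y0-\<rho>..y0+\<rho>}) energy \<le> integral ?Q energy"
    using sub Q energy_nonneg
    by (intro integral_subset_le integrable_continuous_rectangle continuous_on_energy) auto
  also have "\<dots> \<le> 64 * (1 + M\<^sup>2 + A\<^sup>2)\<^sup>2 * R''\<^sup>2 * P * (2 * R'') / (R''\<^sup>2 - R'\<^sup>2)\<^sup>2"
    using assms abs_le_square_iff[of a A] by (intro energy_bound) auto
  finally show ?thesis .
qed

lemma exists_uniform_local_energy_bound:
  assumes P: "0 < P" and \<rho>: "0 < \<rho>" "\<rho> \<le> P / 2" "\<bar>y0\<bar> + \<rho> < R"
  shows "\<exists>C>0. \<forall>a u v p q r s. bounded_periodic_dagger_C2 R a u v p q r s P M \<longrightarrow> \<bar>a\<bar> \<le> A \<longrightarrow>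
    integral ({x0-\<rho>..x0+\<rho>} \<times> {y0-\<rho>..y0+\<rho>}) (dagger_C1.energy a v p q) \<le> C"
proof -
  define R' where "R' = \<bar>y0\<bar> + \<rho>"
  define R'' where "R'' = (R' + R) / 2"
  have R': "0 < R'" "R' < R''" "R'' < R" using \<rho> by (auto simp: R'_def R''_def field_simps)
  define C where "C = 64 * (1 + M\<^sup>2 + A\<^sup>2)\<^sup>2 * R''\<^sup>2 * P * (2 * R'') / (R''\<^sup>2 - R'\<^sup>2)\<^sup>2"
  have "0 < R''\<^sup>2 - R'\<^sup>2" using R' by (simp add: power_strict_mono)
  moreover have "0 < 1 + M\<^sup>2 + A\<^sup>2" by (simp add: add_pos_nonneg)
  ultimately have "0 < C" using R' P by (simp add: C_def)
  moreover have "integral ({x0-\<rho>..x0+\<rho>} \<times> {y0-\<rho>..y0+\<rho>}) (dagger_C1.energy a v p q) \<le> C"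
    if "bounded_periodic_dagger_C2 R a u v p q r s P M" "\<bar>a\<bar> \<le> A" for a u v p q r s
    unfolding C_def
    by (rule bounded_periodic_dagger_C2.local_energy_bound[OF that R' \<rho>(2)]) (simp add: R'_def)
  ultimately show ?thesis by blast
qed

lemma (in bounded_periodic_dagger_C2) close_of_segment_integrals_close:
  fixes u0 v0 :: "real \<times> real \<Rightarrow> real"
  defines "X \<equiv> \<lambda>x0 \<rho>. {x0-\<rho>..x0+\<rho>::real}"
  assumes \<rho>: "0 < \<rho>" "\<bar>y0\<bar> + \<rho> < R" and energy: "integral (X x0 \<rho> \<times> X y0 \<rho>) energy \<le> C" "0 < C"
    and \<gamma>: "0 < \<gamma>" and \<delta>: "0 < \<delta>" "4 * \<delta> \<le> \<rho>" and d: "0 < d" "d \<le> \<rho> / 4" "32 * d * C \<le> \<rho> * \<gamma>\<^sup>2"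
    and small: "4 * (1 + M\<^sup>2 + R\<^sup>2 + a\<^sup>2) * \<delta> * (2 * C) \<le> \<gamma>\<^sup>2 * d" "6 * sqrt \<delta> * (2 * C) \<le> \<gamma>\<^sup>2 * d"
    and cont: "continuous_on (open_strip R) u0" "continuous_on (open_strip R) v0"
    and osc: "\<And>z. z \<in> X x0 \<rho> \<times> X y0 \<rho> \<Longrightarrow> \<bar>u0 z - u0 (x0, y0)\<bar> \<le> \<gamma> \<and> \<bar>v0 z - v0 (x0, y0)\<bar> \<le> \<gamma>"
    and v: "segment_integrals_le (X x0 \<rho>) (X y0 \<rho>) (\<gamma> * \<delta>) (\<lambda>z. v z - v0 z)"
    and u: "segment_integrals_le (X y0 \<rho>) (X x0 \<rho>) (\<gamma> * \<delta>) (\<lambda>z. u (snd z, fst z) - k - u0 (snd z, fst z))"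
    and x: "\<bar>x - x0\<bar> \<le> d" and y: "\<bar>y - y0\<bar> \<le> d"
  shows "\<bar>v (x, y) - v0 (x0, y0)\<bar> \<le> 5 * \<gamma>" "\<bar>u (x, y) - k - u0 (x0, y0)\<bar> \<le> 5 * \<gamma>"
proof -
  note energy' = energy[unfolded X_def]
  have Q: "X x0 \<rho> \<times> X y0 \<rho> \<subseteq> open_strip R" using \<rho> by (auto simp: X_def open_strip_def)
  have twice: "2 * d \<le> \<rho>" using d \<rho> by linarith
  show "\<bar>v (x, y) - v0 (x0, y0)\<bar> \<le> 5 * \<gamma>"
    by (rule finite_energy_rectangle.deviation_le[OF
          v_finite_energy_rectangle[OF \<rho>(1) \<delta> energy'(2) \<rho>(2) energy'(1)] d(1) twice \<gamma> small(1) d(3)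
          continuous_on_subset[OF cont(2) Q[unfolded X_def]] _ v[unfolded X_def] _ y])
      (use osc x d in \<open>auto simp: X_def\<close>)
  have "\<bar>u (snd (y, x), fst (y, x)) - (u0 (x0, y0) + k)\<bar> \<le> 5 * \<gamma>"
  proof (rule finite_energy_rectangle.deviation_le[OF
        u_finite_energy_rectangle[OF \<rho>(1) \<delta> energy'(2) \<rho>(2) energy'(1)] d(1) twice \<gamma> small(2) d(3)])
    show "continuous_on ({y0-\<rho>..y0+\<rho>} \<times> {x0-\<rho>..x0+\<rho>}) (\<lambda>z. u0 (snd z, fst z) + k)"
      using Q by (intro continuous_intros continuous_on_Pair_compose[OF cont(1)]) (auto simp: X_def)
    show "\<bar>u0 (snd z, fst z) + k - (u0 (x0, y0) + k)\<bar> \<le> \<gamma>"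
      if "z \<in> {y0-\<rho>..y0+\<rho>} \<times> {x0-\<rho>..x0+\<rho>}" for z
      using osc[of "(snd z, fst z)"] that by (auto simp: X_def)
    show "segment_integrals_le {y0-\<rho>..y0+\<rho>} {x0-\<rho>..x0+\<rho>} (\<gamma> * \<delta>)
        (\<lambda>z. u (snd z, fst z) - (u0 (snd z, fst z) + k))"
      using u by (simp add: X_def algebra_simps)
  qed (use x y d in auto)
  then show "\<bar>u (x, y) - k - u0 (x0, y0)\<bar> \<le> 5 * \<gamma>" by (simp add: algebra_simps)
qed

definition controlled_by_averages :: "real \<Rightarrow> real \<Rightarrow> real \<Rightarrow> real \<Rightarrow> (real \<times> real \<Rightarrow> real) \<Rightarrow>
    (real \<times> real \<Rightarrow> real) \<Rightarrow> real \<Rightarrow> real \<Rightarrow> real \<Rightarrow> real \<Rightarrow> real \<Rightarrow> real \<Rightarrow> bool" where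
  "controlled_by_averages R P A M u0 v0 x0 y0 \<epsilon> \<rho> \<eta> d \<longleftrightarrow> (\<forall>a u v p q r s k x y.
    bounded_periodic_dagger_C2 R a u v p q r s P M \<longrightarrow> \<bar>a\<bar> \<le> A \<longrightarrow>
    segment_integrals_le {x0-\<rho>..x0+\<rho>} {y0-\<rho>..y0+\<rho>} \<eta> (\<lambda>z. v z - v0 z) \<longrightarrow>
    segment_integrals_le {y0-\<rho>..y0+\<rho>} {x0-\<rho>..x0+\<rho>} \<eta> (\<lambda>z. u (snd z, fst z) - k - u0 (snd z, fst z)) \<longrightarrow>
    \<bar>x - x0\<bar> \<le> d \<longrightarrow> \<bar>y - y0\<bar> \<le> d \<longrightarrow>
    \<bar>v (x, y) - v0 (x0, y0)\<bar> \<le> \<epsilon> \<and> \<bar>u (x, y) - k - u0 (x0, y0)\<bar> \<le> \<epsilon>)"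

theorem exists_controlled_by_averages:
  fixes u0 v0 :: "real \<times> real \<Rightarrow> real"
  assumes P: "0 < P" and y0: "\<bar>y0\<bar> < R" and \<epsilon>: "0 < \<epsilon>"
    and cont: "continuous_on (open_strip R) u0" "continuous_on (open_strip R) v0"
  shows "\<exists>\<rho> \<eta> d. 0 < \<rho> \<and> \<bar>y0\<bar> + \<rho> < R \<and> 0 < \<eta> \<and> 0 < d \<and> controlled_by_averages R P A M u0 v0 x0 y0 \<epsilon> \<rho> \<eta> d"
proof -
  define \<gamma> where "\<gamma> = \<epsilon> / 5"
  have \<gamma>: "0 < \<gamma>" using \<epsilon> by (simp add: \<gamma>_def)
  obtain \<rho>u where \<rho>u: "0 < \<rho>u" "\<And>z. z \<in> {x0-\<rho>u..x0+\<rho>u} \<times> {y0-\<rho>u..y0+\<rho>u} \<Longrightarrow> \<bar>u0 z - u0 (x0, y0)\<bar> \<le> \<gamma>"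
    using exists_small_square[OF cont(1) y0 \<gamma>] by blast
  obtain \<rho>v where \<rho>v: "0 < \<rho>v" "\<bar>y0\<bar> + \<rho>v < R"
    "\<And>z. z \<in> {x0-\<rho>v..x0+\<rho>v} \<times> {y0-\<rho>v..y0+\<rho>v} \<Longrightarrow> \<bar>v0 z - v0 (x0, y0)\<bar> \<le> \<gamma>"
    using exists_small_square[OF cont(2) y0 \<gamma>] by blast
  define \<rho> where "\<rho> = min (min \<rho>u \<rho>v) (P / 2)"
  have \<rho>: "0 < \<rho>" "\<rho> \<le> P / 2" "\<rho> \<le> \<rho>u" "\<rho> \<le> \<rho>v" using \<rho>u(1) \<rho>v(1) P by (auto simp: \<rho>_def)
  let ?X = "{x0-\<rho>..x0+\<rho>}" and ?Y = "{y0-\<rho>..y0+\<rho>}"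
  have osc: "\<bar>u0 z - u0 (x0, y0)\<bar> \<le> \<gamma> \<and> \<bar>v0 z - v0 (x0, y0)\<bar> \<le> \<gamma>" if "z \<in> ?X \<times> ?Y" for z
    using \<rho>u(2)[of z] \<rho>v(3)[of z] that \<rho> by auto
  have inside: "\<bar>y0\<bar> + \<rho> < R" using \<rho>(4) \<rho>v(2) by linarith
  obtain C where C: "0 < C" and energy: "\<And>a u v p q r s. bounded_periodic_dagger_C2 R a u v p q r s P M \<Longrightarrow>
      \<bar>a\<bar> \<le> A \<Longrightarrow> integral (?X \<times> ?Y) (dagger_C1.energy a v p q) \<le> C"
    using exists_uniform_local_energy_bound[OF P \<rho>(1,2) inside, of M A x0] by blast
  define B where "B = 4 * (1 + M\<^sup>2 + R\<^sup>2 + A\<^sup>2)"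
  have "0 < B" by (simp add: B_def add_pos_nonneg)
  then obtain d \<delta> where d: "0 < d" "d \<le> \<rho> / 4" "32 * d * C \<le> \<rho> * \<gamma>\<^sup>2" and \<delta>: "0 < \<delta>" "4 * \<delta> \<le> \<rho>"
    and small: "B * \<delta> * (2 * C) \<le> \<gamma>\<^sup>2 * d" "6 * sqrt \<delta> * (2 * C) \<le> \<gamma>\<^sup>2 * d"
    using exists_deviation_scales[OF \<rho>(1) \<gamma> _ C] by blast
  have "controlled_by_averages R P A M u0 v0 x0 y0 \<epsilon> \<rho> (\<gamma> * \<delta>) d"
    unfolding controlled_by_averages_def
  proof (intro allI impI)
    fix a u v p q r s k x y
    assume S: "bounded_periodic_dagger_C2 R a u v p q r s P M" and a: "\<bar>a\<bar> \<le> A"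
      and v: "segment_integrals_le ?X ?Y (\<gamma> * \<delta>) (\<lambda>z. v z - v0 z)"
      and u: "segment_integrals_le ?Y ?X (\<gamma> * \<delta>) (\<lambda>z. u (snd z, fst z) - k - u0 (snd z, fst z))"
      and x: "\<bar>x - x0\<bar> \<le> d" and y: "\<bar>y - y0\<bar> \<le> d"
    have "a\<^sup>2 \<le> A\<^sup>2" using a by (simp add: abs_le_square_iff[symmetric])
    then have "4 * (1 + M\<^sup>2 + R\<^sup>2 + a\<^sup>2) * \<delta> * (2 * C) \<le> B * \<delta> * (2 * C)"
      unfolding B_def using \<delta> C by (intro mult_right_mono) auto
    then have small_v: "4 * (1 + M\<^sup>2 + R\<^sup>2 + a\<^sup>2) * \<delta> * (2 * C) \<le> \<gamma>\<^sup>2 * d" using small(1) by linarith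
    show "\<bar>v (x, y) - v0 (x0, y0)\<bar> \<le> \<epsilon> \<and> \<bar>u (x, y) - k - u0 (x0, y0)\<bar> \<le> \<epsilon>"
      using bounded_periodic_dagger_C2.close_of_segment_integrals_close[OF S \<rho>(1) inside energy[OF S a] C \<gamma> \<delta> d
          small_v small(2) cont osc v u x y]
      by (simp_all add: \<gamma>_def)
  qed
  then show ?thesis using \<rho>(1) inside mult_pos_pos[OF \<gamma> \<delta>(1)] d(1) by blast
qed

section \<open>The potential of the difference of two solutions\<close>

text \<open>A primitive of \<open>v \<mapsto> 1 / rad a v y\<close>. In terms of \<open>w = rad_primitive a v y\<close> the second equation of the
  system reads \<open>\<partial>w/\<partial>x = -2 \<partial>u/\<partial>y\<close>.\<close>

definition rad_primitive :: "real \<Rightarrow> real \<Rightarrow> real \<Rightarrow> real" where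
  "rad_primitive a v y = arsinh (v / sqrt (y\<^sup>2 + a\<^sup>2))"

lemma rad_eq_mult_sqrt:
  assumes "a \<noteq> 0"
  shows "rad a v y = sqrt (y\<^sup>2 + a\<^sup>2) * sqrt ((v / sqrt (y\<^sup>2 + a\<^sup>2))\<^sup>2 + 1)"
proof -
  have "(y\<^sup>2 + a\<^sup>2) * ((v / sqrt (y\<^sup>2 + a\<^sup>2))\<^sup>2 + 1) = v\<^sup>2 + y\<^sup>2 + a\<^sup>2"
    using sum_squares_pos[OF assms, of y] assms by (simp add: power_divide distrib_left)
  then show ?thesis by (simp add: rad_def real_sqrt_mult[symmetric])
qed

lemma rad_primitive_has_derivative:
  assumes a: "a \<noteq> 0" and f: "(f has_real_derivative f') (at x)"
  shows "((\<lambda>t. rad_primitive a (f t) y) has_real_derivative f' / rad a (f x) y) (at x)"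
proof -
  define \<tau> where "\<tau> = sqrt (y\<^sup>2 + a\<^sup>2)"
  have \<tau>: "\<tau> > 0" using sum_squares_pos[OF a, of y] by (simp add: \<tau>_def)
  have "((\<lambda>t. arsinh (f t / \<tau>)) has_real_derivative 1 / sqrt ((f x / \<tau>)\<^sup>2 + 1) * (f' / \<tau>)) (at x)"
    by (rule DERIV_chain2[OF arsinh_real_has_field_derivative]) (use \<tau> f in \<open>auto intro!: derivative_eq_intros\<close>)
  moreover have "1 / sqrt ((f x / \<tau>)\<^sup>2 + 1) * (f' / \<tau>) = f' / rad a (f x) y"
    using rad_eq_mult_sqrt[OF a, of "f x" y] by (simp add: \<tau>_def mult.commute)
  ultimately show ?thesis unfolding rad_primitive_def \<tau>_def by (simp only:)
qed

lemma rad_primitive_mono: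
  assumes "a \<noteq> 0" "v \<le> v'" shows "rad_primitive a v y \<le> rad_primitive a v' y"
proof -
  have "v / sqrt (y\<^sup>2 + a\<^sup>2) \<le> v' / sqrt (y\<^sup>2 + a\<^sup>2)" using assms by (intro divide_right_mono) auto
  then show ?thesis unfolding rad_primitive_def by (simp add: not_less[symmetric])
qed

lemma diff_mult_rad_primitive_diff_nonneg:
  assumes "a \<noteq> 0" shows "0 \<le> (v1 - v2) * (rad_primitive a v1 y - rad_primitive a v2 y)"
  using rad_primitive_mono[OF assms, of v1 v2 y] rad_primitive_mono[OF assms, of v2 v1 y]
  by (cases "v1 \<le> v2") (auto intro: mult_nonpos_nonpos)

lemma rad_primitive_lipschitz:
  assumes "a \<noteq> 0"
  shows "\<bar>rad_primitive a v1 y - rad_primitive a v2 y\<bar> \<le> 1 / sqrt (y\<^sup>2 + a\<^sup>2) * \<bar>v1 - v2\<bar>"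
proof (rule abs_diff_le_of_bounded_derivative[where S = UNIV])
  show "((\<lambda>t. rad_primitive a t y) has_real_derivative 1 / rad a t y) (at t)" for t
    using rad_primitive_has_derivative[OF assms DERIV_ident] .
  show "\<bar>1 / rad a t y\<bar> \<le> 1 / sqrt (y\<^sup>2 + a\<^sup>2)" for t
  proof -
    have "1 / rad a t y \<le> 1 / sqrt (y\<^sup>2 + a\<^sup>2)"
      using sum_squares_pos[OF assms, of y] rad_pos[OF assms, of t y]
      by (intro divide_left_mono) (auto simp: rad_def)
    then show ?thesis by (simp add: rad_nonneg)
  qed
qed auto

lemma arsinh_le_sqrt:
  assumes x: "0 \<le> x" shows "arsinh x \<le> 2 * sqrt (2 * (x::real))"
proof -
  have "sqrt (x\<^sup>2 + 1) \<le> x + 1" by (rule real_le_lsqrt) (use x in \<open>auto simp: power2_eq_square algebra_simps\<close>)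
  then have "arsinh x \<le> ln (1 + 2 * x)"
    unfolding arsinh_real_def using arsinh_real_aux[of x] x by (subst ln_le_cancel_iff) auto
  also have "\<dots> = 2 * ln (sqrt (1 + 2 * x))" using x by (simp add: ln_sqrt)
  also have "\<dots> \<le> 2 * (sqrt (1 + 2 * x) - 1)" using x ln_le_minus_one[of "sqrt (1 + 2 * x)"] by simp
  also have "\<dots> \<le> 2 * sqrt (2 * x)" using sqrt_add_le_add_sqrt[of 1 "2 * x"] x by simp
  finally show ?thesis .
qed

lemma abs_arsinh: "\<bar>arsinh x\<bar> = arsinh \<bar>x::real\<bar>"
  using arsinh_real_neg_iff[of x] by (cases "0 \<le> x") (auto simp: abs_if)

lemma abs_rad_primitive_le:
  assumes a: "a \<noteq> 0" and v: "\<bar>v\<bar> \<le> M"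
  shows "\<bar>rad_primitive a v y\<bar> \<le> 2 * sqrt (2 * M) * quartic_weight a y"
proof -
  define \<tau> where "\<tau> = sqrt (y\<^sup>2 + a\<^sup>2)"
  have \<tau>: "\<tau> > 0" using sum_squares_pos[OF a, of y] by (simp add: \<tau>_def)
  have "\<bar>rad_primitive a v y\<bar> = arsinh (\<bar>v\<bar> / \<tau>)"
    using \<tau> by (simp add: rad_primitive_def abs_arsinh abs_divide \<tau>_def)
  also have "\<dots> \<le> 2 * sqrt (2 * (\<bar>v\<bar> / \<tau>))" by (rule arsinh_le_sqrt) (use \<tau> in simp)
  also have "\<dots> \<le> 2 * sqrt (2 * (M / \<tau>))" using v \<tau> by (simp add: divide_right_mono)
  also have "\<dots> = 2 * sqrt (2 * M) * quartic_weight a y"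
    by (simp add: real_sqrt_mult real_sqrt_divide quartic_weight_eq_inverse_sqrt \<tau>_def)
  finally show ?thesis .
qed

lemma continuous_on_Times_of_bounded_derivative:
  fixes h k :: "real \<times> real \<Rightarrow> real"
  assumes cont: "\<And>y. y \<in> Y \<Longrightarrow> continuous_on X (\<lambda>x. h (x, y))" and Y: "convex Y"
    and h_dy: "\<And>x y. x \<in> X \<Longrightarrow> y \<in> Y \<Longrightarrow> ((\<lambda>t. h (x, t)) has_real_derivative k (x, y)) (at y)"
    and K: "0 \<le> K" "\<And>z. z \<in> X \<times> Y \<Longrightarrow> \<bar>k z\<bar> \<le> K"
  shows "continuous_on (X \<times> Y) h"
proof -
  have lipschitz: "K-lipschitz_on Y (\<lambda>y. h (x, y))" if x: "x \<in> X" for x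
  proof (rule lipschitz_onI)
    show "dist (h (x, y)) (h (x, y')) \<le> K * dist y y'" if "y \<in> Y" "y' \<in> Y" for y y'
      unfolding dist_real_def
      by (rule abs_diff_le_of_bounded_derivative[where S = Y and f' = "\<lambda>t. k (x, t)"])
        (use x that Y h_dy K in auto)
  qed (rule K(1))
  have "local_lipschitz X Y (\<lambda>x y. h (x, y))"
    by (rule local_lipschitzI, rule exI[of _ 1], rule conjI[OF zero_less_one], rule exI[of _ K])
      (auto intro: lipschitz_on_subset[OF lipschitz])
  from continuous_on_TimesI[OF this cont] show ?thesis by (simp add: case_prod_eta)
qed

lemma potential_exists:
  fixes g k m :: "real \<times> real \<Rightarrow> real"
  assumes ab: "a < b" "c < d"
    and cont: "continuous_on ({a..b} \<times> {c..d}) g" "continuous_on ({a..b} \<times> {c..d}) k"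
      "continuous_on ({a..b} \<times> {c..d}) m"
    and g_dy: "\<And>x y. x \<in> {a..b} \<Longrightarrow> y \<in> {c..d} \<Longrightarrow> ((\<lambda>t. g (x, t)) has_real_derivative m (x, y)) (at y)"
    and k_dx: "\<And>x y. x \<in> {a..b} \<Longrightarrow> y \<in> {c..d} \<Longrightarrow> ((\<lambda>t. k (t, y)) has_real_derivative m (x, y)) (at x)"
  shows "\<exists>h. continuous_on ({a<..<b} \<times> {c<..<d}) h \<and> (\<forall>x\<in>{a<..<b}. \<forall>y\<in>{c<..<d}.
      ((\<lambda>t. h (t, y)) has_real_derivative g (x, y)) (at x) \<and>
      ((\<lambda>t. h (x, t)) has_real_derivative k (x, y)) (at y))"
proof -
  define h where "h z = integral {c..snd z} (\<lambda>t. k (fst z, t)) + integral {a..fst z} (\<lambda>t. g (t, c))" for z :: "real \<times> real"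
  have h_dx: "((\<lambda>t. h (t, y)) has_real_derivative g (x, y)) (at x)" if x: "x \<in> {a<..<b}" and y: "y \<in> {c<..<d}" for x y
  proof -
    have sub: "{c..y} \<subseteq> {c..d}" using y by auto
    have "((\<lambda>x. integral {c..y} (\<lambda>t. k (x, t))) has_real_derivative integral {c..y} (\<lambda>t. m (x, t))) (at x)"
    proof (rule has_real_derivative_integral_snd[where c = a and d = b])
      show "continuous_on ({a<..<b} \<times> {c..y}) m" by (rule continuous_on_subset[OF cont(3)]) (use sub in auto)
      show "continuous_on {c..y} (\<lambda>t. k (x, t))" if "x \<in> {a<..<b}" for x
        by (rule continuous_on_subset[OF continuous_on_Times_lines(1)[OF cont(2)] sub]) (use that in auto)
    qed (use x sub k_dx in auto)
    moreover have "integral {c..y} (\<lambda>t. m (x, t)) = g (x, y) - g (x, c)"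
      by (rule integral_real_derivative) (use x y g_dy in auto)
    moreover have "((\<lambda>x. integral {a..x} (\<lambda>t. g (t, c))) has_real_derivative g (x, c)) (at x within {a..b})"
      by (rule integral_has_real_derivative) (use x ab continuous_on_Times_lines(2)[OF cont(1)] in auto)
    then have "((\<lambda>x. integral {a..x} (\<lambda>t. g (t, c))) has_real_derivative g (x, c)) (at x)"
      using x by (simp add: at_within_Icc_at)
    ultimately show ?thesis unfolding h_def using DERIV_add by fastforce
  qed
  have h_dy: "((\<lambda>t. h (x, t)) has_real_derivative k (x, y)) (at y)" if x: "x \<in> {a<..<b}" and y: "y \<in> {c<..<d}" for x y
  proof -
    have "((\<lambda>y. integral {c..y} (\<lambda>t. k (x, t))) has_real_derivative k (x, y)) (at y within {c..d})"
      by (rule integral_has_real_derivative) (use x y continuous_on_Times_lines(1)[OF cont(2)] in auto)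
    then have "((\<lambda>y. integral {c..y} (\<lambda>t. k (x, t))) has_real_derivative k (x, y)) (at y)"
      using y by (simp add: at_within_Icc_at)
    then show ?thesis unfolding h_def by (auto intro!: derivative_eq_intros)
  qed
  have "bounded (k ` ({a..b} \<times> {c..d}))"
    by (intro compact_imp_bounded compact_continuous_image cont) (simp add: compact_Times)
  then obtain K where K: "K > 0" "\<And>z. z \<in> {a..b} \<times> {c..d} \<Longrightarrow> \<bar>k z\<bar> \<le> K" by (auto simp: bounded_pos)
  have "continuous_on {a<..<b} (\<lambda>x. h (x, y))" if "y \<in> {c<..<d}" for y
    by (rule DERIV_continuous_on[OF has_field_derivative_at_within[OF h_dx[OF _ that]]])
  then have "continuous_on ({a<..<b} \<times> {c<..<d}) h"
    by (rule continuous_on_Times_of_bounded_derivative[OF _ _ h_dy less_imp_le[OF K(1)]]) (use K(2) in auto)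
  then show ?thesis using h_dx h_dy by (intro exI[of _ h]) auto
qed

lemma convex_on_le_max:
  fixes f :: "real \<Rightarrow> real"
  assumes "convex_on {a..b} f" and x: "x \<in> {a..b}"
  shows "f x \<le> max (f a) (f b)"
proof -
  have "x \<in> closed_segment a b" using x by (simp add: closed_segment_eq_real_ivl)
  then obtain t where t: "0 \<le> t" "t \<le> 1" "x = (1 - t) *\<^sub>R a + t *\<^sub>R b" unfolding in_segment by blast
  show ?thesis unfolding t(3) by (rule convex_lower[OF assms(1)]) (use t x in auto)
qed

lemma three_quarters_power_has_derivative:
  assumes a: "a \<noteq> 0"
  shows "((\<lambda>y. (y\<^sup>2 + a\<^sup>2) powr (3 / 4)) has_real_derivative 3 / 2 * (y * quartic_weight a y)) (at y)"
proof -
  have "((\<lambda>y. (y\<^sup>2 + a\<^sup>2) powr (3 / 4)) has_real_derivative 3 / 4 * (y\<^sup>2 + a\<^sup>2) powr (3 / 4 - 1) * (2 * y)) (at y)"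
    by (rule DERIV_chain2[where g = "\<lambda>y. y\<^sup>2 + a\<^sup>2", OF has_real_derivative_powr])
      (use sum_squares_pos[OF a, of y] in \<open>auto intro!: derivative_eq_intros\<close>)
  then show ?thesis by (simp add: quartic_weight_def mult.commute mult.left_commute)
qed

text \<open>The barrier works because the second derivative of \<open>4/3 (y\<^sup>2 + a\<^sup>2)\<^bsup>3/4\<^esup>\<close> is at least \<open>quartic_weight a y\<close>.\<close>

lemma convex_on_add_barrier:
  fixes N N' N'' :: "real \<Rightarrow> real"
  assumes a: "a \<noteq> 0" and bc: "0 \<le> b" "0 \<le> c"
    and N': "\<And>y. y \<in> {-R..R} \<Longrightarrow> (N has_real_derivative N' y) (at y)"
    and N'': "\<And>y. y \<in> {-R..R} \<Longrightarrow> (N' has_real_derivative N'' y) (at y)"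
    and bounds: "\<And>y. y \<in> {-R..R} \<Longrightarrow> 0 \<le> N y \<and> N y \<le> \<mu>"
    and almost_convex: "\<And>y. y \<in> {-R..R} \<Longrightarrow> - (c * quartic_weight a y + b) * (N y + 2) \<le> N'' y"
  shows "convex_on {-R..R} (\<lambda>y. N y + (\<mu> + 2) * (4 / 3 * c * (y\<^sup>2 + a\<^sup>2) powr (3 / 4) + b * (y\<^sup>2 / 2)))"
proof (rule f''_ge0_imp_convex)
  define F where "F y = y * quartic_weight a y" for y
  have F': "(F has_real_derivative quartic_slope a y) (at y)" for y
    unfolding F_def by (rule mult_quartic_weight_has_derivative[OF a])
  fix y assume y: "y \<in> {-R..R}"
  let ?B' = "\<lambda>y. N' y + (\<mu> + 2) * (2 * c * F y + b * y)"
  show "((\<lambda>y. N y + (\<mu> + 2) * (4 / 3 * c * (y\<^sup>2 + a\<^sup>2) powr (3 / 4) + b * (y\<^sup>2 / 2))) has_real_derivative ?B' y) (at y)"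
    unfolding F_def
    by (rule DERIV_cong[OF DERIV_add[OF N'[OF y] DERIV_cmult[OF DERIV_add[OF
            DERIV_cmult[OF three_quarters_power_has_derivative[OF a]] DERIV_cmult[OF DERIV_cdivide[OF DERIV_pow]]]]]]) simp
  show "(?B' has_real_derivative N'' y + (\<mu> + 2) * (2 * c * quartic_slope a y + b)) (at y)"
    by (auto intro!: derivative_eq_intros N''[OF y] F')
  have "(c * quartic_weight a y + b) * (N y + 2) \<le> (2 * c * quartic_slope a y + b) * (\<mu> + 2)"
  proof (rule mult_mono)
    have "c * (quartic_weight a y / 2) \<le> c * quartic_slope a y" by (intro mult_left_mono quartic_slope_ge a bc)
    then show slope: "c * quartic_weight a y + b \<le> 2 * c * quartic_slope a y + b" by simp
    have "0 \<le> c * quartic_weight a y" using bc quartic_weight_pos[OF a, of y] by simp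
    with slope show "0 \<le> 2 * c * quartic_slope a y + b" using bc by linarith
  qed (use bounds[OF y] in auto)
  then show "0 \<le> N'' y + (\<mu> + 2) * (2 * c * quartic_slope a y + b)"
    using almost_convex[OF y] unfolding mult_minus_left mult.commute[of "\<mu> + 2"] by linarith
qed simp

lemma almost_convex_le:
  fixes N N' N'' :: "real \<Rightarrow> real"
  assumes a: "a \<noteq> 0" and bc: "0 \<le> b" "0 \<le> c"
    and N': "\<And>y. y \<in> {-R..R} \<Longrightarrow> (N has_real_derivative N' y) (at y)"
    and N'': "\<And>y. y \<in> {-R..R} \<Longrightarrow> (N' has_real_derivative N'' y) (at y)"
    and nonneg: "\<And>y. y \<in> {-R..R} \<Longrightarrow> 0 \<le> N y"
    and almost_convex: "\<And>y. y \<in> {-R..R} \<Longrightarrow> - (c * quartic_weight a y + b) * (N y + 2) \<le> N'' y"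
    and edges: "N R \<le> \<beta>" "N (- R) \<le> \<beta>"
    and \<theta>: "4 / 3 * c * (R\<^sup>2 + a\<^sup>2) powr (3 / 4) + b * (R\<^sup>2 / 2) \<le> \<theta>" "\<theta> \<le> 1 / 2"
    and y: "y \<in> {-R..R}"
  shows "N y \<le> 2 * \<beta> + 4 * \<theta>"
proof -
  have "continuous_on {-R..R} N" by (rule DERIV_continuous_on[OF has_field_derivative_at_within[OF N']])
  then obtain y0 where y0: "y0 \<in> {-R..R}" and max: "\<And>y. y \<in> {-R..R} \<Longrightarrow> N y \<le> N y0"
    using continuous_attains_sup[of "{-R..R}" N] y by auto
  let ?\<mu> = "N y0"
  have \<mu>: "0 \<le> ?\<mu>" by (rule nonneg[OF y0])
  define barrier where "barrier y = 4 / 3 * c * (y\<^sup>2 + a\<^sup>2) powr (3 / 4) + b * (y\<^sup>2 / 2)" for y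
  have convex: "convex_on {-R..R} (\<lambda>y. N y + (?\<mu> + 2) * barrier y)"
    unfolding barrier_def by (rule convex_on_add_barrier[OF a bc N' N'' conjI[OF nonneg max] almost_convex])
  have "N y0 \<le> N y0 + (?\<mu> + 2) * barrier y0" using bc \<mu> by (simp add: barrier_def)
  also have "\<dots> \<le> max (N (- R) + (?\<mu> + 2) * barrier (- R)) (N R + (?\<mu> + 2) * barrier R)"
    by (rule convex_on_le_max[OF convex y0])
  also have "\<dots> \<le> \<beta> + (?\<mu> + 2) * \<theta>"
  proof -
    have "barrier R \<le> \<theta>" "barrier (- R) \<le> \<theta>" using \<theta>(1) by (simp_all add: barrier_def)
    then have "(?\<mu> + 2) * barrier R \<le> (?\<mu> + 2) * \<theta>" "(?\<mu> + 2) * barrier (- R) \<le> (?\<mu> + 2) * \<theta>"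
      using \<mu> by (auto intro: mult_left_mono)
    then show ?thesis using edges by simp
  qed
  finally have "N y0 \<le> \<beta> + N y0 * \<theta> + 2 * \<theta>" by (simp add: algebra_simps)
  moreover have "N y0 * \<theta> \<le> N y0 * (1 / 2)" by (rule mult_left_mono[OF \<theta>(2) \<mu>])
  ultimately show ?thesis using max[OF y] by linarith
qed

locale strip_potential =
  fixes L R :: real and h g k m :: "real \<times> real \<Rightarrow> real"
  assumes L_pos: "0 < L"
    and cont: "continuous_on ({-L..L} \<times> {-R<..<R}) h" "continuous_on ({-L..L} \<times> {-R<..<R}) g"
      "continuous_on ({-L..L} \<times> {-R<..<R}) k" "continuous_on ({-L..L} \<times> {-R<..<R}) m"
    and h_dx: "\<And>x y. x \<in> {-L..L} \<Longrightarrow> y \<in> {-R<..<R} \<Longrightarrow> ((\<lambda>t. h (t, y)) has_real_derivative g (x, y)) (at x)"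
    and h_dy: "\<And>x y. x \<in> {-L..L} \<Longrightarrow> y \<in> {-R<..<R} \<Longrightarrow> ((\<lambda>t. h (x, t)) has_real_derivative k (x, y)) (at y)"
    and k_dy: "\<And>x y. x \<in> {-L..L} \<Longrightarrow> y \<in> {-R<..<R} \<Longrightarrow> ((\<lambda>t. k (x, t)) has_real_derivative m (x, y)) (at y)"
begin

definition taper :: "real \<Rightarrow> real" where
  "taper x = 1 - x\<^sup>2 / L\<^sup>2"

definition mass :: "real \<Rightarrow> real" where
  "mass y = integral {-L..L} (\<lambda>x. (taper x)\<^sup>2 * (h (x, y))\<^sup>2)"

definition mass' :: "real \<Rightarrow> real" where
  "mass' y = integral {-L..L} (\<lambda>x. (taper x)\<^sup>2 * (2 * h (x, y) * k (x, y)))"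

definition mass'' :: "real \<Rightarrow> real" where
  "mass'' y = integral {-L..L} (\<lambda>x. (taper x)\<^sup>2 * (2 * (k (x, y))\<^sup>2 + 2 * h (x, y) * m (x, y)))"

lemma taper_bounds: "x \<in> {-L..L} \<Longrightarrow> 0 \<le> taper x" "taper x \<le> 1"
  using L_pos abs_le_square_iff[of x L] by (auto simp: taper_def abs_le_iff)

lemma continuous_on_taper [continuous_intros]:
  "continuous_on S f \<Longrightarrow> continuous_on S (\<lambda>z. taper (f z))"
  unfolding taper_def using L_pos by (intro continuous_intros) auto

lemma taper_has_derivative: "(taper has_real_derivative - 2 * x / L\<^sup>2) (at x)"
  unfolding taper_def divide_inverse by (auto intro!: derivative_eq_intros)

lemma cont_line:
  assumes "y \<in> {-R<..<R}"
  shows "continuous_on {-L..L} (\<lambda>x. h (x, y))" "continuous_on {-L..L} (\<lambda>x. g (x, y))"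
    "continuous_on {-L..L} (\<lambda>x. k (x, y))" "continuous_on {-L..L} (\<lambda>x. m (x, y))"
  using continuous_on_Times_lines(2)[OF cont(1) assms] continuous_on_Times_lines(2)[OF cont(2) assms]
    continuous_on_Times_lines(2)[OF cont(3) assms] continuous_on_Times_lines(2)[OF cont(4) assms] by blast+

lemma tapered_integral_has_derivative:
  fixes F F' :: "real \<times> real \<Rightarrow> real"
  assumes cont_F: "continuous_on ({-L..L} \<times> {-R<..<R}) F" "continuous_on ({-L..L} \<times> {-R<..<R}) F'"
    and F': "\<And>x y. x \<in> {-L..L} \<Longrightarrow> y \<in> {-R<..<R} \<Longrightarrow> ((\<lambda>t. F (x, t)) has_real_derivative F' (x, y)) (at y)"
    and y: "y \<in> {-R<..<R}"
  shows "((\<lambda>y. integral {-L..L} (\<lambda>x. (taper x)\<^sup>2 * F (x, y))) has_real_derivative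
    integral {-L..L} (\<lambda>x. (taper x)\<^sup>2 * F' (x, y))) (at y)"
proof -
  have "((\<lambda>y. integral {-L..L} (\<lambda>x. (\<lambda>z. (taper (fst z))\<^sup>2 * F z) (x, y))) has_real_derivative
    integral {-L..L} (\<lambda>x. (\<lambda>z. (taper (fst z))\<^sup>2 * F' z) (x, y))) (at y)"
    by (rule has_real_derivative_integral_fst[OF _ _ _ y])
      (auto intro!: DERIV_cmult F' continuous_intros cont_F continuous_on_Times_lines(2)[OF cont_F(1)])
  then show ?thesis by simp
qed

lemma mass_has_derivative:
  assumes "y \<in> {-R<..<R}"
  shows "(mass has_real_derivative mass' y) (at y)" "(mass' has_real_derivative mass'' y) (at y)"
  unfolding mass_def[abs_def] mass'_def[abs_def] mass''_def
  by (rule tapered_integral_has_derivative[where F = "\<lambda>z. (h z)\<^sup>2" and F' = "\<lambda>z. 2 * h z * k z", simplified]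
      tapered_integral_has_derivative[where F = "\<lambda>z. 2 * h z * k z" and F' = "\<lambda>z. 2 * (k z)\<^sup>2 + 2 * h z * m z", simplified];
      use assms in \<open>auto intro!: continuous_intros cont derivative_eq_intros h_dy k_dy simp: power2_eq_square\<close>)+

lemma mass_nonneg: "y \<in> {-R<..<R} \<Longrightarrow> 0 \<le> mass y"
  unfolding mass_def
  by (intro Henstock_Kurzweil_Integration.integral_nonneg integrable_continuous_real continuous_intros cont_line) auto

lemma mass_le_of_small_gradient:
  assumes y: "y \<in> {-R<..<R}" and h0: "h (0, y) = 0" and \<epsilon>: "\<And>x. x \<in> {-L..L} \<Longrightarrow> \<bar>g (x, y)\<bar> \<le> \<epsilon>"
  shows "mass y \<le> 2 * \<epsilon>\<^sup>2 * L ^ 3"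
proof -
  have "mass y \<le> integral {-L..L} (\<lambda>x. \<epsilon>\<^sup>2 * L\<^sup>2)"
    unfolding mass_def
  proof (intro integral_le integrable_continuous_real continuous_intros cont_line y)
    fix x assume x: "x \<in> {-L..L}"
    have "\<bar>h (x, y) - h (0, y)\<bar> \<le> \<epsilon> * \<bar>x - 0\<bar>"
      by (rule abs_diff_le_of_bounded_derivative[where S = "{-L..L}" and f' = "\<lambda>t. g (t, y)"])
        (use x y h_dx \<epsilon> in auto)
    also have "\<dots> \<le> \<epsilon> * L"
      using x \<epsilon>[OF x] by (intro mult_left_mono) auto
    finally have "(h (x, y))\<^sup>2 \<le> (\<epsilon> * L)\<^sup>2" using h0 abs_le_square_iff[of "h (x, y)" "\<epsilon> * L"] by simp
    moreover have "(taper x)\<^sup>2 \<le> 1" using taper_bounds[of x] x by (simp add: power_le_one)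
    ultimately have "(taper x)\<^sup>2 * (h (x, y))\<^sup>2 \<le> 1 * (\<epsilon> * L)\<^sup>2" by (intro mult_mono) auto
    then show "(taper x)\<^sup>2 * (h (x, y))\<^sup>2 \<le> \<epsilon>\<^sup>2 * L\<^sup>2" by (simp add: power_mult_distrib)
  qed
  also have "\<dots> = 2 * \<epsilon>\<^sup>2 * L ^ 3" using L_pos by (simp add: power2_eq_square power3_eq_cube)
  finally show ?thesis .
qed

context
  fixes y \<Lambda> \<epsilon> :: real and e E :: "real \<Rightarrow> real"
  assumes y: "y \<in> {-R<..<R}"
    and e_deriv: "\<And>x. x \<in> {-L..L} \<Longrightarrow> (e has_real_derivative - 2 * m (x, y) - 2 * E x) (at x)"
    and cont_E: "continuous_on {-L..L} E"
    and e_bounds: "\<And>x. x \<in> {-L..L} \<Longrightarrow> \<bar>e x\<bar> \<le> \<Lambda>" "\<And>x. x \<in> {-L..L} \<Longrightarrow> 0 \<le> g (x, y) * e x"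
    and E_bound: "\<And>x. x \<in> {-L..L} \<Longrightarrow> \<bar>E x\<bar> \<le> \<epsilon>"
begin

abbreviation integrand :: "real \<Rightarrow> real" where
  "integrand x \<equiv> 2 * (taper x)\<^sup>2 * (k (x, y))\<^sup>2 - 2 * (taper x)\<^sup>2 * h (x, y) * E x
    + (2 * taper x * (- 2 * x / L\<^sup>2) * h (x, y) + (taper x)\<^sup>2 * g (x, y)) * e x"

lemma continuous_on_e: "continuous_on {-L..L} e"
  by (rule DERIV_continuous_on[OF has_field_derivative_at_within[OF e_deriv]])

lemma continuous_on_integrand: "continuous_on {-L..L} integrand"
  using L_pos by (intro continuous_intros cont_line y cont_E continuous_on_e) auto

lemma mass''_eq_integral_integrand: "mass'' y = integral {-L..L} integrand"
proof -
  let ?F = "\<lambda>x. 2 * (taper x)\<^sup>2 * (k (x, y))\<^sup>2 - 2 * (taper x)\<^sup>2 * h (x, y) * E x"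
  let ?G = "\<lambda>x. (2 * taper x * (- 2 * x / L\<^sup>2) * h (x, y) + (taper x)\<^sup>2 * g (x, y)) * e x"
  let ?e' = "\<lambda>x. - 2 * m (x, y) - 2 * E x"
  note ints = integrable_continuous_real continuous_intros cont_line y cont_E continuous_on_e
  have "integral {-L..L} (\<lambda>x. ((taper x)\<^sup>2 * h (x, y)) * ?e' x) = - integral {-L..L} ?G"
  proof (rule integral_by_parts_vanishing[OF _ _ e_deriv])
    show "((\<lambda>x. (taper x)\<^sup>2 * h (x, y)) has_real_derivative
        2 * taper x * (- 2 * x / L\<^sup>2) * h (x, y) + (taper x)\<^sup>2 * g (x, y)) (at x)" if "x \<in> {-L..L}" for x
      using h_dx[OF that y] by (auto intro!: derivative_eq_intros taper_has_derivative simp: algebra_simps)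
  qed (use L_pos in \<open>auto intro!: ints simp: taper_def\<close>)
  moreover have "mass'' y = integral {-L..L} (\<lambda>x. ?F x - ((taper x)\<^sup>2 * h (x, y)) * ?e' x)"
    unfolding mass''_def by (rule integral_cong) (simp add: algebra_simps)
  moreover have "integral {-L..L} (\<lambda>x. ?F x - ((taper x)\<^sup>2 * h (x, y)) * ?e' x)
      = integral {-L..L} ?F - integral {-L..L} (\<lambda>x. ((taper x)\<^sup>2 * h (x, y)) * ?e' x)"
    by (intro Henstock_Kurzweil_Integration.integral_diff ints)
  moreover have "integral {-L..L} integrand = integral {-L..L} ?F + integral {-L..L} ?G"
    using L_pos by (intro Henstock_Kurzweil_Integration.integral_add ints) auto
  ultimately show ?thesis by simp
qed

lemma integrand_ge:
  assumes x: "x \<in> {-L..L}"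
  shows "- (2 * \<Lambda> / L + \<epsilon>) * (sqrt L * ((taper x)\<^sup>2 * (h (x, y))\<^sup>2) + 1 / sqrt L) \<le> integrand x"
proof -
  let ?\<kappa> = "taper x"
  note \<kappa> = taper_bounds(1)[OF x] taper_bounds(2)[of x]
  define X where "X = ?\<kappa> * \<bar>h (x, y)\<bar>"
  have X: "0 \<le> X" "X\<^sup>2 = ?\<kappa>\<^sup>2 * (h (x, y))\<^sup>2" using \<kappa> by (simp_all add: X_def power_mult_distrib)
  have "\<bar>2 * ?\<kappa> * (- 2 * x / L\<^sup>2) * h (x, y) * e x\<bar> = 4 * (\<bar>x\<bar> / L\<^sup>2) * X * \<bar>e x\<bar>"
    using \<kappa> by (simp add: X_def abs_mult)
  also have "\<dots> \<le> 4 * (1 / L) * X * \<Lambda>"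
    using x X(1) e_bounds(1)[OF x] L_pos
    by (intro mult_mono) (auto simp: field_simps power2_eq_square abs_le_iff)
  also have "\<dots> = 4 * \<Lambda> / L * X" by simp
  finally have taper_term: "- (4 * \<Lambda> / L * X) \<le> 2 * ?\<kappa> * (- 2 * x / L\<^sup>2) * h (x, y) * e x"
    by (drule_tac abs_le_D2) linarith
  have "?\<kappa>\<^sup>2 * \<bar>h (x, y)\<bar> \<le> X"
    unfolding X_def power2_eq_square using \<kappa> by (intro mult_right_mono) (auto simp: mult_left_le)
  then have "\<bar>?\<kappa>\<^sup>2 * h (x, y) * E x\<bar> \<le> X * \<epsilon>"
    unfolding abs_mult using E_bound[OF x] X(1) by (intro mult_mono) auto
  then have error_term: "- (2 * \<epsilon> * X) \<le> - (2 * ?\<kappa>\<^sup>2 * h (x, y) * E x)" by (simp add: abs_le_iff mult_ac)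
  have monotone_term: "0 \<le> ?\<kappa>\<^sup>2 * g (x, y) * e x"
    using e_bounds(2)[OF x] by (simp add: mult.assoc)
  have "0 \<le> (sqrt L * X - 1)\<^sup>2 / sqrt L" using L_pos by simp
  also have "\<dots> = sqrt L * X\<^sup>2 + 1 / sqrt L - 2 * X" using L_pos by (simp add: field_simps power2_eq_square)
  finally have "(2 * \<Lambda> / L + \<epsilon>) * (2 * X) \<le> (2 * \<Lambda> / L + \<epsilon>) * (sqrt L * X\<^sup>2 + 1 / sqrt L)"
    using e_bounds(1)[OF x] E_bound[OF x] L_pos by (intro mult_left_mono add_nonneg_nonneg) auto
  moreover have "(2 * \<Lambda> / L + \<epsilon>) * (2 * X) = 4 * \<Lambda> / L * X + 2 * \<epsilon> * X" by (simp add: algebra_simps)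
  moreover have "0 \<le> 2 * ?\<kappa>\<^sup>2 * (k (x, y))\<^sup>2" by simp
  moreover have "(2 * ?\<kappa> * (- 2 * x / L\<^sup>2) * h (x, y) + ?\<kappa>\<^sup>2 * g (x, y)) * e x
      = 2 * ?\<kappa> * (- 2 * x / L\<^sup>2) * h (x, y) * e x + ?\<kappa>\<^sup>2 * g (x, y) * e x" by (rule distrib_right)
  ultimately show ?thesis
    using taper_term error_term monotone_term unfolding X(2) mult_minus_left by linarith
qed

lemma mass''_ge: "- (2 * \<Lambda> / sqrt L + \<epsilon> * sqrt L) * (mass y + 2) \<le> mass'' y"
proof -
  let ?l = "sqrt L" and ?c = "2 * \<Lambda> / L + \<epsilon>"
  have "integral {-L..L} (\<lambda>x. ?l * ((taper x)\<^sup>2 * (h (x, y))\<^sup>2) + 1 / ?l) = ?l * mass y + 2 * L / ?l"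
    unfolding mass_def using L_pos
    by (subst Henstock_Kurzweil_Integration.integral_add)
      (auto intro!: integrable_continuous_real continuous_intros cont_line y)
  then have "integral {-L..L} (\<lambda>x. - ?c * (?l * ((taper x)\<^sup>2 * (h (x, y))\<^sup>2) + 1 / ?l)) = - ?c * (?l * mass y + 2 * L / ?l)"
    by (simp only: integral_mult_right)
  moreover have "integral {-L..L} (\<lambda>x. - ?c * (?l * ((taper x)\<^sup>2 * (h (x, y))\<^sup>2) + 1 / ?l)) \<le> mass'' y"
    unfolding mass''_eq_integral_integrand
    by (intro integral_le integrable_continuous_real continuous_on_integrand integrand_ge continuous_intros cont_line y)
      (use L_pos in auto)
  moreover have "?c * (?l * mass y + 2 * L / ?l) = (2 * \<Lambda> / ?l + \<epsilon> * ?l) * (mass y + 2)"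
  proof -
    have "2 * L / ?l = 2 * ?l"
      using L_pos by (simp only: times_divide_eq_right[symmetric] real_div_sqrt less_imp_le)
    then have "?c * (?l * mass y + 2 * L / ?l) = ?c * ?l * (mass y + 2)" by (simp only: distrib_left mult_ac)
    also have "?c * ?l = 2 * \<Lambda> / ?l + \<epsilon> * ?l" using L_pos by (simp add: field_simps)
    finally show ?thesis .
  qed
  ultimately show ?thesis by (simp only: mult_minus_left)
qed

end

end

lemma (in strip_potential) abs_h_le_of_small_mass:
  assumes y: "y \<in> {-R<..<R}" and g: "\<And>x. x \<in> {-L..L} \<Longrightarrow> \<bar>g (x, y)\<bar> \<le> K"
    and s: "0 < s" "s \<le> 1" "K * s \<le> \<eta> / 2" and \<eta>: "0 < \<eta>"
    and x0: "2 * \<bar>x0\<bar> + 2 \<le> L" and mass: "mass y < \<eta>\<^sup>2 * s / 8"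
  shows "\<bar>h (x0, y)\<bar> \<le> \<eta>"
proof (rule ccontr)
  assume "\<not> \<bar>h (x0, y)\<bar> \<le> \<eta>"
  then have large: "\<eta> < \<bar>h (x0, y)\<bar>" by simp
  have sub: "{x0..x0+s} \<subseteq> {-L..L}" using x0 s by (auto simp: abs_le_iff)
  define f where "f x = (taper x)\<^sup>2 * (h (x, y))\<^sup>2" for x
  have cont_f: "continuous_on {-L..L} f" unfolding f_def by (intro continuous_intros cont_line y)
  have f_ge: "\<eta>\<^sup>2 / 8 \<le> f x" if x: "x \<in> {x0..x0+s}" for x
  proof -
    have "\<bar>h (x, y) - h (x0, y)\<bar> \<le> K * \<bar>x - x0\<bar>"
      by (rule abs_diff_le_of_bounded_derivative[where S = "{-L..L}" and f' = "\<lambda>t. g (t, y)"])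
        (use x y h_dx g sub in auto)
    also have "\<dots> \<le> K * s" using x g[of x0] sub s by (intro mult_left_mono) auto
    finally have "\<eta> / 2 \<le> \<bar>h (x, y)\<bar>" using large s(3) by linarith
    then have "\<eta>\<^sup>2 / 4 \<le> (h (x, y))\<^sup>2" using \<eta> abs_le_square_iff[of "\<eta> / 2" "h (x, y)"] by (simp add: power_divide)
    moreover have "1 / 2 \<le> (taper x)\<^sup>2"
    proof -
      have "\<bar>x\<bar> \<le> L / 2" using x x0 s by auto
      then have "x\<^sup>2 \<le> (L / 2)\<^sup>2" using abs_le_square_iff[of x "L / 2"] L_pos by simp
      then have "3 / 4 \<le> taper x" using L_pos by (simp add: taper_def field_simps power2_eq_square)
      then have "(3 / 4)\<^sup>2 \<le> (taper x)\<^sup>2" by (intro power_mono) auto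
      then show ?thesis by (simp add: power2_eq_square)
    qed
    ultimately have "1 / 2 * (\<eta>\<^sup>2 / 4) \<le> f x" unfolding f_def by (intro mult_mono) auto
    then show ?thesis by simp
  qed
  have "\<eta>\<^sup>2 * s / 8 = integral {x0..x0+s} (\<lambda>x. \<eta>\<^sup>2 / 8)" using s by simp
  also have "\<dots> \<le> integral {x0..x0+s} f"
    by (intro integral_le integrable_continuous_real continuous_on_subset[OF cont_f sub] continuous_on_const f_ge)
  also have "\<dots> \<le> integral {-L..L} f"
    by (intro integral_subset_le integrable_continuous_real continuous_on_subset[OF cont_f sub] cont_f sub)
      (simp add: f_def)
  finally show False using mass by (simp add: mass_def f_def[abs_def])
qed

section \<open>Convergence of nearby solutions\<close>

text \<open>A solution \<open>(u\<^sub>2, v\<^sub>2)\<close> of the system with parameter \<open>b\<close> solves the one with parameter \<open>a\<close> up to the defect.\<close>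

locale nearby_solutions =
  S1: dagger_C1 R a u1 v1 p1 q1 + S2: dagger_C1 R b u2 v2 p2 q2
  for R a u1 v1 p1 q1 b u2 v2 p2 q2 +
  fixes M L R' \<epsilon> :: real
  assumes a_nonzero: "a \<noteq> 0" and L_pos: "0 < L" and R': "0 < R'" "R' < R"
    and v_bounded: "\<And>x y. \<bar>y\<bar> < R \<Longrightarrow> \<bar>v1 (x, y)\<bar> \<le> M \<and> \<bar>v2 (x, y)\<bar> \<le> M"
    and edges: "\<And>x. x \<in> {-L..L} \<Longrightarrow> \<bar>v1 (x, R') - v2 (x, R')\<bar> \<le> \<epsilon> \<and> \<bar>v1 (x, - R') - v2 (x, - R')\<bar> \<le> \<epsilon>"
    and defect: "\<And>x y. x \<in> {-L..L} \<Longrightarrow> y \<in> {-R'..R'} \<Longrightarrow>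
      \<bar>q2 (x, y) * (1 - rad b (v2 (x, y)) y / rad a (v2 (x, y)) y)\<bar> \<le> \<epsilon>"
begin

lemma \<epsilon>_nonneg: "0 \<le> \<epsilon>"
proof -
  have "\<bar>v1 (0, R') - v2 (0, R')\<bar> \<le> \<epsilon>" using edges[of 0] L_pos by simp
  then show ?thesis by linarith
qed

lemma exists_potential:
  assumes R'': "R' < R''" "R'' < R"
  shows "\<exists>h \<gamma>. strip_potential L R'' h (\<lambda>z. v1 z - v2 z) (\<lambda>z. u1 z - u2 z - \<gamma>) (\<lambda>z. q1 z - q2 z) \<and>
    h (0, R') = 0 \<and> h (0, - R') = 0"
proof -
  let ?Q = "{-L-1<..<L+1} \<times> {-R''<..<R''}"
  have Q: "{-L-1..L+1} \<times> {-R''..R''} \<subseteq> open_strip R"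
    by (rule Times_subset_open_strip) (use R' R'' in auto)
  have inside: "\<bar>y\<bar> < R" if "y \<in> {-R''..R''}" for y using that R'' by auto
  have "\<exists>h. continuous_on ?Q h \<and> (\<forall>x\<in>{-L-1<..<L+1}. \<forall>y\<in>{-R''<..<R''}.
      ((\<lambda>t. h (t, y)) has_real_derivative v1 (x, y) - v2 (x, y)) (at x) \<and>
      ((\<lambda>t. h (x, t)) has_real_derivative u1 (x, y) - u2 (x, y)) (at y))"
    by (rule potential_exists[where g = "\<lambda>z. v1 z - v2 z" and k = "\<lambda>z. u1 z - u2 z" and m = "\<lambda>z. p1 z - p2 z"])
      (use L_pos R' R'' inside in \<open>auto intro!: continuous_intros S1.continuous_on[OF Q] S2.continuous_on[OF Q]
        derivative_intros S1.derivs S2.derivs\<close>)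
  then obtain h0 where cont: "continuous_on ?Q h0"
    and h0: "\<And>x y. x \<in> {-L..L} \<Longrightarrow> y \<in> {-R''<..<R''} \<Longrightarrow>
      ((\<lambda>t. h0 (t, y)) has_real_derivative v1 (x, y) - v2 (x, y)) (at x) \<and>
      ((\<lambda>t. h0 (x, t)) has_real_derivative u1 (x, y) - u2 (x, y)) (at y)" by auto
  define \<gamma> where "\<gamma> = (h0 (0, R') - h0 (0, - R')) / (2 * R')"
  define h where "h z = h0 z - h0 (0, R') + \<gamma> * R' - \<gamma> * snd z" for z
  have sub: "{-L..L} \<times> {-R''<..<R''} \<subseteq> ?Q" "{-L..L} \<times> {-R''<..<R''} \<subseteq> open_strip R"
    using R'' by (auto simp: open_strip_def)
  have "strip_potential L R'' h (\<lambda>z. v1 z - v2 z) (\<lambda>z. u1 z - u2 z - \<gamma>) (\<lambda>z. q1 z - q2 z)"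
    by unfold_locales
      (use L_pos h0 inside in \<open>auto intro!: continuous_intros continuous_on_subset[OF cont sub(1)]
        S1.continuous_on[OF sub(2)] S2.continuous_on[OF sub(2)] derivative_eq_intros S1.derivs S2.derivs simp: h_def\<close>)
  moreover have "h (0, R') = 0" "h (0, - R') = 0" using R' by (auto simp: h_def \<gamma>_def field_simps)
  ultimately show ?thesis by blast
qed

context
  fixes R'' h \<gamma>
  assumes potential: "strip_potential L R'' h (\<lambda>z. v1 z - v2 z) (\<lambda>z. u1 z - u2 z - \<gamma>) (\<lambda>z. q1 z - q2 z)"
    and R'': "R' < R''" "R'' < R"
begin

interpretation H: strip_potential L R'' h "\<lambda>z. v1 z - v2 z" "\<lambda>z. u1 z - u2 z - \<gamma>" "\<lambda>z. q1 z - q2 z"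
  by (rule potential)

lemma mass''_ge:
  assumes y: "y \<in> {-R'..R'}"
  shows "- (8 * sqrt (2 * M) / sqrt L * quartic_weight a y + \<epsilon> * sqrt L) * (H.mass y + 2) \<le> H.mass'' y"
proof -
  have y': "y \<in> {-R''<..<R''}" "\<bar>y\<bar> < R" using y R'' by auto
  define e where "e x = rad_primitive a (v1 (x, y)) y - rad_primitive a (v2 (x, y)) y" for x
  define E where "E x = q2 (x, y) * (1 - rad b (v2 (x, y)) y / rad a (v2 (x, y)) y)" for x
  have "- (2 * (4 * sqrt (2 * M) * quartic_weight a y) / sqrt L + \<epsilon> * sqrt L) * (H.mass y + 2) \<le> H.mass'' y"
  proof (rule H.mass''_ge[OF y'(1)])
    fix x assume x: "x \<in> {-L..L}"
    have "(e has_real_derivative - 2 * rad a (v1 (x, y)) y * q1 (x, y) / rad a (v1 (x, y)) y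
        - - 2 * rad b (v2 (x, y)) y * q2 (x, y) / rad a (v2 (x, y)) y) (at x)"
      unfolding e_def
      by (intro derivative_intros rad_primitive_has_derivative a_nonzero S1.v_dx[OF y'(2)] S2.v_dx[OF y'(2)])
    then show "(e has_real_derivative - 2 * (q1 (x, y) - q2 (x, y)) - 2 * E x) (at x)"
      by (rule DERIV_cong) (use rad_pos[OF a_nonzero] in \<open>simp add: E_def field_simps less_imp_neq[symmetric]\<close>)
    show "\<bar>e x\<bar> \<le> 4 * sqrt (2 * M) * quartic_weight a y"
      using abs_rad_primitive_le[OF a_nonzero, of "v1 (x, y)" M y] abs_rad_primitive_le[OF a_nonzero, of "v2 (x, y)" M y]
        v_bounded[OF y'(2), of x] unfolding e_def by linarith
    show "0 \<le> (v1 (x, y) - v2 (x, y)) * e x"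
      unfolding e_def by (rule diff_mult_rad_primitive_diff_nonneg[OF a_nonzero])
    show "\<bar>E x\<bar> \<le> \<epsilon>" unfolding E_def by (rule defect[OF x y])
  next
    show "continuous_on {-L..L} E"
      unfolding E_def using rad_pos[OF a_nonzero]
      by (intro continuous_intros continuous_on_horizontal_line[OF _ y'(2)] S2.continuous)
        (auto simp: less_imp_neq[symmetric])
  qed
  moreover have "2 * (4 * sqrt (2 * M) * quartic_weight a y) / sqrt L = 8 * sqrt (2 * M) / sqrt L * quartic_weight a y"
    by simp
  ultimately show ?thesis by metis
qed

lemma mass_le:
  assumes h_0: "h (0, R') = 0" "h (0, - R') = 0"
    and \<theta>: "32 / 3 * sqrt (2 * M) * (R\<^sup>2 + a\<^sup>2) powr (3 / 4) / sqrt L + \<epsilon> * sqrt L * (R\<^sup>2 / 2) \<le> \<theta>" "\<theta> \<le> 1 / 2"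
    and y: "y \<in> {-R'..R'}"
  shows "H.mass y \<le> 4 * \<epsilon>\<^sup>2 * L ^ 3 + 4 * \<theta>"
proof -
  have inside: "y \<in> {-R''<..<R''}" if "y \<in> {-R'..R'}" for y using that R'' by auto
  have M: "0 \<le> M" using v_bounded[of 0 0] R' by force
  let ?c = "8 * sqrt (2 * M) / sqrt L"
  have edge_mass: "H.mass R' \<le> 2 * \<epsilon>\<^sup>2 * L ^ 3" "H.mass (- R') \<le> 2 * \<epsilon>\<^sup>2 * L ^ 3"
    using edges R' R'' h_0 by (auto intro!: H.mass_le_of_small_gradient)
  have square: "R'\<^sup>2 \<le> R\<^sup>2" using R' by (intro power_mono) auto
  then have "(R'\<^sup>2 + a\<^sup>2) powr (3 / 4) \<le> (R\<^sup>2 + a\<^sup>2) powr (3 / 4)" by (intro powr_mono2) auto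
  then have "4 / 3 * ?c * (R'\<^sup>2 + a\<^sup>2) powr (3 / 4) + \<epsilon> * sqrt L * (R'\<^sup>2 / 2)
      \<le> 4 / 3 * ?c * (R\<^sup>2 + a\<^sup>2) powr (3 / 4) + \<epsilon> * sqrt L * (R\<^sup>2 / 2)"
    using square M L_pos \<epsilon>_nonneg by (intro add_mono mult_left_mono) auto
  also have "\<dots> = 32 / 3 * sqrt (2 * M) * (R\<^sup>2 + a\<^sup>2) powr (3 / 4) / sqrt L + \<epsilon> * sqrt L * (R\<^sup>2 / 2)" by simp
  also note \<theta>(1)
  finally have \<theta>_bound: "4 / 3 * ?c * (R'\<^sup>2 + a\<^sup>2) powr (3 / 4) + \<epsilon> * sqrt L * (R'\<^sup>2 / 2) \<le> \<theta>" .
  have "H.mass y \<le> 2 * (2 * \<epsilon>\<^sup>2 * L ^ 3) + 4 * \<theta>"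
    by (rule almost_convex_le[OF a_nonzero _ _ H.mass_has_derivative(1) H.mass_has_derivative(2) _ mass''_ge
          edge_mass \<theta>_bound \<theta>(2) y])
      (use inside H.mass_nonneg \<epsilon>_nonneg M L_pos in auto)
  then show ?thesis by simp
qed

end

lemma segment_integrals_of_difference:
  assumes \<theta>: "32 / 3 * sqrt (2 * M) * (R\<^sup>2 + a\<^sup>2) powr (3 / 4) / sqrt L + \<epsilon> * sqrt L * (R\<^sup>2 / 2) \<le> \<theta>" "\<theta> \<le> 1 / 2"
    and s: "0 < s" "s \<le> 1" "2 * M * s \<le> \<eta> / 2" and \<eta>: "0 < \<eta>"
    and K: "2 * K + 2 \<le> L" and small: "4 * \<epsilon>\<^sup>2 * L ^ 3 + 4 * \<theta> < \<eta>\<^sup>2 * s / 8"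
  shows "\<exists>\<gamma>. segment_integrals_le {-K..K} {-R'..R'} (2 * \<eta>) (\<lambda>z. v1 z - v2 z) \<and>
    segment_integrals_le {-R'..R'} {-K..K} (2 * \<eta>) (\<lambda>z. u1 (snd z, fst z) - u2 (snd z, fst z) - \<gamma>)"
proof -
  define R'' where "R'' = (R' + R) / 2"
  have R'': "R' < R''" "R'' < R" using R' by (auto simp: R''_def)
  obtain h \<gamma> where H: "strip_potential L R'' h (\<lambda>z. v1 z - v2 z) (\<lambda>z. u1 z - u2 z - \<gamma>) (\<lambda>z. q1 z - q2 z)"
    and h_0: "h (0, R') = 0" "h (0, - R') = 0"
    using exists_potential[OF R''] by blast
  interpret H: strip_potential L R'' h "\<lambda>z. v1 z - v2 z" "\<lambda>z. u1 z - u2 z - \<gamma>" "\<lambda>z. q1 z - q2 z" by fact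
  have h_small: "\<bar>h (x, y)\<bar> \<le> \<eta>" if "x \<in> {-K..K}" "y \<in> {-R'..R'}" for x y
  proof (rule H.abs_h_le_of_small_mass[OF _ _ s \<eta>])
    show "H.mass y < \<eta>\<^sup>2 * s / 8" using mass_le[OF H R'' h_0 \<theta> that(2)] small by linarith
    show "\<bar>v1 (x, y) - v2 (x, y)\<bar> \<le> 2 * M" for x
      using v_bounded[of y x] that R' by fastforce
  qed (use that K R' R'' in \<open>auto simp: abs_le_iff\<close>)
  have "\<bar>integral {x..x'} (\<lambda>t. v1 (t, y) - v2 (t, y))\<bar> \<le> 2 * \<eta>"
    if x: "x \<le> x'" "{x..x'} \<subseteq> {-K..K}" and y: "y \<in> {-R'..R'}" for x x' y
  proof -
    have "integral {x..x'} (\<lambda>t. v1 (t, y) - v2 (t, y)) = h (x', y) - h (x, y)"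
      by (rule integral_real_derivative) (use x y K R'' H.h_dx in auto)
    moreover have "\<bar>h (x', y)\<bar> \<le> \<eta>" "\<bar>h (x, y)\<bar> \<le> \<eta>" using h_small x y by auto
    ultimately show ?thesis by linarith
  qed
  moreover have "\<bar>integral {y..y'} (\<lambda>t. u1 (x, t) - u2 (x, t) - \<gamma>)\<bar> \<le> 2 * \<eta>"
    if y: "y \<le> y'" "{y..y'} \<subseteq> {-R'..R'}" and x: "x \<in> {-K..K}" for x y y'
  proof -
    have "integral {y..y'} (\<lambda>t. u1 (x, t) - u2 (x, t) - \<gamma>) = h (x, y') - h (x, y)"
      by (rule integral_real_derivative) (use x y K R'' H.h_dy in auto)
    moreover have "\<bar>h (x, y')\<bar> \<le> \<eta>" "\<bar>h (x, y)\<bar> \<le> \<eta>" using h_small x y by auto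
    ultimately show ?thesis by linarith
  qed
  ultimately show ?thesis unfolding segment_integrals_le_def by (intro exI[of _ \<gamma>]) auto
qed

end

lemma exists_potential_scales:
  fixes \<eta> B K M R :: real
  assumes "0 < \<eta>" "0 \<le> B" "0 \<le> K" "0 \<le> M"
  shows "\<exists>L \<epsilon> s \<theta>. 2 * K + 2 \<le> L \<and> 0 < \<epsilon> \<and> 0 < s \<and> s \<le> 1 \<and> 2 * M * s \<le> \<eta> / 2 \<and>
    B / sqrt L + \<epsilon> * sqrt L * (R\<^sup>2 / 2) \<le> \<theta> \<and> \<theta> \<le> 1 / 2 \<and> 4 * \<epsilon>\<^sup>2 * L ^ 3 + 4 * \<theta> < \<eta>\<^sup>2 * s / 8"
proof -
  define s where "s = min 1 (\<eta> / (4 * M + 4))"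
  have s: "0 < s" "s \<le> 1" "s \<le> \<eta> / (4 * M + 4)" using assms by (simp_all add: s_def)
  have "2 * M * s \<le> 2 * M * (\<eta> / (4 * M + 4))" using s assms by (intro mult_left_mono) auto
  also have "\<dots> \<le> \<eta> / 2" using assms by (simp add: field_simps)
  finally have Ms: "2 * M * s \<le> \<eta> / 2" .
  define \<zeta> where "\<zeta> = min (1 / 4) (\<eta>\<^sup>2 * s / 100)"
  have \<zeta>: "0 < \<zeta>" "\<zeta> \<le> 1 / 4" "\<zeta> \<le> \<eta>\<^sup>2 * s / 100" using assms s by (auto simp: \<zeta>_def)
  define L where "L = 2 * K + 2 + (B / \<zeta>)\<^sup>2"
  have L: "2 * K + 2 \<le> L" "0 < L" "0 < L ^ 3" using assms by (auto simp: L_def intro: add_pos_nonneg)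
  have "B / \<zeta> \<le> sqrt L" by (rule real_le_rsqrt) (use assms in \<open>simp add: L_def\<close>)
  then have B: "B / sqrt L \<le> \<zeta>" using L \<zeta> by (simp add: field_simps)
  define \<epsilon> where "\<epsilon> = min (min 1 (\<zeta> / (4 * L ^ 3))) (\<zeta> / (sqrt L * (R\<^sup>2 + 1)))"
  have pos: "0 < sqrt L * (R\<^sup>2 + 1)" using L by (intro mult_pos_pos add_nonneg_pos) auto
  then have \<epsilon>: "0 < \<epsilon>" "\<epsilon> \<le> 1" "\<epsilon> \<le> \<zeta> / (4 * L ^ 3)" "\<epsilon> \<le> \<zeta> / (sqrt L * (R\<^sup>2 + 1))"
    using \<zeta> L by (auto simp: \<epsilon>_def)
  have "\<epsilon> * (sqrt L * (R\<^sup>2 / 2)) \<le> \<epsilon> * (sqrt L * (R\<^sup>2 + 1))" using \<epsilon> L by (intro mult_left_mono) auto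
  also have "\<dots> \<le> \<zeta>" using \<epsilon>(4) pos pos_le_divide_eq by blast
  finally have \<theta>: "B / sqrt L + \<epsilon> * sqrt L * (R\<^sup>2 / 2) \<le> 2 * \<zeta>" using B by (simp add: mult.assoc)
  have "\<epsilon>\<^sup>2 \<le> \<epsilon>" using \<epsilon> by (simp add: power2_eq_square mult_left_le)
  then have "4 * \<epsilon>\<^sup>2 * L ^ 3 \<le> 4 * \<epsilon> * L ^ 3" using L by simp
  also have "\<dots> \<le> \<zeta>" using \<epsilon>(3) L by (simp add: field_simps)
  finally have "4 * \<epsilon>\<^sup>2 * L ^ 3 + 4 * (2 * \<zeta>) < \<eta>\<^sup>2 * s / 8" using \<zeta> by linarith
  moreover have "2 * \<zeta> \<le> 1 / 2" using \<zeta> by simp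
  ultimately show ?thesis using L(1) \<epsilon>(1) s(1,2) Ms \<theta> by blast
qed

theorem nearby_solutions_segment_integrals:
  assumes "0 < \<eta>" "0 \<le> K" "0 \<le> M"
  shows "\<exists>L \<epsilon>. 2 * K + 2 \<le> L \<and> 0 < \<epsilon> \<and> (\<forall>a u1 v1 p1 q1 b u2 v2 p2 q2 R' \<epsilon>'. \<bar>a\<bar> \<le> A \<longrightarrow> \<epsilon>' \<le> \<epsilon> \<longrightarrow>
    nearby_solutions R a u1 v1 p1 q1 b u2 v2 p2 q2 M L R' \<epsilon>' \<longrightarrow>
    (\<exists>\<gamma>. segment_integrals_le {-K..K} {-R'..R'} \<eta> (\<lambda>z. v1 z - v2 z) \<and>
      segment_integrals_le {-R'..R'} {-K..K} \<eta> (\<lambda>z. u1 (snd z, fst z) - u2 (snd z, fst z) - \<gamma>)))"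
proof -
  define B where "B = 32 / 3 * sqrt (2 * M) * (R\<^sup>2 + A\<^sup>2) powr (3 / 4)"
  have "0 \<le> B" using assms by (simp add: B_def)
  then obtain L \<epsilon> s \<theta> where L: "2 * K + 2 \<le> L" and \<epsilon>: "0 < \<epsilon>" and s: "0 < s" "s \<le> 1" "2 * M * s \<le> \<eta> / 2 / 2"
    and \<theta>: "B / sqrt L + \<epsilon> * sqrt L * (R\<^sup>2 / 2) \<le> \<theta>" "\<theta> \<le> 1 / 2"
    and small: "4 * \<epsilon>\<^sup>2 * L ^ 3 + 4 * \<theta> < (\<eta> / 2)\<^sup>2 * s / 8"
    using exists_potential_scales[of "\<eta> / 2" B K M R] assms by auto
  have L_pos: "0 < L" using L assms by linarith
  show ?thesis
  proof (rule exI[of _ L], rule exI[of _ \<epsilon>], intro conjI allI impI L \<epsilon>)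
    fix a u1 v1 p1 q1 b u2 v2 p2 q2 R' \<epsilon>'
    assume a: "\<bar>a\<bar> \<le> A" and \<epsilon>': "\<epsilon>' \<le> \<epsilon>" and "nearby_solutions R a u1 v1 p1 q1 b u2 v2 p2 q2 M L R' \<epsilon>'"
    then interpret nearby_solutions R a u1 v1 p1 q1 b u2 v2 p2 q2 M L R' \<epsilon>' by simp
    have "a\<^sup>2 \<le> A\<^sup>2" using a by (simp add: abs_le_square_iff[symmetric])
    then have "32 / 3 * sqrt (2 * M) * (R\<^sup>2 + a\<^sup>2) powr (3 / 4) / sqrt L + \<epsilon>' * sqrt L * (R\<^sup>2 / 2)
        \<le> B / sqrt L + \<epsilon> * sqrt L * (R\<^sup>2 / 2)"
      unfolding B_def using assms L_pos \<epsilon>'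
      by (intro add_mono divide_right_mono mult_left_mono mult_right_mono powr_mono2) auto
    then have \<theta>': "32 / 3 * sqrt (2 * M) * (R\<^sup>2 + a\<^sup>2) powr (3 / 4) / sqrt L + \<epsilon>' * sqrt L * (R\<^sup>2 / 2) \<le> \<theta>"
      using \<theta>(1) by linarith
    have "\<epsilon>'\<^sup>2 \<le> \<epsilon>\<^sup>2" using \<epsilon>' \<epsilon>_nonneg by (rule power_mono)
    then have "4 * \<epsilon>'\<^sup>2 * L ^ 3 \<le> 4 * \<epsilon>\<^sup>2 * L ^ 3" using L_pos by (intro mult_right_mono) auto
    then have small': "4 * \<epsilon>'\<^sup>2 * L ^ 3 + 4 * \<theta> < (\<eta> / 2)\<^sup>2 * s / 8" using small by linarith
    show "\<exists>\<gamma>. segment_integrals_le {-K..K} {-R'..R'} \<eta> (\<lambda>z. v1 z - v2 z) \<and>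
      segment_integrals_le {-R'..R'} {-K..K} \<eta> (\<lambda>z. u1 (snd z, fst z) - u2 (snd z, fst z) - \<gamma>)"
      using segment_integrals_of_difference[OF \<theta>' \<theta>(2) s _ L small'] assms(1) by simp
  qed
qed

lemma segment_integrals_le_trans:
  fixes f g h :: "real \<times> real \<Rightarrow> real"
  assumes segments: "segment_integrals_le X Y \<eta> (\<lambda>z. f z - g z)"
    and sub: "{c-\<rho>..c+\<rho>} \<subseteq> X" "T \<subseteq> Y"
    and cont: "continuous_on ({c-\<rho>..c+\<rho>} \<times> T) f" "continuous_on ({c-\<rho>..c+\<rho>} \<times> T) g"
      "continuous_on ({c-\<rho>..c+\<rho>} \<times> T) h"
    and close: "\<And>z. z \<in> {c-\<rho>..c+\<rho>} \<times> T \<Longrightarrow> \<bar>g z - h z\<bar> \<le> \<epsilon>"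
    and small: "\<eta> + \<epsilon> * (2 * \<rho>) \<le> \<zeta>"
  shows "segment_integrals_le {c-\<rho>..c+\<rho>} T \<zeta> (\<lambda>z. f z - h z)"
  unfolding segment_integrals_le_def
proof (intro allI impI)
  fix s s' t assume s: "s \<le> s'" "{s..s'} \<subseteq> {c-\<rho>..c+\<rho>}" and t: "t \<in> T"
  have line: "continuous_on {s..s'} (\<lambda>x. F (x, t))" if "continuous_on ({c-\<rho>..c+\<rho>} \<times> T) F" for F :: "real \<times> real \<Rightarrow> real"
    by (rule continuous_on_subset[OF continuous_on_Times_lines(2)[OF that t] s(2)])
  note integrable = integrable_continuous_real continuous_intros line cont
  have "integral {s..s'} (\<lambda>x. f (x, t) - h (x, t))
      = integral {s..s'} (\<lambda>x. (f (x, t) - g (x, t)) + (g (x, t) - h (x, t)))" by simp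
  also have "\<dots> = integral {s..s'} (\<lambda>x. f (x, t) - g (x, t)) + integral {s..s'} (\<lambda>x. g (x, t) - h (x, t))"
    by (intro Henstock_Kurzweil_Integration.integral_add integrable)
  finally have split: "integral {s..s'} (\<lambda>x. f (x, t) - h (x, t)) = \<dots>" .
  have "norm (integral {s..s'} (\<lambda>x. g (x, t) - h (x, t))) \<le> \<epsilon> * (s' - s)"
    by (intro integral_bound continuous_intros line cont s) (use close s t in auto)
  also have "\<dots> \<le> \<epsilon> * (2 * \<rho>)"
    using close[of "(s, t)"] s t by (intro mult_left_mono) auto
  finally show "\<bar>integral {s..s'} (\<lambda>x. f (x, t) - h (x, t))\<bar> \<le> \<zeta>"
    using segment_integrals_leD[OF segments s(1) order_trans[OF s(2) sub(1)] subsetD[OF sub(2) t]] small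
    unfolding split by simp
qed

lemma (in nearby_solutions) segment_integrals_le_of_close:
  fixes u0 v0 :: "real \<times> real \<Rightarrow> real" and xc yc \<rho> :: real
  defines "X \<equiv> {xc-\<rho>..xc+\<rho>}" and "Y \<equiv> {yc-\<rho>..yc+\<rho>}"
  assumes segments: "segment_integrals_le {-K..K} {-R'..R'} \<zeta> (\<lambda>z. v1 z - v2 z)"
      "segment_integrals_le {-R'..R'} {-K..K} \<zeta> (\<lambda>z. u1 (snd z, fst z) - u2 (snd z, fst z) - k)"
    and sub: "X \<subseteq> {-K..K}" "Y \<subseteq> {-R'..R'}"
    and cont: "continuous_on (open_strip R) u0" "continuous_on (open_strip R) v0"
    and close: "\<And>z. z \<in> X \<times> Y \<Longrightarrow> \<bar>u2 z - u0 z\<bar> \<le> \<epsilon>' \<and> \<bar>v2 z - v0 z\<bar> \<le> \<epsilon>'"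
    and small: "\<zeta> + \<epsilon>' * (2 * \<rho>) \<le> \<zeta>'"
  shows "segment_integrals_le X Y \<zeta>' (\<lambda>z. v1 z - v0 z)"
    "segment_integrals_le Y X \<zeta>' (\<lambda>z. u1 (snd z, fst z) - k - u0 (snd z, fst z))"
proof -
  have inside: "X \<times> Y \<subseteq> open_strip R" using sub(2) R' by (fastforce simp: open_strip_def abs_less_iff)
  show "segment_integrals_le X Y \<zeta>' (\<lambda>z. v1 z - v0 z)"
    unfolding X_def
    by (rule segment_integrals_le_trans[OF segments(1) sub[unfolded X_def] _ _ _ _ small])
      (use close inside in \<open>auto simp: X_def intro!: S1.continuous_on S2.continuous_on continuous_on_subset[OF cont(2)]\<close>)
  have swap: "continuous_on (Y \<times> X) (\<lambda>z. F (snd z, fst z))" if "continuous_on (X \<times> Y) F" for F :: "real \<times> real \<Rightarrow> real"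
    by (rule continuous_on_Pair_compose[OF that]) (auto intro!: continuous_intros)
  have "segment_integrals_le {-R'..R'} {-K..K} \<zeta> (\<lambda>z. u1 (snd z, fst z) - k - u2 (snd z, fst z))"
    using segments(2) by (simp add: algebra_simps)
  then show "segment_integrals_le Y X \<zeta>' (\<lambda>z. u1 (snd z, fst z) - k - u0 (snd z, fst z))"
    unfolding Y_def
    by (rule segment_integrals_le_trans[OF _ sub(2)[unfolded Y_def] sub(1) _ _ _ _ small])
      (use close inside in \<open>auto simp: Y_def[symmetric] intro!: continuous_intros swap S1.continuous_on S2.continuous_on
        continuous_on_subset[OF cont(1)]\<close>)
qed

lemma (in nearby_solutions) close_of_controlled_by_averages:
  fixes u0 v0 :: "real \<times> real \<Rightarrow> real"
  assumes S: "bounded_periodic_dagger_C2 R a u1 v1 p1 q1 r s P M" and a: "\<bar>a\<bar> \<le> A"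
    and segments: "segment_integrals_le {-K..K} {-R'..R'} \<zeta> (\<lambda>z. v1 z - v2 z)"
      "segment_integrals_le {-R'..R'} {-K..K} \<zeta> (\<lambda>z. u1 (snd z, fst z) - u2 (snd z, fst z) - k)"
    and cont: "continuous_on (open_strip R) u0" "continuous_on (open_strip R) v0"
    and control: "controlled_by_averages R P A M u0 v0 xc yc \<eta> \<rho> \<zeta>' d"
    and box: "\<bar>xc\<bar> + \<rho> \<le> K" "\<bar>yc\<bar> + \<rho> \<le> R1" "K \<le> L" "R1 \<le> R'"
    and close: "\<And>z. z \<in> {-L..L} \<times> {-R1..R1} \<Longrightarrow> \<bar>u2 z - u0 z\<bar> \<le> \<epsilon>' \<and> \<bar>v2 z - v0 z\<bar> \<le> \<epsilon>'"
    and small: "\<zeta> + \<epsilon>' * (2 * \<rho>) \<le> \<zeta>'" and xy: "\<bar>x - xc\<bar> \<le> d" "\<bar>y - yc\<bar> \<le> d"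
  shows "\<bar>v1 (x, y) - v0 (xc, yc)\<bar> \<le> \<eta> \<and> \<bar>u1 (x, y) - k - u0 (xc, yc)\<bar> \<le> \<eta>"
proof -
  let ?X = "{xc-\<rho>..xc+\<rho>}" and ?Y = "{yc-\<rho>..yc+\<rho>}"
  have sub: "?X \<subseteq> {-K..K}" "?Y \<subseteq> {-R'..R'}" "?X \<times> ?Y \<subseteq> {-L..L} \<times> {-R1..R1}" using box by auto
  have "segment_integrals_le ?X ?Y \<zeta>' (\<lambda>z. v1 z - v0 z)"
    "segment_integrals_le ?Y ?X \<zeta>' (\<lambda>z. u1 (snd z, fst z) - k - u0 (snd z, fst z))"
    using segment_integrals_le_of_close[OF segments sub(1,2) cont _ small] close sub(3) by blast+
  with control S a xy show ?thesis unfolding controlled_by_averages_def by blast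
qed

definition controlled_by_nearby_solutions :: "real \<Rightarrow> real \<Rightarrow> real \<Rightarrow> real \<Rightarrow> (real \<times> real \<Rightarrow> real) \<Rightarrow>
    (real \<times> real \<Rightarrow> real) \<Rightarrow> real \<Rightarrow> real \<Rightarrow> real \<Rightarrow> real \<Rightarrow> real \<Rightarrow> real \<Rightarrow> real \<Rightarrow> bool" where
  "controlled_by_nearby_solutions R P A M u0 v0 x0 y0 \<eta> L \<epsilon> R1 d \<longleftrightarrow> (\<forall>a u v p q r s b U V pU qU R' x y.
    bounded_periodic_dagger_C2 R a u v p q r s P M \<longrightarrow> \<bar>a\<bar> \<le> A \<longrightarrow> u (0, 0) = 0 \<longrightarrow> R1 < R' \<longrightarrow>
    nearby_solutions R a u v p q b U V pU qU M L R' \<epsilon> \<longrightarrow>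
    (\<forall>z\<in>{-L..L} \<times> {-R1..R1}. \<bar>U z - u0 z\<bar> \<le> \<epsilon> \<and> \<bar>V z - v0 z\<bar> \<le> \<epsilon>) \<longrightarrow>
    \<bar>x - x0\<bar> \<le> d \<longrightarrow> \<bar>y - y0\<bar> \<le> d \<longrightarrow>
    \<bar>v (x, y) - v0 (x0, y0)\<bar> < \<eta> \<and> \<bar>u (x, y) - u0 (x0, y0)\<bar> < \<eta>)"

text \<open>The condition \<open>u (0, 0) = 0\<close> fixes the additive constant in \<open>u\<close>, which the
  potential of the difference leaves undetermined; hence closeness is also established at the origin.\<close>

theorem exists_controlled_by_nearby_solutions:
  fixes u0 v0 :: "real \<times> real \<Rightarrow> real"
  assumes R: "0 < R" and P: "0 < P" and M: "0 \<le> M" and y0: "\<bar>y0\<bar> < R" and \<eta>: "0 < \<eta>"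
    and cont: "continuous_on (open_strip R) u0" "continuous_on (open_strip R) v0" and u0_origin: "u0 (0, 0) = 0"
  shows "\<exists>L \<epsilon> R1 d. 0 < L \<and> 0 < \<epsilon> \<and> 0 < R1 \<and> R1 < R \<and> 0 < d \<and>
    controlled_by_nearby_solutions R P A M u0 v0 x0 y0 \<eta> L \<epsilon> R1 d"
proof -
  have "0 < \<eta> / 3" using \<eta> by simp
  note exists_scales = exists_controlled_by_averages[OF P _ this cont, of _ A M]
  obtain \<rho>0 \<zeta>0 d0 where scales0: "0 < \<rho>0" "\<bar>y0\<bar> + \<rho>0 < R" "0 < \<zeta>0" "0 < d0" and near0: "controlled_by_averages R P A M u0 v0 x0 y0 (\<eta> / 3) \<rho>0 \<zeta>0 d0"
    using exists_scales[OF y0] by blast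
  obtain \<rho>1 \<zeta>1 d1 where scales1: "0 < \<rho>1" "\<rho>1 < R" "0 < \<zeta>1" "0 < d1" and near1: "controlled_by_averages R P A M u0 v0 0 0 (\<eta> / 3) \<rho>1 \<zeta>1 d1"
    using exists_scales[of 0 0] R by auto
  define \<zeta> K R1 where "\<zeta> = min \<zeta>0 \<zeta>1 / 2" and "K = \<bar>x0\<bar> + \<rho>0 + \<rho>1" and "R1 = max (\<bar>y0\<bar> + \<rho>0) \<rho>1"
  have \<zeta>: "0 < \<zeta>" "2 * \<zeta> \<le> \<zeta>0" "2 * \<zeta> \<le> \<zeta>1" using scales0 scales1 by (auto simp: \<zeta>_def)
  have K: "0 \<le> K" "\<bar>x0\<bar> + \<rho>0 \<le> K" "\<rho>1 \<le> K" using scales0 scales1 by (auto simp: K_def)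
  have R1: "0 < R1" "R1 < R" "\<bar>y0\<bar> + \<rho>0 \<le> R1" "\<rho>1 \<le> R1" using scales0 scales1 by (auto simp: R1_def)
  obtain L \<epsilon>1 where L: "2 * K + 2 \<le> L" and \<epsilon>1: "0 < \<epsilon>1" and potential:
    "\<forall>a u1 v1 p1 q1 b u2 v2 p2 q2 R' \<epsilon>'. \<bar>a\<bar> \<le> A \<longrightarrow> \<epsilon>' \<le> \<epsilon>1 \<longrightarrow>
      nearby_solutions R a u1 v1 p1 q1 b u2 v2 p2 q2 M L R' \<epsilon>' \<longrightarrow>
      (\<exists>\<gamma>. segment_integrals_le {-K..K} {-R'..R'} \<zeta> (\<lambda>z. v1 z - v2 z) \<and>
        segment_integrals_le {-R'..R'} {-K..K} \<zeta> (\<lambda>z. u1 (snd z, fst z) - u2 (snd z, fst z) - \<gamma>))"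
    using nearby_solutions_segment_integrals[OF \<zeta>(1) K(1) M, of A R] by blast
  define \<epsilon> where "\<epsilon> = min \<epsilon>1 (\<zeta> / (2 * (\<rho>0 + \<rho>1)))"
  have \<epsilon>: "0 < \<epsilon>" "\<epsilon> \<le> \<epsilon>1" "\<epsilon> * (2 * (\<rho>0 + \<rho>1)) \<le> \<zeta>"
    using \<epsilon>1 \<zeta>(1) scales0(1) scales1(1) by (simp_all add: \<epsilon>_def pos_le_divide_eq[symmetric])
  have "controlled_by_nearby_solutions R P A M u0 v0 x0 y0 \<eta> L \<epsilon> R1 d0"
    unfolding controlled_by_nearby_solutions_def
  proof (intro allI impI)
    fix a u v p q r s b U V pU qU R' x y
    assume S: "bounded_periodic_dagger_C2 R a u v p q r s P M" and a: "\<bar>a\<bar> \<le> A" and u_origin: "u (0, 0) = 0"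
      and R1': "R1 < R'" and "nearby_solutions R a u v p q b U V pU qU M L R' \<epsilon>"
      and close: "\<forall>z\<in>{-L..L} \<times> {-R1..R1}. \<bar>U z - u0 z\<bar> \<le> \<epsilon> \<and> \<bar>V z - v0 z\<bar> \<le> \<epsilon>"
      and xy: "\<bar>x - x0\<bar> \<le> d0" "\<bar>y - y0\<bar> \<le> d0"
    then interpret N: nearby_solutions R a u v p q b U V pU qU M L R' \<epsilon> by simp
    obtain k where segments: "segment_integrals_le {-K..K} {-R'..R'} \<zeta> (\<lambda>z. v z - V z)"
        "segment_integrals_le {-R'..R'} {-K..K} \<zeta> (\<lambda>z. u (snd z, fst z) - U (snd z, fst z) - k)"
      using potential a \<epsilon>(2) N.nearby_solutions_axioms by blast
    have K_le_L: "K \<le> L" using L K(1) by linarith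
    have scaled: "\<epsilon> * (2 * \<rho>) \<le> \<zeta>" if "\<rho> \<le> \<rho>0 + \<rho>1" for \<rho>
      by (rule order_trans[OF mult_left_mono \<epsilon>(3)]) (use that \<epsilon>(1) in auto)
    have small: "\<zeta> + \<epsilon> * (2 * \<rho>0) \<le> \<zeta>0" "\<zeta> + \<epsilon> * (2 * \<rho>1) \<le> \<zeta>1"
      using scaled[of \<rho>0] scaled[of \<rho>1] \<zeta> scales0(1) scales1(1) by simp_all
    note close_at = N.close_of_controlled_by_averages[OF S a segments cont _ _ _ K_le_L less_imp_le[OF R1'] close[rule_format]]
    have "\<bar>v (x, y) - v0 (x0, y0)\<bar> \<le> \<eta> / 3 \<and> \<bar>u (x, y) - k - u0 (x0, y0)\<bar> \<le> \<eta> / 3"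
      by (rule close_at[OF near0 K(2) R1(3) _ small(1) xy])
    moreover have "\<bar>u (0, 0) - k - u0 (0, 0)\<bar> \<le> \<eta> / 3"
      using close_at[OF near1 _ _ _ small(2), of 0 0] K R1 scales0 scales1 by simp
    ultimately show "\<bar>v (x, y) - v0 (x0, y0)\<bar> < \<eta> \<and> \<bar>u (x, y) - u0 (x0, y0)\<bar> < \<eta>"
      using u_origin u0_origin \<eta> by linarith
  qed
  moreover have "0 < L" using L K(1) by linarith
  ultimately show ?thesis using \<epsilon>(1) R1(1,2) scales0(4) by blast
qed

section \<open>A degenerate Gronwall argument\<close>

text \<open>In integrated form, \<open>M'' \<le> (c / \<bar>y\<bar>) M\<close>. Although \<open>1 / \<bar>y\<bar>\<close> is not integrable at \<open>0\<close>,
  the inequality propagates zeros of \<open>M \<ge> 0\<close>, because \<open>M\<close> vanishes to first order at its zeros.\<close>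

locale degenerate_growth =
  fixes R c :: real and M M' :: "real \<Rightarrow> real"
  assumes cont: "continuous_on {-R<..<R} M" "continuous_on {-R<..<R} M'"
    and nonneg: "\<And>y. y \<in> {-R<..<R} \<Longrightarrow> 0 \<le> M y"
    and increment: "\<And>y1 y2. -R < y1 \<Longrightarrow> y1 \<le> y2 \<Longrightarrow> y2 < R \<Longrightarrow> M y2 - M y1 = integral {y1..y2} M'"
    and slope_growth: "\<And>y1 y2. -R < y1 \<Longrightarrow> y1 \<le> y2 \<Longrightarrow> y2 < R \<Longrightarrow> 0 \<notin> {y1..y2} \<Longrightarrow>
      M' y2 - M' y1 \<le> integral {y1..y2} (\<lambda>s. c / \<bar>s\<bar> * M s)"
    and c_pos: "0 < c"
begin

lemma has_derivative:
  assumes "y \<in> {-R<..<R}"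
  shows "(M has_real_derivative M' y) (at y)"
proof -
  define l r where "l = (y - R) / 2" and "r = (y + R) / 2"
  have lr: "-R < l" "l < y" "y < r" "r < R" using assms by (auto simp: l_def r_def field_simps)
  have "((\<lambda>t. integral {l..t} M') has_real_derivative M' y) (at y within {l..r})"
    by (rule integral_has_real_derivative[OF continuous_on_subset[OF cont(2)]]) (use lr in auto)
  then have "((\<lambda>t. integral {l..t} M') has_real_derivative M' y) (at y)"
    using lr by (simp add: at_within_Icc_at)
  from DERIV_add[OF this DERIV_const[of "M l"]]
  have primitive: "((\<lambda>t. integral {l..t} M' + M l) has_real_derivative M' y) (at y)" by simp
  show ?thesis
  proof (rule has_field_derivative_transform_within_open[OF primitive, of "{l<..<r}"])
    fix t assume "t \<in> {l<..<r}"
    then show "integral {l..t} M' + M l = M t" using increment[of l t] lr by auto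
  qed (use lr in auto)
qed

lemma slope_eq_0:
  assumes y: "y \<in> {-R<..<R}" and zero: "M y = 0"
  shows "M' y = 0"
proof (rule DERIV_local_min[OF has_derivative[OF y], of "R - \<bar>y\<bar>"])
  show "\<forall>z. \<bar>y - z\<bar> < R - \<bar>y\<bar> \<longrightarrow> M y \<le> M z"
    using nonneg zero by (auto simp: abs_if split: if_splits)
qed (use y in auto)

lemma exists_growth_scale:
  assumes y: "y \<in> {-R<..<R}"
  shows "\<exists>\<delta>>0. y + \<delta> < R \<and> c * \<delta> \<le> 1 / 2 \<and> (\<forall>s\<in>{y<..y+\<delta>}. s - y \<le> \<bar>s\<bar> \<and> s \<noteq> 0)"
proof -
  define d where "d = (if y < 0 then - y / 2 else 1)"
  define \<delta> where "\<delta> = Min {(R - y) / 2, 1 / (2 * c), d}"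
  have "0 < d" by (simp add: d_def)
  then have "0 < \<delta>" using y c_pos by (simp add: \<delta>_def)
  moreover have "\<delta> \<le> (R - y) / 2" "\<delta> \<le> 1 / (2 * c)" "\<delta> \<le> d" unfolding \<delta>_def by (rule Min_le; simp)+
  ultimately have \<delta>: "0 < \<delta>" "\<delta> \<le> (R - y) / 2" "\<delta> \<le> 1 / (2 * c)" "y < 0 \<Longrightarrow> \<delta> \<le> - y / 2"
    by (simp_all add: d_def)
  have "s - y \<le> \<bar>s\<bar>" "s \<noteq> 0" if "s \<in> {y<..y+\<delta>}" for s
    using that \<delta>(4) by (cases "y < 0"; force)+
  moreover have "y + \<delta> < R" using \<delta>(2) y by simp
  moreover have "c * \<delta> \<le> 1 / 2" using \<delta>(3) c_pos by (simp add: field_simps)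
  ultimately show ?thesis using \<delta>(1) by blast
qed

context
  fixes y \<delta> b :: real
  assumes y: "y \<in> {-R<..<R}" and zero: "M y = 0"
    and \<delta>: "0 < \<delta>" "y + \<delta> < R" "c * \<delta> \<le> 1 / 2" and away: "\<And>s. s \<in> {y<..y+\<delta>} \<Longrightarrow> s - y \<le> \<bar>s\<bar> \<and> s \<noteq> 0"
    and slope_le: "\<And>s. s \<in> {y..y+\<delta>} \<Longrightarrow> M' s \<le> b"
begin

lemma slope_bound_nonneg: "0 \<le> b"
  using slope_le[of y] slope_eq_0[OF y zero] \<delta>(1) by simp

lemma le_linear:
  assumes s: "s \<in> {y..y+\<delta>}"
  shows "M s \<le> b * (s - y)"
proof -
  have "M s - M y = integral {y..s} M'" by (rule increment) (use s y \<delta>(2) in auto)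
  also have "\<dots> \<le> integral {y..s} (\<lambda>_. b)"
  proof (rule integral_le)
    show "M' integrable_on {y..s}"
      by (rule integrable_continuous_real[OF continuous_on_subset[OF cont(2)]]) (use s y \<delta>(2) in auto)
  qed (use slope_le s in \<open>auto intro: integrable_const_ivl\<close>)
  also have "\<dots> = b * (s - y)" using s by simp
  finally show ?thesis using zero by simp
qed

lemma slope_increment_le:
  assumes s: "y < s" "s \<le> s'" "s' \<le> y + \<delta>"
  shows "M' s' - M' s \<le> b / 2"
proof -
  have inside: "t \<in> {y<..y+\<delta>}" "t \<in> {-R<..<R}" if "t \<in> {s..s'}" for t using that s y \<delta>(2) by auto
  have nonzero: "t \<noteq> 0" if "t \<in> {s..s'}" for t using away[OF inside(1)[OF that]] by blast
  then have "0 \<notin> {s..s'}" by blast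
  then have "M' s' - M' s \<le> integral {s..s'} (\<lambda>t. c / \<bar>t\<bar> * M t)"
    using inside(2)[of s] inside(2)[of s'] s(2) by (intro slope_growth) simp_all
  also have "\<dots> \<le> integral {s..s'} (\<lambda>t. c * b)"
  proof (rule integral_le)
    show "(\<lambda>t. c / \<bar>t\<bar> * M t) integrable_on {s..s'}"
      by (intro integrable_continuous_real continuous_intros continuous_on_subset[OF cont(1)])
        (use inside(2) nonzero in auto)
    fix t assume t: "t \<in> {s..s'}"
    have "M t \<le> b * (t - y)" using inside(1)[OF t] by (intro le_linear) auto
    also have "\<dots> \<le> b * \<bar>t\<bar>" using away[OF inside(1)[OF t]] slope_bound_nonneg by (intro mult_left_mono) auto
    finally have "c / \<bar>t\<bar> * M t \<le> c / \<bar>t\<bar> * (b * \<bar>t\<bar>)" using c_pos by (intro mult_left_mono) auto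
    also have "\<dots> = c * b" using nonzero[OF t] by simp
    finally show "c / \<bar>t\<bar> * M t \<le> c * b" .
  qed auto
  also have "\<dots> = c * (s' - s) * b" using s by simp
  also have "\<dots> \<le> c * \<delta> * b" using s c_pos slope_bound_nonneg by (intro mult_right_mono mult_left_mono) auto
  also have "\<dots> \<le> 1 / 2 * b" using \<delta>(3) slope_bound_nonneg by (intro mult_right_mono) auto
  finally show ?thesis by simp
qed

lemma slope_le_half:
  assumes s: "s \<in> {y..y+\<delta>}"
  shows "M' s \<le> b / 2"
proof (cases "s = y")
  case True
  then show ?thesis using slope_eq_0[OF y zero] slope_bound_nonneg by simp
next
  case False
  have "isCont M' y" using cont(2) y by (simp add: continuous_on_eq_continuous_at)
  then have "(M' \<longlongrightarrow> M' y) (at_right y)" by (simp add: isCont_def filterlim_at_split)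
  then have "((\<lambda>t. M' s - M' t) \<longlongrightarrow> M' s - M' y) (at_right y)" by (intro tendsto_intros)
  moreover have "\<forall>\<^sub>F t in at_right y. M' s - M' t \<le> b / 2"
    unfolding eventually_at_right_field 
    by (rule exI[of _ s]) (use s False slope_increment_le[of _ s] in auto)
  ultimately have "M' s - M' y \<le> b / 2" by (rule tendsto_upperbound) simp
  then show ?thesis using slope_eq_0[OF y zero] by simp
qed

end

lemma vanishes_right:
  assumes y: "y \<in> {-R<..<R}" and zero: "M y = 0"
  shows "\<exists>\<delta>>0. y + \<delta> < R \<and> (\<forall>s\<in>{y..y+\<delta>}. M s = 0)"
proof -
  obtain \<delta> where \<delta>: "0 < \<delta>" "y + \<delta> < R" "c * \<delta> \<le> 1 / 2" and away: "\<And>s. s \<in> {y<..y+\<delta>} \<Longrightarrow> s - y \<le> \<bar>s\<bar> \<and> s \<noteq> 0"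
    using exists_growth_scale[OF y] by blast
  have inside: "{y..y+\<delta>} \<subseteq> {-R<..<R}" using y \<delta> by auto
  obtain z where z: "z \<in> {y..y+\<delta>}" "\<And>s. s \<in> {y..y+\<delta>} \<Longrightarrow> M' s \<le> M' z"
    using continuous_attains_sup[OF _ _ continuous_on_subset[OF cont(2) inside]] \<delta>(1) by auto
  have "M' z \<le> M' z / 2" by (rule slope_le_half[OF y zero \<delta> away z(2) z(1)])
  then have max_slope: "M' z \<le> 0" by simp
  have "M s = 0" if s: "s \<in> {y..y+\<delta>}" for s
  proof (rule antisym)
    have "M s \<le> M' z * (s - y)" by (rule le_linear[OF y zero \<delta> away z(2) s])
    also have "\<dots> \<le> 0" using max_slope s by (intro mult_nonpos_nonneg) auto
    finally show "M s \<le> 0" .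
    show "0 \<le> M s" using nonneg s inside by blast
  qed
  then show ?thesis using \<delta> by blast
qed

lemma reflect: "degenerate_growth R c (\<lambda>y. M (- y)) (\<lambda>y. - M' (- y))"
proof
  have integral_uminus: "integral {y1..y2} (\<lambda>t. f (- t)) = integral {-y2..-y1} f" for f :: "real \<Rightarrow> real" and y1 y2
    using Henstock_Kurzweil_Integration.integral_reflect_real[of "-y1" "-y2" f] by simp
  have continuous_on_uminus: "continuous_on {-R<..<R} (\<lambda>t. f (- t))" if "continuous_on {-R<..<R} f" for f :: "real \<Rightarrow> real"
    by (rule continuous_on_compose2[OF that]) (auto intro!: continuous_intros)
  show "continuous_on {-R<..<R} (\<lambda>y. M (- y))" "continuous_on {-R<..<R} (\<lambda>y. - M' (- y))"
    using cont by (auto intro: continuous_on_uminus continuous_on_minus)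
  fix y1 y2 assume y: "-R < y1" "y1 \<le> y2" "y2 < R"
  show "M (- y2) - M (- y1) = integral {y1..y2} (\<lambda>y. - M' (- y))"
    using increment[of "-y2" "-y1"] y integral_uminus[of y1 y2 M'] by simp
  assume "0 \<notin> {y1..y2}"
  then have "M' (- y1) - M' (- y2) \<le> integral {-y2..-y1} (\<lambda>s. c / \<bar>s\<bar> * M s)"
    using slope_growth[of "-y2" "-y1"] y by auto
  then show "- M' (- y2) - - M' (- y1) \<le> integral {y1..y2} (\<lambda>s. c / \<bar>s\<bar> * M (- s))"
    using integral_uminus[of y1 y2 "\<lambda>s. c / \<bar>s\<bar> * M s"] by simp
qed (use nonneg c_pos in auto)

theorem vanishes:
  assumes y0: "y0 \<in> {-R<..<R}" "M y0 = 0" and y: "y \<in> {-R<..<R}"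
  shows "M y = 0"
proof -
  define Z where "Z = {y \<in> {-R<..<R}. M y = 0}"
  have "openin (top_of_set {-R<..<R}) Z"
    unfolding openin_contains_ball
  proof (intro conjI ballI)
    fix z assume z: "z \<in> Z"
    obtain \<delta>1 where right: "\<delta>1 > 0" "\<forall>s\<in>{z..z+\<delta>1}. M s = 0" using vanishes_right[of z] z by (auto simp: Z_def)
    obtain \<delta>2 where left: "\<delta>2 > 0" "\<forall>s\<in>{-z..-z+\<delta>2}. M (- s) = 0"
      using degenerate_growth.vanishes_right[OF reflect, of "-z"] z by (auto simp: Z_def)
    have "M s = 0" if "dist z s < min \<delta>1 \<delta>2" for s
    proof (cases "z \<le> s")
      case True
      then have "s \<in> {z..z+\<delta>1}" using that by (simp add: dist_real_def)
      then show ?thesis using right(2) by blast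
    next
      case False
      then have "- s \<in> {-z..-z+\<delta>2}" using that by (simp add: dist_real_def)
      then have "M (- (- s)) = 0" using left(2) by blast
      then show ?thesis by simp
    qed
    then have "ball z (min \<delta>1 \<delta>2) \<inter> {-R<..<R} \<subseteq> Z" by (auto simp: Z_def)
    then show "\<exists>e>0. ball z e \<inter> {-R<..<R} \<subseteq> Z" using right(1) left(1) by (intro exI[of _ "min \<delta>1 \<delta>2"]) simp
  qed (auto simp: Z_def)
  moreover have "closedin (top_of_set {-R<..<R}) Z"
    unfolding Z_def by (rule continuous_closedin_preimage_constant[OF cont(1)])
  ultimately have "Z = {} \<or> Z = {-R<..<R}"
    using connected_clopen[of "{-R<..<R}"] connected_Ioo by blast
  moreover have "y0 \<in> Z" using y0 by (simp add: Z_def)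
  ultimately have "y \<in> Z" using y by blast
  then show ?thesis by (simp add: Z_def)
qed

end

section \<open>Averages of the difference of two ordered solutions\<close>

definition bump :: "real \<Rightarrow> real \<Rightarrow> real \<Rightarrow> real" where
  "bump x0 t x = (1 + cos (pi * (x - x0) / t)) / 2"

definition bump' :: "real \<Rightarrow> real \<Rightarrow> real \<Rightarrow> real" where
  "bump' x0 t x = - (pi / t) * sin (pi * (x - x0) / t) / 2"

definition bump'' :: "real \<Rightarrow> real \<Rightarrow> real \<Rightarrow> real" where
  "bump'' x0 t x = - (pi / t)\<^sup>2 * cos (pi * (x - x0) / t) / 2"

lemma bump_has_derivative:
  "(bump x0 t has_real_derivative bump' x0 t x) (at x)" "(bump' x0 t has_real_derivative bump'' x0 t x) (at x)"
proof -
  have phase: "((\<lambda>x. pi * (x - x0) / t) has_real_derivative pi / t) (at x)" for x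
    by (rule DERIV_cdivide) (auto intro!: derivative_eq_intros)
  show "(bump x0 t has_real_derivative bump' x0 t x) (at x)"
    unfolding bump_def[abs_def]
    by (rule DERIV_cong[OF DERIV_cdivide[OF DERIV_add[OF DERIV_const DERIV_chain2[OF DERIV_cos phase]]]])
      (simp add: bump'_def)
  show "(bump' x0 t has_real_derivative bump'' x0 t x) (at x)"
    unfolding bump'_def[abs_def]
    by (rule DERIV_cong[OF DERIV_cdivide[OF DERIV_cmult[OF DERIV_chain2[OF DERIV_sin phase]]]])
      (simp add: bump''_def power2_eq_square)
qed

lemma continuous_on_bump [continuous_intros]:
  fixes f :: "'c::t2_space \<Rightarrow> real"
  assumes "continuous_on S f"
  shows "continuous_on S (\<lambda>z. bump x0 t (f z))" "continuous_on S (\<lambda>z. bump' x0 t (f z))"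
    "continuous_on S (\<lambda>z. bump'' x0 t (f z))"
proof -
  have "continuous_on S (\<lambda>z. pi * (f z - x0) / t)" by (cases "t = 0") (auto intro!: continuous_intros assms)
  note trig = continuous_on_cos[OF this] continuous_on_sin[OF this]
  show "continuous_on S (\<lambda>z. bump x0 t (f z))" "continuous_on S (\<lambda>z. bump' x0 t (f z))"
    "continuous_on S (\<lambda>z. bump'' x0 t (f z))"
    unfolding bump_def bump'_def bump''_def
    by (intro continuous_on_divide continuous_on_add continuous_on_mult continuous_on_const trig; simp)+
qed

lemma bump_nonneg: "0 \<le> bump x0 t x"
proof -
  have "0 \<le> 1 + cos (pi * (x - x0) / t)" using cos_ge_minus_one[of "pi * (x - x0) / t"] by linarith
  then show ?thesis by (simp add: bump_def)
qed

lemma bump''_ge: "- (pi / t)\<^sup>2 * bump x0 t x \<le> bump'' x0 t x"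
proof -
  have "bump'' x0 t x + (pi / t)\<^sup>2 * bump x0 t x = (pi / t)\<^sup>2 / 2"
    unfolding bump_def bump''_def by (simp only: distrib_left add_divide_distrib times_divide_eq_right)
  then show ?thesis using zero_le_power2[of "pi / t"] by linarith
qed

lemma bump_endpoints:
  assumes "0 < t"
  shows "bump x0 t (x0 - t) = 0" "bump x0 t (x0 + t) = 0" "bump' x0 t (x0 - t) = 0" "bump' x0 t (x0 + t) = 0"
proof -
  have "pi * (x0 - t - x0) / t = - pi" "pi * (x0 + t - x0) / t = pi" using assms by (simp_all add: field_simps)
  then show "bump x0 t (x0 - t) = 0" "bump x0 t (x0 + t) = 0" "bump' x0 t (x0 - t) = 0" "bump' x0 t (x0 + t) = 0"
    unfolding bump_def bump'_def by simp_all
qed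

lemma bump_center: "bump x0 t x0 = 1"
  by (simp add: bump_def)

definition bump_average :: "real \<Rightarrow> real \<Rightarrow> (real \<times> real \<Rightarrow> real) \<Rightarrow> real \<Rightarrow> real" where
  "bump_average x0 t f y = integral {x0-t..x0+t} (\<lambda>x. f (x, y) * bump x0 t x)"

definition bump_average' :: "real \<Rightarrow> real \<Rightarrow> (real \<times> real \<Rightarrow> real) \<Rightarrow> real \<Rightarrow> real" where
  "bump_average' x0 t f y = - integral {x0-t..x0+t} (\<lambda>x. f (x, y) * bump' x0 t x)"

lemma weighted_integral_has_derivative:
  fixes f f' :: "real \<times> real \<Rightarrow> real" and w :: "real \<Rightarrow> real"
  assumes cont: "continuous_on (open_strip R) f" "continuous_on (open_strip R) f'" "continuous_on UNIV w"
    and f': "\<And>x y. \<bar>y\<bar> < R \<Longrightarrow> ((\<lambda>s. f (x, s)) has_real_derivative f' (x, y)) (at y)"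
    and y: "\<bar>y\<bar> < R"
  shows "((\<lambda>y. integral {x1..x2} (\<lambda>x. f (x, y) * w x)) has_real_derivative
    integral {x1..x2} (\<lambda>x. f' (x, y) * w x)) (at y)"
proof -
  have Q: "{x1..x2} \<times> {-R<..<R} \<subseteq> open_strip R" by (auto simp: open_strip_def)
  have w: "continuous_on S (\<lambda>z. w (g z))" if "continuous_on S g" for S :: "'c::t2_space set" and g
    by (rule continuous_on_compose2[OF cont(3) that]) auto
  have "((\<lambda>y. integral {x1..x2} (\<lambda>x. (\<lambda>z. f z * w (fst z)) (x, y))) has_real_derivative
    integral {x1..x2} (\<lambda>x. (\<lambda>z. f' z * w (fst z)) (x, y))) (at y)"
  proof (rule has_real_derivative_integral_fst[where c = "-R" and d = R])
    fix s x assume "s \<in> {-R<..<R}"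
    then have s: "\<bar>s\<bar> < R" by auto
    show "((\<lambda>y. f (x, y) * w (fst (x, y))) has_real_derivative f' (x, s) * w (fst (x, s))) (at s)"
      unfolding fst_conv by (rule DERIV_cmult_right[OF f'[OF s]])
    show "continuous_on {x1..x2} (\<lambda>x. f (x, s) * w (fst (x, s)))"
      unfolding fst_conv by (intro continuous_intros w continuous_on_horizontal_line[OF cont(1) s])
  next
    show "continuous_on ({x1..x2} \<times> {-R<..<R}) (\<lambda>z. f' z * w (fst z))"
      by (intro continuous_intros w continuous_on_subset[OF cont(2) Q])
  qed (use y in auto)
  then show ?thesis by simp
qed

locale ordered_solutions =
  S1: dagger_C1 R a u1 v1 p1 q1 + S2: dagger_C1 R a u2 v2 p2 q2
  for R a u1 v1 p1 q1 u2 v2 p2 q2 +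
  fixes x0 t :: real
  assumes a_nonzero: "a \<noteq> 0" and t_pos: "0 < t"
    and ordered: "\<And>x y. \<bar>y\<bar> < R \<Longrightarrow> v1 (x, y) \<le> v2 (x, y)"
begin

abbreviation M :: "real \<Rightarrow> real" where
  "M \<equiv> bump_average x0 t (\<lambda>z. v2 z - v1 z)"

abbreviation M' :: "real \<Rightarrow> real" where
  "M' \<equiv> bump_average' x0 t (\<lambda>z. u2 z - u1 z)"

abbreviation M'' :: "real \<Rightarrow> real" where
  "M'' \<equiv> bump_average' x0 t (\<lambda>z. q2 z - q1 z)"

lemma average_has_derivative:
  assumes y: "\<bar>y\<bar> < R"
  shows "(M has_real_derivative M' y) (at y)"
proof -
  have "integral {x0-t..x0+t} (\<lambda>x. bump x0 t x * (p2 (x, y) - p1 (x, y)))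
      = - integral {x0-t..x0+t} (\<lambda>x. bump' x0 t x * (u2 (x, y) - u1 (x, y)))"
    by (rule integral_by_parts_vanishing)
      (use t_pos y in \<open>auto simp: bump_endpoints intro!: bump_has_derivative derivative_intros S1.u_dx S2.u_dx
        continuous_intros continuous_on_horizontal_line[OF S1.continuous(3)] continuous_on_horizontal_line[OF S2.continuous(3)]\<close>)
  moreover have "(M has_real_derivative integral {x0-t..x0+t} (\<lambda>x. (p2 (x, y) - p1 (x, y)) * bump x0 t x)) (at y)"
    unfolding bump_average_def[abs_def]
    by (rule weighted_integral_has_derivative[where f = "\<lambda>z. v2 z - v1 z" and f' = "\<lambda>z. p2 z - p1 z"])
      (use y in \<open>auto intro!: continuous_intros S1.continuous S2.continuous derivative_intros S1.v_dy S2.v_dy\<close>)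
  ultimately show ?thesis by (simp add: bump_average'_def mult.commute)
qed

lemma average'_has_derivative:
  assumes y: "\<bar>y\<bar> < R"
  shows "(M' has_real_derivative M'' y) (at y)"
  unfolding bump_average'_def[abs_def]
  by (rule DERIV_minus, rule weighted_integral_has_derivative[where f = "\<lambda>z. u2 z - u1 z" and f' = "\<lambda>z. q2 z - q1 z"])
    (use y in \<open>auto intro!: continuous_intros S1.continuous S2.continuous derivative_intros S1.u_dy S2.u_dy\<close>)

lemma rad_primitive_diff_bounds:
  assumes y: "\<bar>y\<bar> < R" "y \<noteq> 0"
  shows "0 \<le> rad_primitive a (v2 (x, y)) y - rad_primitive a (v1 (x, y)) y"
    "rad_primitive a (v2 (x, y)) y - rad_primitive a (v1 (x, y)) y \<le> (v2 (x, y) - v1 (x, y)) / \<bar>y\<bar>"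
proof -
  show "0 \<le> rad_primitive a (v2 (x, y)) y - rad_primitive a (v1 (x, y)) y"
    using rad_primitive_mono[OF a_nonzero ordered[OF y(1), of x], of y] by simp
  have "rad_primitive a (v2 (x, y)) y - rad_primitive a (v1 (x, y)) y \<le> (v2 (x, y) - v1 (x, y)) / sqrt (y\<^sup>2 + a\<^sup>2)"
    using rad_primitive_lipschitz[OF a_nonzero, of "v2 (x, y)" y "v1 (x, y)"] ordered[OF y(1), of x] by simp
  also have "\<dots> \<le> (v2 (x, y) - v1 (x, y)) / \<bar>y\<bar>"
  proof (rule divide_left_mono)
    show "\<bar>y\<bar> \<le> sqrt (y\<^sup>2 + a\<^sup>2)" by (rule real_le_rsqrt) simp
    show "0 < sqrt (y\<^sup>2 + a\<^sup>2) * \<bar>y\<bar>" using y sum_squares_pos[OF a_nonzero, of y] by simp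
  qed (use ordered[OF y(1), of x] in simp)
  finally show "rad_primitive a (v2 (x, y)) y - rad_primitive a (v1 (x, y)) y \<le> (v2 (x, y) - v1 (x, y)) / \<bar>y\<bar>" .
qed

lemma average''_le:
  assumes y: "\<bar>y\<bar> < R" "y \<noteq> 0"
  shows "M'' y \<le> (pi / t)\<^sup>2 / 2 / \<bar>y\<bar> * M y"
proof -
  define e where "e x = rad_primitive a (v2 (x, y)) y - rad_primitive a (v1 (x, y)) y" for x
  have e_dx: "(e has_real_derivative - 2 * (q2 (x, y) - q1 (x, y))) (at x)" for x
  proof -
    have "(e has_real_derivative - 2 * rad a (v2 (x, y)) y * q2 (x, y) / rad a (v2 (x, y)) y
        - - 2 * rad a (v1 (x, y)) y * q1 (x, y) / rad a (v1 (x, y)) y) (at x)"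
      unfolding e_def
      by (intro derivative_intros rad_primitive_has_derivative a_nonzero S1.v_dx[OF y(1)] S2.v_dx[OF y(1)])
    then show ?thesis
      using rad_pos[OF a_nonzero, of "v1 (x, y)" y] rad_pos[OF a_nonzero, of "v2 (x, y)" y] by (simp add: algebra_simps)
  qed
  have cont: "continuous_on Z e" "continuous_on Z (\<lambda>x. q2 (x, y) - q1 (x, y))" "continuous_on Z (\<lambda>x. v2 (x, y) - v1 (x, y))" for Z
    by (rule DERIV_continuous_on[OF has_field_derivative_at_within[OF e_dx]])
      (intro continuous_intros continuous_on_horizontal_line[OF _ y(1)] S1.continuous S2.continuous)+
  have "integral {x0-t..x0+t} (\<lambda>x. bump' x0 t x * (- 2 * (q2 (x, y) - q1 (x, y))))
      = - integral {x0-t..x0+t} (\<lambda>x. bump'' x0 t x * e x)"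
  proof (rule integral_by_parts_vanishing[OF _ bump_has_derivative(2) e_dx])
    show "continuous_on {x0-t..x0+t} (\<lambda>x. - 2 * (q2 (x, y) - q1 (x, y)))" by (intro continuous_intros cont)
  qed (use t_pos in \<open>auto simp: bump_endpoints intro!: continuous_intros\<close>)
  moreover have "integral {x0-t..x0+t} (\<lambda>x. bump' x0 t x * (- 2 * (q2 (x, y) - q1 (x, y)))) = 2 * M'' y"
  proof -
    have "(\<lambda>x. bump' x0 t x * (- 2 * (q2 (x, y) - q1 (x, y)))) = (\<lambda>x. - 2 * ((q2 (x, y) - q1 (x, y)) * bump' x0 t x))"
      by (simp add: fun_eq_iff algebra_simps)
    then show ?thesis unfolding bump_average'_def by (simp only: integral_mult_right)
  qed
  ultimately have "2 * M'' y = integral {x0-t..x0+t} (\<lambda>x. - (bump'' x0 t x * e x))" by simp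
  also have "\<dots> \<le> integral {x0-t..x0+t} (\<lambda>x. (pi / t)\<^sup>2 / \<bar>y\<bar> * ((v2 (x, y) - v1 (x, y)) * bump x0 t x))"
  proof (intro integral_le integrable_continuous_real continuous_on_minus continuous_on_mult continuous_on_const
      continuous_on_bump continuous_on_id cont)
    fix x
    have "- bump'' x0 t x * e x \<le> (pi / t)\<^sup>2 * bump x0 t x * e x"
      using bump''_ge[of t x0 x] rad_primitive_diff_bounds(1)[OF y, of x] unfolding e_def by (intro mult_right_mono) auto
    also have "\<dots> \<le> (pi / t)\<^sup>2 * bump x0 t x * ((v2 (x, y) - v1 (x, y)) / \<bar>y\<bar>)"
      using rad_primitive_diff_bounds(2)[OF y, of x] bump_nonneg[of x0 t x] unfolding e_def by (intro mult_left_mono) auto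
    finally show "- (bump'' x0 t x * e x) \<le> (pi / t)\<^sup>2 / \<bar>y\<bar> * ((v2 (x, y) - v1 (x, y)) * bump x0 t x)"
      by (simp add: mult.commute mult.left_commute)
  qed
  also have "\<dots> = (pi / t)\<^sup>2 / \<bar>y\<bar> * M y" by (simp add: bump_average_def)
  finally show ?thesis by simp
qed

lemma average_increment:
  assumes "-R < y1" "y1 \<le> y2" "y2 < R"
  shows "M y2 - M y1 = integral {y1..y2} M'"
  by (rule integral_real_derivative[symmetric]) (use assms average_has_derivative in auto)

lemma average_slope_growth:
  assumes y: "-R < y1" "y1 \<le> y2" "y2 < R" and zero: "0 \<notin> {y1..y2}"
  shows "M' y2 - M' y1 \<le> integral {y1..y2} (\<lambda>s. (pi / t)\<^sup>2 / 2 / \<bar>s\<bar> * M s)"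
proof -
  have inside: "\<bar>s\<bar> < R" "s \<noteq> 0" if "s \<in> {y1..y2}" for s using that y zero by auto
  have "M' y2 - M' y1 = integral {y1..y2} M''"
    by (rule integral_real_derivative[symmetric]) (use y inside average'_has_derivative in auto)
  also have "\<dots> \<le> integral {y1..y2} (\<lambda>s. (pi / t)\<^sup>2 / 2 / \<bar>s\<bar> * M s)"
  proof (rule integral_le)
    have "continuous_on ({x0-t..x0+t} \<times> {y1..y2}) (\<lambda>z. (q2 z - q1 z) * bump' x0 t (fst z))"
      using y by (intro continuous_intros S1.continuous_on S2.continuous_on Times_subset_open_strip) auto
    then have "continuous_on {y1..y2} M''"
      unfolding bump_average'_def
      using continuous_on_integral_fst[of "x0-t" "x0+t" "{y1..y2}" "\<lambda>z. (q2 z - q1 z) * bump' x0 t (fst z)"]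
      by (auto intro!: continuous_intros)
    then show "M'' integrable_on {y1..y2}" by (rule integrable_continuous_real)
    have "continuous_on {y1..y2} M"
      by (rule DERIV_continuous_on[OF has_field_derivative_at_within[OF average_has_derivative]]) (use inside in auto)
    then show "(\<lambda>s. (pi / t)\<^sup>2 / 2 / \<bar>s\<bar> * M s) integrable_on {y1..y2}"
      using inside by (intro integrable_continuous_real continuous_intros) auto
  qed (use average''_le inside in auto)
  finally show ?thesis .
qed

end

section \<open>Periodic functions and boundary data\<close>

lemma periodic_value_in_period:
  fixes f :: "real \<Rightarrow> 'b" and P :: real
  assumes P: "0 < P" and periodic: "\<And>x. f (x + P) = f x"
  obtains x' where "x' \<in> {0..P}" "f x' = f x"
proof
  let ?n = "\<lfloor>x / P\<rfloor>"
  interpret periodic_fun_simple f P by unfold_locales (rule periodic)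
  show "f (x + of_int (- ?n) * P) = f x" by (rule plus_of_int)
  have "of_int ?n * P \<le> x" "x \<le> (of_int ?n + 1) * P"
    using floor_divide_lower[OF P, of x] floor_divide_upper[OF P, of x] by simp_all
  then show "x + of_int (- ?n) * P \<in> {0..P}" by (simp add: algebra_simps)
qed

lemma eventually_less_near_edge:
  fixes f :: "real \<times> real \<Rightarrow> real"
  assumes R: "0 < R" and cont: "continuous_on (strip R) f" and X: "compact X"
    and edge: "\<And>x. x \<in> X \<Longrightarrow> f (x, R) < c"
  shows "\<forall>\<^sub>F y in at_left R. \<forall>x\<in>X. f (x, y) < c"
proof (cases "X = {}")
  case False
  have "continuous_on (X \<times> {-R..R}) f" by (rule continuous_on_subset[OF cont]) (auto simp: strip_def)
  from continuous_openin_preimage_gen[OF this open_lessThan[of c]]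
  have opn: "openin (top_of_set (X \<times> {-R..R})) ((X \<times> {-R..R}) \<inter> f -` {..<c})" .
  have "(\<lambda>x. (x, R)) ` X \<subseteq> (X \<times> {-R..R}) \<inter> f -` {..<c}" using edge R by auto
  then obtain V where V: "openin (top_of_set {-R..R}) V" "R \<in> V" "X \<times> V \<subseteq> (X \<times> {-R..R}) \<inter> f -` {..<c}"
    using tube_lemma[OF X False _ opn] by blast
  obtain T where T: "open T" "V = {-R..R} \<inter> T" using V(1) by (auto simp: openin_open)
  have "\<forall>\<^sub>F y in at_left R. y \<in> T"
    unfolding eventually_at_topological using T V(2) by blast
  moreover have "\<forall>\<^sub>F y in at_left R. y \<in> {-R<..<R}" using R by (intro eventually_at_left_real) simp
  ultimately show ?thesis
  proof eventually_elim
    case (elim y)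
    then have "X \<times> {y} \<subseteq> X \<times> V" using T(2) by auto
    then show ?case using V(3) by blast
  qed
qed simp

lemma exists_line_near_edges:
  fixes f :: "real \<times> real \<Rightarrow> real"
  assumes cont: "continuous_on (strip R) f" and X: "compact X" and R1: "0 < R1" "R1 < R"
    and edges: "\<And>x. x \<in> X \<Longrightarrow> f (x, R) < c \<and> f (x, - R) < c"
  obtains R' where "R1 < R'" "R' < R" "\<And>x. x \<in> X \<Longrightarrow> f (x, R') < c \<and> f (x, - R') < c"
proof -
  have R: "0 < R" using R1 by simp
  have "continuous_on (strip R) (\<lambda>z. f (fst z, - snd z))"
    by (rule continuous_on_Pair_compose[OF cont]) (auto simp: strip_def intro!: continuous_intros)
  from eventually_less_near_edge[OF R this X, of c] eventually_less_near_edge[OF R cont X, of c]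
  have "\<forall>\<^sub>F y in at_left R. \<forall>x\<in>X. f (x, - y) < c" "\<forall>\<^sub>F y in at_left R. \<forall>x\<in>X. f (x, y) < c"
    using edges by auto
  with eventually_at_left_real[OF R1(2)]
  have "\<forall>\<^sub>F y in at_left R. y \<in> {R1<..<R} \<and> (\<forall>x\<in>X. f (x, - y) < c) \<and> (\<forall>x\<in>X. f (x, y) < c)"
    by eventually_elim blast
  from eventually_happens'[OF _ this] show thesis using that by auto
qed

definition periodic_solution ::
    "real \<Rightarrow> real \<Rightarrow> real \<Rightarrow> (real \<times> real \<Rightarrow> real) \<Rightarrow> (real \<times> real \<Rightarrow> real) \<Rightarrow> bool" where
  "periodic_solution R P a u v \<longleftrightarrow> (\<exists>p q r s. dagger_C2 R a u v p q r s) \<and> continuous_on (strip R) v \<and>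
     (\<forall>x y. \<bar>y\<bar> \<le> R \<longrightarrow> u (x + P, y) = u (x, y) \<and> v (x + P, y) = v (x, y))"

lemma periodic_solution_const: "periodic_solution R P a (\<lambda>_. 0) (\<lambda>_. c)"
proof -
  have "dagger_C2 R a (\<lambda>_. 0) (\<lambda>_. c) (\<lambda>_. 0) (\<lambda>_. 0) (\<lambda>_. 0) (\<lambda>_. 0)" by unfold_locales auto
  then show ?thesis by (auto simp: periodic_solution_def)
qed

lemma periodic_solution_translate:
  assumes "periodic_solution R P a u v"
  shows "periodic_solution R P a (\<lambda>z. u (fst z + t, snd z)) (\<lambda>z. v (fst z + t, snd z))"
proof -
  have "\<exists>p q r s. dagger_C2 R a (\<lambda>z. u (fst z + t, snd z)) (\<lambda>z. v (fst z + t, snd z)) p q r s"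
    using assms dagger_C2.translate unfolding periodic_solution_def by blast
  moreover have "continuous_on (strip R) (\<lambda>z. v (fst z + t, snd z))"
    by (rule continuous_on_Pair_compose[of "strip R"])
      (use assms in \<open>auto simp: periodic_solution_def strip_def intro!: continuous_intros\<close>)
  moreover have "u (x + P + t, y) = u (x + t, y) \<and> v (x + P + t, y) = v (x + t, y)" if "\<bar>y\<bar> \<le> R" for x y
    using assms that unfolding periodic_solution_def by (metis add.assoc add.commute)
  ultimately show ?thesis by (simp add: periodic_solution_def)
qed

theorem periodic_solution_comparison:
  assumes sols: "periodic_solution R P a u1 v1" "periodic_solution R P a u2 v2" and a: "a \<noteq> 0" and P: "0 < P"
    and edges: "\<And>x. v1 (x, R) < v2 (x, R) \<and> v1 (x, - R) < v2 (x, - R)" and y: "\<bar>y\<bar> < R"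
  shows "v1 (x, y) \<le> v2 (x, y)"
proof -
  obtain p1 q1 r1 s1 p2 q2 r2 s2
    where C2: "dagger_C2 R a u1 v1 p1 q1 r1 s1" "dagger_C2 R a u2 v2 p2 q2 r2 s2"
    using sols by (auto simp: periodic_solution_def)
  have periodic: "u1 (x + P, y) = u1 (x, y) \<and> v1 (x + P, y) = v1 (x, y)"
    "u2 (x + P, y) = u2 (x, y) \<and> v2 (x + P, y) = v2 (x, y)" if "\<bar>y\<bar> < R" for x y
    using sols that by (auto simp: periodic_solution_def)
  have cont: "continuous_on (strip R) (\<lambda>z. v1 z - v2 z)"
    using sols by (auto simp: periodic_solution_def intro!: continuous_intros)
  have "0 < (\<bar>y\<bar> + R) / 2" "(\<bar>y\<bar> + R) / 2 < R" using y by auto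
  from exists_line_near_edges[OF cont compact_Icc[of 0 P] this, of 0]
  obtain R' where R': "(\<bar>y\<bar> + R) / 2 < R'" "R' < R"
    and line: "\<And>x. x \<in> {0..P} \<Longrightarrow> v1 (x, R') - v2 (x, R') < 0 \<and> v1 (x, - R') - v2 (x, - R') < 0"
    using edges by auto
  have abs_R': "\<bar>y\<bar> < R'" "0 < R'" "\<bar>R'\<bar> < R" "\<bar>- R'\<bar> < R" using R' y by auto
  have "v1 (x, R') \<le> v2 (x, R') \<and> v1 (x, - R') \<le> v2 (x, - R')" for x
  proof -
    obtain x' where "x' \<in> {0..P}" "(v1 (x', R') - v2 (x', R'), v1 (x', - R') - v2 (x', - R'))
        = (v1 (x, R') - v2 (x, R'), v1 (x, - R') - v2 (x, - R'))"
      by (rule periodic_value_in_period[OF P, where f = "\<lambda>x. (v1 (x, R') - v2 (x, R'), v1 (x, - R') - v2 (x, - R'))" and x = x])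
        (use periodic abs_R' in auto)
    then show ?thesis using line[of x'] by simp
  qed
  then interpret ordered_on_edges R a u1 v1 p1 q1 r1 s1 u2 v2 p2 q2 r2 s2 P R'
    using C2 a P R' abs_R' periodic by (auto simp: ordered_on_edges_def ordered_on_edges_axioms_def)
  show ?thesis using comparison abs_R'(1) by simp
qed

lemma periodic_gap:
  fixes f g :: "real \<Rightarrow> real"
  assumes P: "0 < P" and cont: "continuous_on UNIV f" "continuous_on UNIV g"
    and periodic: "\<And>x. f (x + P) = f x" "\<And>x. g (x + P) = g x" and less: "\<And>x. f x < g x"
  shows "\<exists>e>0. \<forall>x. f x + e \<le> g x"
proof -
  have "continuous_on {0..P} (\<lambda>x. g x - f x)"
    by (intro continuous_intros continuous_on_subset[OF cont(1)] continuous_on_subset[OF cont(2)]) auto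
  then obtain x0 where x0: "x0 \<in> {0..P}" "\<And>x. x \<in> {0..P} \<Longrightarrow> g x0 - f x0 \<le> g x - f x"
    using continuous_attains_inf[of "{0..P}" "\<lambda>x. g x - f x"] P by auto
  have "f x + (g x0 - f x0) \<le> g x" for x
  proof -
    obtain x' where "x' \<in> {0..P}" "g x' - f x' = g x - f x"
      by (rule periodic_value_in_period[OF P, where f = "\<lambda>x. g x - f x" and x = x]) (simp add: periodic)
    then show ?thesis using x0(2)[of x'] by simp
  qed
  then show ?thesis using less[of x0] by (intro exI[of _ "g x0 - f x0"]) auto
qed

lemma eventually_less_of_uniform_limit:
  fixes f g :: "'i \<Rightarrow> real \<Rightarrow> real"
  assumes limits: "uniform_limit UNIV f f0 F" "uniform_limit UNIV g g0 F"
    and gap: "0 < P" "continuous_on UNIV f0" "continuous_on UNIV g0"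
      "\<And>x. f0 (x + P) = f0 x" "\<And>x. g0 (x + P) = g0 x" "\<And>x. f0 x < g0 x"
  shows "\<forall>\<^sub>F i in F. \<forall>x. f i x < g i x"
proof -
  obtain e where e: "0 < e" "\<And>x. f0 x + e \<le> g0 x" using periodic_gap[OF gap] by blast
  then have "0 < e / 2" by simp
  from uniform_limitD[OF limits(1) this] uniform_limitD[OF limits(2) this] show ?thesis
  proof eventually_elim
    case (elim i)
    show ?case
    proof
      fix x
      have "\<bar>f i x - f0 x\<bar> < e / 2" "\<bar>g i x - g0 x\<bar> < e / 2" using elim by (auto simp: dist_real_def)
      then show "f i x < g i x" using e(2)[of x] by linarith
    qed
  qed
qed

lemma uniform_limit_translation:
  fixes f :: "real \<Rightarrow> real"
  assumes lipschitz: "\<And>x y. \<bar>f x - f y\<bar> \<le> K * \<bar>x - y\<bar>"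
  shows "uniform_limit UNIV (\<lambda>t x. f (x + t)) f (nhds 0)"
proof (rule uniform_limitI)
  fix e :: real assume e: "0 < e"
  have K: "0 \<le> K" using order_trans[OF abs_ge_zero lipschitz[of 1 0]] by simp
  show "\<forall>\<^sub>F t in nhds 0. \<forall>x\<in>UNIV. dist (f (x + t)) (f x) < e"
    unfolding eventually_nhds_metric
  proof (intro exI[of _ "e / (K + 1)"] conjI allI impI ballI)
    fix t x :: real assume "dist t 0 < e / (K + 1)"
    then have "(K + 1) * \<bar>t\<bar> < e" using K by (simp add: dist_real_def field_simps)
    moreover have "\<bar>f (x + t) - f x\<bar> \<le> K * \<bar>t\<bar>" using lipschitz[of "x + t" x] by simp
    ultimately show "dist (f (x + t)) (f x) < e" by (simp add: dist_real_def algebra_simps)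
  qed (use e K in simp)
qed

lemma eventually_uniformly_large:
  fixes f :: "real \<Rightarrow> real \<Rightarrow> real"
  assumes P: "0 < P" and cont: "\<And>b. continuous_on UNIV (f b)" and periodic: "\<And>b x. f b (x + P) = f b x"
    and mono: "\<And>b b' x. b < b' \<Longrightarrow> f b x < f b' x" and lim: "\<And>x. filterlim (\<lambda>b. f b x) at_top at_top"
  shows "\<forall>\<^sub>F b in at_top. \<forall>x. c < f b x"
proof -
  have "\<exists>b. c < f b x" for x
    using lim[of x] unfolding filterlim_at_top_dense by (meson eventually_happens' trivial_limit_at_top_linorder)
  then obtain B where B: "\<And>x. c < f (B x) x" by metis
  have opn: "open {x'. c < f (B x) x'}" for x using cont by (auto intro!: open_Collect_less continuous_intros)
  obtain D where D: "finite D" "{0..P} \<subseteq> (\<Union>x\<in>D. {x'. c < f (B x) x'})"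
    by (rule compactE_image[OF compact_Icc, of "{0..P}" "\<lambda>x. {x'. c < f (B x) x'}"]) (use B opn in auto)
  have "c < f b x" if b: "Max (B ` D) \<le> b" for b x
  proof -
    obtain x' where x': "x' \<in> {0..P}" "(\<lambda>b. f b x') = (\<lambda>b. f b x)"
      by (rule periodic_value_in_period[OF P, where f = "\<lambda>x b. f b x" and x = x]) (use periodic in auto)
    then obtain z where z: "z \<in> D" "c < f (B z) x'" using D(2) by auto
    have "B z \<le> b" using b D(1) z(1) by (auto intro: order_trans[OF Max_ge])
    then have "f (B z) x \<le> f b x" using mono[of "B z" b x] by (cases "B z = b") auto
    then show ?thesis using z(2) fun_cong[OF x'(2), of "B z"] by simp
  qed
  then show ?thesis unfolding eventually_at_top_linorder by blast
qed

lemma eventually_uniformly_small: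
  fixes f :: "real \<Rightarrow> real \<Rightarrow> real"
  assumes P: "0 < P" and cont: "\<And>b. continuous_on UNIV (f b)" and periodic: "\<And>b x. f b (x + P) = f b x"
    and mono: "\<And>b b' x. b < b' \<Longrightarrow> f b x < f b' x" and lim: "\<And>x. filterlim (\<lambda>b. f b x) at_bot at_bot"
  shows "\<forall>\<^sub>F b in at_bot. \<forall>x. f b x < c"
proof -
  have "filterlim (\<lambda>b. - f (- b) x) at_top at_top" for x
    by (rule filterlim_compose[OF filterlim_uminus_at_top_at_bot filterlim_compose[OF lim filterlim_uminus_at_bot_at_top]])
  then have "\<forall>\<^sub>F b in at_top. \<forall>x. - c < - f (- b) x"
    by (intro eventually_uniformly_large[OF P, where f = "\<lambda>b x. - f (- b) x"])
      (simp_all add: cont continuous_on_minus periodic mono)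
  then show ?thesis by (simp add: at_bot_mirror eventually_filtermap)
qed

lemma C3a_has_derivative:
  assumes "C3a \<alpha> f"
  shows "(f has_real_derivative deriv f x) (at x)"
proof -
  have "((deriv ^^ 0) f has_real_derivative (deriv ^^ Suc 0) f x) (at x)"
    using assms unfolding C3a_def by (metis zero_less_numeral)
  then show ?thesis by simp
qed

lemma C3a_continuous: "C3a \<alpha> f \<Longrightarrow> continuous_on UNIV f"
  by (meson C3a_has_derivative DERIV_isCont continuous_at_imp_continuous_on)

lemma C3a_lipschitz:
  assumes "C3a \<alpha> f"
  obtains K where "\<And>x y. \<bar>f x - f y\<bar> \<le> K * \<bar>x - y\<bar>"
proof -
  have "bounded (range ((deriv ^^ 1) f))" using assms by (simp add: C3a_def del: funpow.simps One_nat_def)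
  then obtain K where "\<And>x. \<bar>deriv f x\<bar> \<le> K" by (auto simp: bounded_iff)
  then have "\<bar>f x - f y\<bar> \<le> K * \<bar>x - y\<bar>" for x y
    by (intro abs_diff_le_of_bounded_derivative[where S = UNIV and f' = "deriv f"] C3a_has_derivative[OF assms]) auto
  then show thesis by (rule that)
qed

context
  fixes \<alpha> :: real and f g :: "real \<Rightarrow> real"
  assumes C3a: "C3a \<alpha> f" "C3a \<alpha> g"
begin

lemma funpow_deriv_diff:
  "k \<le> 3 \<Longrightarrow> (deriv ^^ k) (\<lambda>x. f x - g x) = (\<lambda>x. (deriv ^^ k) f x - (deriv ^^ k) g x)"
proof (induction k)
  case (Suc k)
  then have "k < 3" by simp
  then have "((\<lambda>x. (deriv ^^ k) f x - (deriv ^^ k) g x) has_real_derivative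
      (deriv ^^ Suc k) f x - (deriv ^^ Suc k) g x) (at x)" for x
    using C3a unfolding C3a_def by (intro DERIV_diff) blast+
  then have "deriv (\<lambda>x. (deriv ^^ k) f x - (deriv ^^ k) g x) = (\<lambda>x. (deriv ^^ Suc k) f x - (deriv ^^ Suc k) g x)"
    by (intro ext DERIV_imp_deriv)
  then show ?case using Suc by simp
qed simp

lemma bdd_above_deriv_diff:
  assumes k: "k \<le> 3"
  shows "bdd_above (range (\<lambda>x. \<bar>(deriv ^^ k) (\<lambda>x. f x - g x) x\<bar>))"
proof -
  obtain A where A: "\<And>x. \<bar>(deriv ^^ k) f x\<bar> \<le> A" using C3a(1) k unfolding C3a_def bounded_iff by force
  obtain B where B: "\<And>x. \<bar>(deriv ^^ k) g x\<bar> \<le> B" using C3a(2) k unfolding C3a_def bounded_iff by force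
  have "\<bar>(deriv ^^ k) (\<lambda>x. f x - g x) x\<bar> \<le> A + B" for x
    using A[of x] B[of x] unfolding funpow_deriv_diff[OF k] by linarith
  then show ?thesis by (auto intro!: bdd_aboveI2)
qed

lemma bdd_above_holder_quotient_diff:
  "bdd_above ((\<lambda>xy. \<bar>(deriv ^^ 3) (\<lambda>x. f x - g x) (fst xy) - (deriv ^^ 3) (\<lambda>x. f x - g x) (snd xy)\<bar>
    / \<bar>fst xy - snd xy\<bar> powr \<alpha>) ` {xy. fst xy \<noteq> snd xy})"
proof -
  obtain A where A: "\<And>x y. \<bar>(deriv ^^ 3) f x - (deriv ^^ 3) f y\<bar> \<le> A * \<bar>x - y\<bar> powr \<alpha>" using C3a by (auto simp: C3a_def)
  obtain B where B: "\<And>x y. \<bar>(deriv ^^ 3) g x - (deriv ^^ 3) g y\<bar> \<le> B * \<bar>x - y\<bar> powr \<alpha>" using C3a by (auto simp: C3a_def)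
  show ?thesis
  proof (rule bdd_aboveI2[where M = "A + B"])
    fix xy :: "real \<times> real" assume "xy \<in> {xy. fst xy \<noteq> snd xy}"
    then have pos: "0 < \<bar>fst xy - snd xy\<bar> powr \<alpha>" by simp
    have "\<bar>(deriv ^^ 3) (\<lambda>x. f x - g x) (fst xy) - (deriv ^^ 3) (\<lambda>x. f x - g x) (snd xy)\<bar>
        \<le> (A + B) * \<bar>fst xy - snd xy\<bar> powr \<alpha>"
      using A[of "fst xy" "snd xy"] B[of "fst xy" "snd xy"] unfolding funpow_deriv_diff[OF order_refl] distrib_right by linarith
    then show "\<bar>(deriv ^^ 3) (\<lambda>x. f x - g x) (fst xy) - (deriv ^^ 3) (\<lambda>x. f x - g x) (snd xy)\<bar>
        / \<bar>fst xy - snd xy\<bar> powr \<alpha> \<le> A + B" using pos by (simp add: pos_divide_le_eq)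
  qed
qed

text \<open>The suprema in \<open>c3a_norm\<close> are meaningful only for bounded sets.\<close>

lemma abs_diff_le_c3a_norm: "\<bar>f x - g x\<bar> \<le> c3a_norm \<alpha> (\<lambda>x. f x - g x)"
proof -
  let ?h = "\<lambda>x. f x - g x"
  have sup_nonneg: "0 \<le> (SUP x. \<bar>(deriv ^^ k) ?h x\<bar>)" if "k \<le> 3" for k
    by (rule order_trans[OF _ cSUP_upper[OF _ bdd_above_deriv_diff[OF that], of 0]]) auto
  have holder_nonneg: "0 \<le> (SUP xy \<in> {xy. fst xy \<noteq> snd xy}.
      \<bar>(deriv ^^ 3) ?h (fst xy) - (deriv ^^ 3) ?h (snd xy)\<bar> / \<bar>fst xy - snd xy\<bar> powr \<alpha>)"
    by (rule order_trans[OF _ cSUP_upper[OF _ bdd_above_holder_quotient_diff, of "(0, 1)"]]) auto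
  have "\<bar>?h x\<bar> \<le> (SUP x. \<bar>(deriv ^^ 0) ?h x\<bar>)"
    using cSUP_upper[OF UNIV_I bdd_above_deriv_diff[of 0], of x] by simp
  also have "\<dots> \<le> (\<Sum>k\<le>3. (SUP x. \<bar>(deriv ^^ k) ?h x\<bar>))"
    by (rule member_le_sum[of 0 "{..3::nat}" "\<lambda>k. SUP x. \<bar>(deriv ^^ k) ?h x\<bar>"]) (use sup_nonneg in auto)
  also have "\<dots> \<le> c3a_norm \<alpha> ?h" unfolding c3a_norm_def using holder_nonneg by simp
  finally show ?thesis .
qed

end

lemma le_of_eventually_le:
  fixes F G :: "real \<Rightarrow> real"
  assumes "continuous_on UNIV F" "continuous_on UNIV G" "\<forall>\<^sub>F a' in at a. F a' \<le> G a'"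
  shows "F a \<le> G a"
  using assms by (intro tendsto_le[of "at a" G "G a" F "F a"]) (auto simp: continuous_on_def)

lemma continuous_on_of_dense:
  fixes F :: "'a::topological_space \<Rightarrow> 'b::metric_space"
  assumes X: "X \<subseteq> closure D"
    and close: "\<And>p e. p \<in> X \<Longrightarrow> 0 < e \<Longrightarrow> \<forall>\<^sub>F q in nhds p. q \<in> D \<longrightarrow> dist (F q) (F p) < e"
  shows "continuous_on X F"
  unfolding continuous_on_def
proof (intro ballI tendstoI)
  fix p and e :: real assume p: "p \<in> X" and "0 < e"
  then have e: "0 < e / 2" by simp
  obtain S where S: "open S" "p \<in> S" "\<And>q. q \<in> S \<Longrightarrow> q \<in> D \<Longrightarrow> dist (F q) (F p) < e / 2"
    using close[OF p e] unfolding eventually_nhds by blast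
  have "dist (F q) (F p) < e" if q: "q \<in> S \<inter> X" for q
  proof -
    obtain T where T: "open T" "q \<in> T" "\<And>q'. q' \<in> T \<Longrightarrow> q' \<in> D \<Longrightarrow> dist (F q') (F q) < e / 2"
      using close[of q, OF _ e] q unfolding eventually_nhds by blast
    have "S \<inter> T \<inter> D \<noteq> {}"
      using q X T S(1) open_Int_closure_eq_empty[of "S \<inter> T" D] by blast
    then obtain q' where "q' \<in> S" "q' \<in> T" "q' \<in> D" by blast
    then have "dist (F q') (F p) < e / 2" "dist (F q') (F q) < e / 2" using S(3) T(3) by auto
    then show ?thesis by (metis dist_triangle_half_l dist_commute)
  qed
  then show "\<forall>\<^sub>F q in at p within X. dist (F q) (F p) < e"
    unfolding eventually_at_topological using S(1,2) by blast
qed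

section \<open>The family of solutions\<close>

lemma rad_ratio_defect:
  assumes a: "a \<noteq> 0"
  shows "\<bar>1 - rad b t y / rad a t y\<bar> \<le> \<bar>a - b\<bar> / \<bar>a\<bar>"
proof -
  have pos: "0 < rad a t y" by (rule rad_pos[OF a])
  then have "1 - rad b t y / rad a t y = (rad a t y - rad b t y) / rad a t y" by (simp add: field_simps)
  then have "\<bar>1 - rad b t y / rad a t y\<bar> = \<bar>rad a t y - rad b t y\<bar> / rad a t y" using pos by simp
  also have "\<dots> \<le> \<bar>a - b\<bar> / \<bar>a\<bar>"
    using rad_lipschitz_parameter[of a t y b] abs_le_rad[of a t y] a by (intro frac_le) auto
  finally show ?thesis .
qed

lemma uniform_limit_of_c3a_norm:
  fixes f :: "real \<Rightarrow> real \<Rightarrow> real \<Rightarrow> real"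
  assumes C3a: "\<And>a b. C3a \<alpha> (f a b)"
    and cont: "\<And>e. 0 < e \<Longrightarrow> \<exists>d>0. \<forall>a' b'. dist (a', b') (a, b) < d \<longrightarrow> c3a_norm \<alpha> (\<lambda>x. f a' b' x - f a b x) < e"
  shows "uniform_limit UNIV (\<lambda>z. f (fst z) (snd z)) (f a b) (nhds (a, b))"
proof (rule uniform_limitI)
  fix e :: real assume "0 < e"
  then obtain d where d: "0 < d" "\<And>a' b'. dist (a', b') (a, b) < d \<Longrightarrow> c3a_norm \<alpha> (\<lambda>x. f a' b' x - f a b x) < e"
    using cont by blast
  have "\<bar>f (fst z) (snd z) x - f a b x\<bar> < e" if "dist z (a, b) < d" for z x
    using abs_diff_le_c3a_norm[OF C3a C3a, of "fst z" "snd z" x a b] d(2)[of "fst z" "snd z"] that by simp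
  then show "\<forall>\<^sub>F z in nhds (a, b). \<forall>x\<in>UNIV. dist (f (fst z) (snd z) x) (f a b x) < e"
    unfolding eventually_nhds_metric dist_real_def using d(1) by blast
qed

locale sl_family =
  fixes R P \<alpha> :: real
    and \<phi>p \<phi>m :: "real \<Rightarrow> real \<Rightarrow> real \<Rightarrow> real"
    and u v :: "real \<Rightarrow> real \<Rightarrow> real \<times> real \<Rightarrow> real"
  assumes R_pos: "R > 0" and P_pos: "P > 0"
    and reg: "\<And>a b. C3a \<alpha> (\<phi>p a b) \<and> C3a \<alpha> (\<phi>m a b)"
    and cont_p: "\<And>a b e. e > 0 \<Longrightarrow> \<exists>d>0. \<forall>a' b'. dist (a', b') (a, b) < d \<longrightarrow>
                   c3a_norm \<alpha> (\<lambda>x. \<phi>p a' b' x - \<phi>p a b x) < e"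
    and cont_m: "\<And>a b e. e > 0 \<Longrightarrow> \<exists>d>0. \<forall>a' b'. dist (a', b') (a, b) < d \<longrightarrow>
                   c3a_norm \<alpha> (\<lambda>x. \<phi>m a' b' x - \<phi>m a b x) < e"
    and per: "\<And>a b x. \<phi>p a b (x + P) = \<phi>p a b x \<and> \<phi>m a b (x + P) = \<phi>m a b x"
    and mono: "\<And>a b b' x. b < b' \<Longrightarrow> \<phi>p a b x < \<phi>p a b' x \<and> \<phi>m a b x < \<phi>m a b' x"
    and lim_p: "\<And>a x. filterlim (\<lambda>b. \<phi>p a b x) at_top at_top \<and>
                        filterlim (\<lambda>b. \<phi>p a b x) at_bot at_bot"
    and lim_m: "\<And>a x. filterlim (\<lambda>b. \<phi>m a b x) at_top at_top \<and>
                        filterlim (\<lambda>b. \<phi>m a b x) at_bot at_bot"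
    and sol: "\<And>a b. assoc_sol R P \<alpha> a (\<phi>p a b) (\<phi>m a b) (u a b) (v a b)"
begin

lemma periodic_uv:
  assumes "\<bar>y\<bar> \<le> R"
  shows "u a b (x + P, y) = u a b (x, y) \<and> v a b (x + P, y) = v a b (x, y)"
proof -
  have "(x, y) \<in> strip R" using assms by (simp add: strip_def)
  then show ?thesis using sol[of a b] unfolding assoc_sol_def by fastforce
qed

lemma u_origin: "u a b (0, 0) = 0"
  using sol[of a b] by (simp add: assoc_sol_def)

lemma v_edge: "v a b (x, R) = \<phi>p a b x" "v a b (x, -R) = \<phi>m a b x"
  using sol[of a b] by (simp_all add: assoc_sol_def)

lemma regular:
  assumes "a \<noteq> 0"
  shows "Ck_strip R 2 (u a b)" "Ck_strip R 2 (v a b)" "dagger_on_strip R a (u a b) (v a b)"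
proof -
  have "Ck_strip R 3 (u a b)" "Ck_strip R 3 (v a b)" "dagger_on_strip R a (u a b) (v a b)"
    using sol[of a b] assms by (auto simp: assoc_sol_def Cka_strip_def)
  then show "Ck_strip R 2 (u a b)" "Ck_strip R 2 (v a b)" "dagger_on_strip R a (u a b) (v a b)"
    by (auto simp: Ck_strip_def)
qed

lemma continuous_strip: "continuous_on (strip R) (u a b)" "continuous_on (strip R) (v a b)"
proof -
  have "continuous_on (strip R) f" if "Ck_strip R 2 f" for f
    using Ck_strip_continuous[OF that, of "[]"] by simp
  then show "continuous_on (strip R) (u a b)" "continuous_on (strip R) (v a b)"
    using sol[of a b] regular[of a b] by (cases "a = 0"; auto simp: assoc_sol_def singular_sol_def)+
qed

lemma periodic_solution_uv:
  assumes "a \<noteq> 0" shows "periodic_solution R P a (u a b) (v a b)"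
  using dagger_on_strip_imp_dagger_C2[OF regular[OF assms]] continuous_strip periodic_uv
  unfolding periodic_solution_def by blast

lemma \<phi>_continuous: "continuous_on UNIV (\<phi>p a b)" "continuous_on UNIV (\<phi>m a b)"
  using reg C3a_continuous by blast+

lemma \<phi>_uniform_limit:
  "uniform_limit UNIV (\<lambda>z. \<phi>p (fst z) (snd z)) (\<phi>p a b) (nhds (a, b))"
  "uniform_limit UNIV (\<lambda>z. \<phi>m (fst z) (snd z)) (\<phi>m a b) (nhds (a, b))"
  by (rule uniform_limit_of_c3a_norm[where \<alpha> = \<alpha>]; use reg cont_p cont_m in blast)+

lemma \<phi>_uniform_limit_at:
  "uniform_limit UNIV (\<lambda>a. \<phi>p a b) (\<phi>p a b) (at a)" "uniform_limit UNIV (\<lambda>a. \<phi>m a b) (\<phi>m a b) (at a)"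
proof -
  have "((\<lambda>a. (a, b)) \<longlongrightarrow> (a, b)) (at a)" by (intro tendsto_intros)
  from filterlim_compose[OF \<phi>_uniform_limit(1) this] filterlim_compose[OF \<phi>_uniform_limit(2) this]
  show "uniform_limit UNIV (\<lambda>a. \<phi>p a b) (\<phi>p a b) (at a)" "uniform_limit UNIV (\<lambda>a. \<phi>m a b) (\<phi>m a b) (at a)"
    by simp_all
qed

lemma exists_\<phi>_close:
  assumes "0 < e"
  shows "\<exists>d>0. \<forall>a b x. \<bar>a - a0\<bar> < d \<longrightarrow> \<bar>b - b0\<bar> < d \<longrightarrow>
    \<bar>\<phi>p a b x - \<phi>p a0 b0 x\<bar> < e \<and> \<bar>\<phi>m a b x - \<phi>m a0 b0 x\<bar> < e"
proof -
  from uniform_limitD[OF \<phi>_uniform_limit(1) assms, of a0 b0] uniform_limitD[OF \<phi>_uniform_limit(2) assms, of a0 b0]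
  have "\<forall>\<^sub>F z in nhds (a0, b0). \<forall>x. \<bar>\<phi>p (fst z) (snd z) x - \<phi>p a0 b0 x\<bar> < e \<and> \<bar>\<phi>m (fst z) (snd z) x - \<phi>m a0 b0 x\<bar> < e"
    by eventually_elim (simp add: dist_real_def)
  then obtain d where d: "0 < d" "\<And>a b x. dist (a, b) (a0, b0) < d \<Longrightarrow>
      \<bar>\<phi>p a b x - \<phi>p a0 b0 x\<bar> < e \<and> \<bar>\<phi>m a b x - \<phi>m a0 b0 x\<bar> < e"
    unfolding eventually_nhds_metric by auto
  have "dist (a, b) (a0, b0) < d" if "\<bar>a - a0\<bar> < d / 2" "\<bar>b - b0\<bar> < d / 2" for a b
    using sqrt_sum_squares_le_sum_abs[of "a - a0" "b - b0"] that by (simp add: dist_Pair_Pair dist_real_def)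
  then show ?thesis using d by (intro exI[of _ "d / 2"]) simp
qed

lemma v_bounded: "\<exists>M>0. \<forall>z\<in>strip R. \<bar>v a b z\<bar> \<le> M"
proof -
  have "continuous_on ({0..P} \<times> {-R..R}) (v a b)"
    by (rule continuous_on_subset[OF continuous_strip(2)]) (auto simp: strip_def)
  then have "bounded (v a b ` ({0..P} \<times> {-R..R}))"
    by (intro compact_imp_bounded compact_continuous_image) (auto simp: compact_Times)
  then obtain M where M: "M > 0" "\<And>z. z \<in> {0..P} \<times> {-R..R} \<Longrightarrow> \<bar>v a b z\<bar> \<le> M" by (auto simp: bounded_pos)
  have "\<bar>v a b (x, y)\<bar> \<le> M" if y: "\<bar>y\<bar> \<le> R" for x y
  proof -
    obtain x' where "x' \<in> {0..P}" "v a b (x', y) = v a b (x, y)"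
      by (rule periodic_value_in_period[OF P_pos, where f = "\<lambda>x. v a b (x, y)" and x = x]) (use periodic_uv[OF y] in auto)
    moreover from this have "(x', y) \<in> {0..P} \<times> {-R..R}" using y by (auto simp: abs_le_iff)
    ultimately show ?thesis using M(2)[of "(x', y)"] by simp
  qed
  then show ?thesis using M(1) by (auto simp: strip_def)
qed

lemma v_le_const_nonzero:
  assumes "a \<noteq> 0" "\<bar>y\<bar> < R" "\<And>x. \<phi>p a b x < c \<and> \<phi>m a b x < c"
  shows "v a b (x, y) \<le> c"
  using periodic_solution_comparison[OF periodic_solution_uv periodic_solution_const, of a b c y x] assms P_pos
  by (simp add: v_edge)

lemma v_ge_const_nonzero:
  assumes "a \<noteq> 0" "\<bar>y\<bar> < R" "\<And>x. c < \<phi>p a b x \<and> c < \<phi>m a b x"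
  shows "c \<le> v a b (x, y)"
  using periodic_solution_comparison[OF periodic_solution_const periodic_solution_uv, of a c b y x] assms P_pos
  by (simp add: v_edge)

lemma v_order_translated_nonzero:
  assumes "a \<noteq> 0" "\<bar>y\<bar> < R" "\<And>x. \<phi>p a b x < \<phi>p a b' (x + t) \<and> \<phi>m a b x < \<phi>m a b' (x + t)"
  shows "v a b (x, y) \<le> v a b' (x + t, y)"
proof -
  have "v a b (x, y) \<le> (\<lambda>z. v a b' (fst z + t, snd z)) (x, y)"
    by (rule periodic_solution_comparison[OF periodic_solution_uv periodic_solution_translate[OF periodic_solution_uv]])
      (use assms P_pos in \<open>simp_all add: v_edge\<close>)
  then show ?thesis by simp
qed

lemma abs_v_le_of_close_edges:
  assumes "a \<noteq> 0" "\<bar>y\<bar> < R" and M: "\<And>z. z \<in> strip R \<Longrightarrow> \<bar>v a0 b0 z\<bar> \<le> M"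
    and close: "\<And>x. \<bar>\<phi>p a b x - \<phi>p a0 b0 x\<bar> < 1 \<and> \<bar>\<phi>m a b x - \<phi>m a0 b0 x\<bar> < 1"
  shows "\<bar>v a b (x, y)\<bar> \<le> M + 1"
proof -
  have edges: "\<phi>p a b x < M + 1 \<and> \<phi>m a b x < M + 1 \<and> - (M + 1) < \<phi>p a b x \<and> - (M + 1) < \<phi>m a b x" for x
  proof -
    have "\<bar>\<phi>p a0 b0 x\<bar> \<le> M" "\<bar>\<phi>m a0 b0 x\<bar> \<le> M"
      using M[of "(x, R)"] M[of "(x, -R)"] R_pos by (simp_all add: v_edge strip_def)
    then show ?thesis using close[of x] by linarith
  qed
  have "v a b (x, y) \<le> M + 1" by (rule v_le_const_nonzero[OF assms(1,2)]) (use edges in blast)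
  moreover have "- (M + 1) \<le> v a b (x, y)" by (rule v_ge_const_nonzero[OF assms(1,2)]) (use edges in blast)
  ultimately show ?thesis by simp
qed

lemma exists_nearby_solutions:
  assumes a: "a \<noteq> 0" and UV: "dagger_C1 R b' U V pU qU" and cont_V: "continuous_on (strip R) V"
    and L: "0 < L" and R1: "0 < R1" "R1 < R"
    and bounds: "\<And>x y. \<bar>y\<bar> < R \<Longrightarrow> \<bar>v a b (x, y)\<bar> \<le> M \<and> \<bar>V (x, y)\<bar> \<le> M"
    and edges: "\<And>x. \<bar>\<phi>p a b x - V (x, R)\<bar> < \<epsilon> \<and> \<bar>\<phi>m a b x - V (x, - R)\<bar> < \<epsilon>"
    and defect: "\<And>x y. x \<in> {-L..L} \<Longrightarrow> \<bar>y\<bar> < R \<Longrightarrow>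
      \<bar>qU (x, y) * (1 - rad b' (V (x, y)) y / rad a (V (x, y)) y)\<bar> \<le> \<epsilon>"
  shows "\<exists>p q r s R'. R1 < R' \<and> bounded_periodic_dagger_C2 R a (u a b) (v a b) p q r s P M \<and>
    nearby_solutions R a (u a b) (v a b) p q b' U V pU qU M L R' \<epsilon>"
proof -
  obtain p q r s where C2: "dagger_C2 R a (u a b) (v a b) p q r s"
    using periodic_solution_uv[OF a, of b] by (auto simp: periodic_solution_def)
  then have C1: "dagger_C1 R a (u a b) (v a b) p q" by (simp add: dagger_C2_def)
  have "continuous_on (strip R) (\<lambda>z. \<bar>v a b z - V z\<bar>)" by (intro continuous_intros continuous_strip cont_V)
  from exists_line_near_edges[OF this compact_Icc[of "-L" L] R1, of \<epsilon>]
  obtain R' where R': "R1 < R'" "R' < R"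
    "\<And>x. x \<in> {-L..L} \<Longrightarrow> \<bar>v a b (x, R') - V (x, R')\<bar> < \<epsilon> \<and> \<bar>v a b (x, - R') - V (x, - R')\<bar> < \<epsilon>"
    using edges unfolding v_edge by blast
  have "bounded_periodic_dagger_C2 R a (u a b) (v a b) p q r s P M"
    using C2 a P_pos periodic_uv bounds by (simp add: bounded_periodic_dagger_C2_def bounded_periodic_dagger_C2_axioms_def)
  moreover have "nearby_solutions R a (u a b) (v a b) p q b' U V pU qU M L R' \<epsilon>"
  proof (rule nearby_solutions.intro[OF C1 UV], unfold_locales)
    show "\<bar>v a b (x, R') - V (x, R')\<bar> \<le> \<epsilon> \<and> \<bar>v a b (x, - R') - V (x, - R')\<bar> \<le> \<epsilon>" if "x \<in> {-L..L}" for x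
      using R'(3)[OF that] by linarith
    show "\<bar>qU (x, y) * (1 - rad b' (V (x, y)) y / rad a (V (x, y)) y)\<bar> \<le> \<epsilon>"
      if "x \<in> {-L..L}" "y \<in> {-R'..R'}" for x y
      by (rule defect) (use that R' in auto)
  qed (use a L R1 R' bounds in simp_all)
  ultimately show ?thesis using R'(1) by blast
qed

lemma close_to_given_solution:
  assumes a: "a \<noteq> 0" and M: "\<And>z. z \<in> strip R \<Longrightarrow> \<bar>v a0 b0 z\<bar> \<le> M" and \<epsilon>: "\<epsilon> \<le> 1"
    and \<phi>_close: "\<And>x. \<bar>\<phi>p a b x - \<phi>p a0 b0 x\<bar> < \<epsilon> \<and> \<bar>\<phi>m a b x - \<phi>m a0 b0 x\<bar> < \<epsilon>"
    and close: "\<And>z. z \<in> strip R \<Longrightarrow> \<bar>V z - v a0 b0 z\<bar> < \<epsilon>"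
  shows "\<bar>y\<bar> < R \<Longrightarrow> \<bar>v a b (x, y)\<bar> \<le> M + 1 \<and> \<bar>V (x, y)\<bar> \<le> M + 1"
    and "\<bar>\<phi>p a b x - V (x, R)\<bar> < 2 * \<epsilon> \<and> \<bar>\<phi>m a b x - V (x, - R)\<bar> < 2 * \<epsilon>"
proof -
  assume y: "\<bar>y\<bar> < R"
  have "\<bar>v a b (x, y)\<bar> \<le> M + 1"
  proof (rule abs_v_le_of_close_edges[OF a y M])
    show "\<bar>\<phi>p a b x - \<phi>p a0 b0 x\<bar> < 1 \<and> \<bar>\<phi>m a b x - \<phi>m a0 b0 x\<bar> < 1" for x
      using \<phi>_close[of x] \<epsilon> by linarith
  qed
  moreover have "(x, y) \<in> strip R" using y by (simp add: strip_def)
  ultimately show "\<bar>v a b (x, y)\<bar> \<le> M + 1 \<and> \<bar>V (x, y)\<bar> \<le> M + 1"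
    using close[of "(x, y)"] M[of "(x, y)"] \<epsilon> by linarith
next
  have "(x, R) \<in> strip R" "(x, - R) \<in> strip R" using R_pos by (auto simp: strip_def)
  then have "\<bar>V (x, R) - \<phi>p a0 b0 x\<bar> < \<epsilon>" "\<bar>V (x, - R) - \<phi>m a0 b0 x\<bar> < \<epsilon>"
    unfolding v_edge[symmetric] by (simp_all only: close)
  then show "\<bar>\<phi>p a b x - V (x, R)\<bar> < 2 * \<epsilon> \<and> \<bar>\<phi>m a b x - V (x, - R)\<bar> < 2 * \<epsilon>"
    using \<phi>_close[of x] by linarith
qed

definition controlled_by_regular_solutions :: "real \<Rightarrow> real \<Rightarrow> real \<Rightarrow> real \<Rightarrow> real \<Rightarrow> real \<Rightarrow> real \<Rightarrow> real \<Rightarrow> bool" where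
  "controlled_by_regular_solutions a0 b0 x0 y0 \<eta> L \<epsilon> d \<longleftrightarrow>
    (\<forall>a b b' U V pU qU x y. a \<noteq> 0 \<longrightarrow> \<bar>a - a0\<bar> < d \<longrightarrow> \<bar>b - b0\<bar> < d \<longrightarrow>
    dagger_C1 R b' U V pU qU \<longrightarrow> continuous_on (strip R) V \<longrightarrow>
    (\<forall>z\<in>strip R. \<bar>U z - u a0 b0 z\<bar> < \<epsilon> \<and> \<bar>V z - v a0 b0 z\<bar> < \<epsilon>) \<longrightarrow>
    (\<forall>x y. x \<in> {-L..L} \<longrightarrow> \<bar>y\<bar> < R \<longrightarrow> \<bar>qU (x, y) * (1 - rad b' (V (x, y)) y / rad a (V (x, y)) y)\<bar> \<le> \<epsilon>) \<longrightarrow>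
    \<bar>x - x0\<bar> < d \<longrightarrow> \<bar>y - y0\<bar> < d \<longrightarrow>
    \<bar>v a b (x, y) - v a0 b0 (x0, y0)\<bar> < \<eta> \<and> \<bar>u a b (x, y) - u a0 b0 (x0, y0)\<bar> < \<eta>)"

lemma exists_controlled_by_regular_solutions:
  assumes y0: "\<bar>y0\<bar> < R" and \<eta>: "0 < \<eta>"
  shows "\<exists>L \<epsilon> d. 0 < \<epsilon> \<and> 0 < d \<and> controlled_by_regular_solutions a0 b0 x0 y0 \<eta> L \<epsilon> d"
proof -
  obtain M where M: "0 < M" "\<And>z. z \<in> strip R \<Longrightarrow> \<bar>v a0 b0 z\<bar> \<le> M" using v_bounded by blast
  have M_nonneg: "0 \<le> M + 1" using M(1) by simp
  note cont0 = continuous_strip[THEN continuous_on_subset, OF open_strip_subset_strip, of a0 b0]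
  obtain L \<epsilon>0 R1 d0 where L: "0 < L" and \<epsilon>0: "0 < \<epsilon>0" and R1: "0 < R1" "R1 < R" and d0: "0 < d0"
    and controlled: "controlled_by_nearby_solutions R P (\<bar>a0\<bar> + 1) (M + 1) (u a0 b0) (v a0 b0) x0 y0 \<eta> L \<epsilon>0 R1 d0"
    using exists_controlled_by_nearby_solutions[OF R_pos P_pos M_nonneg y0 \<eta> cont0 u_origin] by blast
  define \<epsilon> where "\<epsilon> = min (\<epsilon>0 / 2) 1"
  have \<epsilon>: "0 < \<epsilon>" "2 * \<epsilon> \<le> \<epsilon>0" "\<epsilon> \<le> 1" using \<epsilon>0 by (auto simp: \<epsilon>_def)
  obtain d1 where d1: "0 < d1" "\<And>a b x. \<bar>a - a0\<bar> < d1 \<Longrightarrow> \<bar>b - b0\<bar> < d1 \<Longrightarrow>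
      \<bar>\<phi>p a b x - \<phi>p a0 b0 x\<bar> < \<epsilon> \<and> \<bar>\<phi>m a b x - \<phi>m a0 b0 x\<bar> < \<epsilon>"
    using exists_\<phi>_close[OF \<epsilon>(1)] by blast
  define d where "d = Min {d0, d1, 1}"
  have d: "0 < d" "d \<le> d0" "d \<le> d1" "d \<le> 1" using d0 d1(1) by (auto simp: d_def)
  have "controlled_by_regular_solutions a0 b0 x0 y0 \<eta> L \<epsilon> d"
    unfolding controlled_by_regular_solutions_def
  proof (intro allI impI)
    fix a b b' U V pU qU x y
    assume a: "a \<noteq> 0" "\<bar>a - a0\<bar> < d" and b: "\<bar>b - b0\<bar> < d" and UV: "dagger_C1 R b' U V pU qU" and cont_V: "continuous_on (strip R) V"
      and close: "\<forall>z\<in>strip R. \<bar>U z - u a0 b0 z\<bar> < \<epsilon> \<and> \<bar>V z - v a0 b0 z\<bar> < \<epsilon>"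
      and defect: "\<forall>x y. x \<in> {-L..L} \<longrightarrow> \<bar>y\<bar> < R \<longrightarrow> \<bar>qU (x, y) * (1 - rad b' (V (x, y)) y / rad a (V (x, y)) y)\<bar> \<le> \<epsilon>"
      and xy: "\<bar>x - x0\<bar> < d" "\<bar>y - y0\<bar> < d"
    have \<phi>_close: "\<bar>\<phi>p a b x - \<phi>p a0 b0 x\<bar> < \<epsilon> \<and> \<bar>\<phi>m a b x - \<phi>m a0 b0 x\<bar> < \<epsilon>" for x
      using d1(2)[of a b x] a(2) b d(3) by linarith
    have V_close: "\<bar>V z - v a0 b0 z\<bar> < \<epsilon>" if "z \<in> strip R" for z using close that by blast
    note bounds = close_to_given_solution(1)[OF a(1) M(2) \<epsilon>(3) \<phi>_close V_close]
    have edges: "\<bar>\<phi>p a b x - V (x, R)\<bar> < \<epsilon>0 \<and> \<bar>\<phi>m a b x - V (x, - R)\<bar> < \<epsilon>0" for x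
      using close_to_given_solution(2)[OF a(1) M(2) \<epsilon>(3) \<phi>_close V_close, of x] \<epsilon>(2) by linarith
    have defect': "\<bar>qU (x, y) * (1 - rad b' (V (x, y)) y / rad a (V (x, y)) y)\<bar> \<le> \<epsilon>0" if "x \<in> {-L..L}" "\<bar>y\<bar> < R" for x y
      using defect[rule_format, OF that] \<epsilon>(1,2) by linarith
    obtain p q r s R' where R': "R1 < R'" and S: "bounded_periodic_dagger_C2 R a (u a b) (v a b) p q r s P (M + 1)"
      and N: "nearby_solutions R a (u a b) (v a b) p q b' U V pU qU (M + 1) L R' \<epsilon>0"
      using exists_nearby_solutions[OF a(1) UV cont_V L R1 bounds edges defect'] by blast
    have UV_close: "\<bar>U z - u a0 b0 z\<bar> \<le> \<epsilon>0 \<and> \<bar>V z - v a0 b0 z\<bar> \<le> \<epsilon>0" if "z \<in> {-L..L} \<times> {-R1..R1}" for z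
    proof -
      have "z \<in> strip R" using that R1 by (auto simp: strip_def)
      then have "\<bar>U z - u a0 b0 z\<bar> < \<epsilon>" "\<bar>V z - v a0 b0 z\<bar> < \<epsilon>" using close by auto
      then show "\<bar>U z - u a0 b0 z\<bar> \<le> \<epsilon>0 \<and> \<bar>V z - v a0 b0 z\<bar> \<le> \<epsilon>0" using \<epsilon> by linarith
    qed
    have ranges: "\<bar>a\<bar> \<le> \<bar>a0\<bar> + 1" "\<bar>x - x0\<bar> \<le> d0" "\<bar>y - y0\<bar> \<le> d0" using a(2) xy d by linarith+
    show "\<bar>v a b (x, y) - v a0 b0 (x0, y0)\<bar> < \<eta> \<and> \<bar>u a b (x, y) - u a0 b0 (x0, y0)\<bar> < \<eta>"
      by (rule controlled[unfolded controlled_by_nearby_solutions_def, rule_format, OF S ranges(1) u_origin R' N UV_close ranges(2,3)])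
  qed
  then show ?thesis using \<epsilon>(1) d(1) by blast
qed

lemma convergence_at_nonzero:
  assumes a0: "a0 \<noteq> 0" and y0: "\<bar>y0\<bar> < R" and \<eta>: "0 < \<eta>"
  shows "\<exists>d>0. \<forall>a b x y. a \<noteq> 0 \<longrightarrow> \<bar>a - a0\<bar> < d \<longrightarrow> \<bar>b - b0\<bar> < d \<longrightarrow> \<bar>x - x0\<bar> < d \<longrightarrow> \<bar>y - y0\<bar> < d \<longrightarrow>
    \<bar>v a b (x, y) - v a0 b0 (x0, y0)\<bar> < \<eta> \<and> \<bar>u a b (x, y) - u a0 b0 (x0, y0)\<bar> < \<eta>"
proof -
  obtain L \<epsilon> d0 where \<epsilon>: "0 < \<epsilon>" and d0: "0 < d0" and "controlled_by_regular_solutions a0 b0 x0 y0 \<eta> L \<epsilon> d0"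
    using exists_controlled_by_regular_solutions[OF y0 \<eta>] by blast
  note controls = this(3)[unfolded controlled_by_regular_solutions_def, rule_format]
  let ?q = "pyS R (u a0 b0)"
  have C1: "dagger_C1 R a0 (u a0 b0) (v a0 b0) (px (u a0 b0)) ?q"
    using dagger_on_strip_imp_dagger_C2[OF regular[OF a0, of b0]] by (simp add: dagger_C2_def)
  have "continuous_on (strip R) ?q" using Ck_strip_continuous[OF regular(1)[OF a0], of "[True]" b0] by simp
  then have "continuous_on ({-L..L} \<times> {-R..R}) ?q" by (rule continuous_on_subset) (auto simp: strip_def)
  then have "bounded (?q ` ({-L..L} \<times> {-R..R}))"
    by (intro compact_imp_bounded compact_continuous_image) (auto simp: compact_Times)
  then obtain K where K: "0 < K" "\<And>z. z \<in> {-L..L} \<times> {-R..R} \<Longrightarrow> \<bar>?q z\<bar> \<le> K" by (auto simp: bounded_pos)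
  define d where "d = Min {d0, \<bar>a0\<bar> / 2, \<epsilon> * \<bar>a0\<bar> / (2 * K)}"
  have d: "0 < d" "d \<le> d0" "d \<le> \<bar>a0\<bar> / 2" "d \<le> \<epsilon> * \<bar>a0\<bar> / (2 * K)"
    using d0 a0 \<epsilon> K(1) by (auto simp: d_def)
  have defect: "\<bar>?q (x, y) * (1 - rad a0 (v a0 b0 (x, y)) y / rad a (v a0 b0 (x, y)) y)\<bar> \<le> \<epsilon>"
    if "a \<noteq> 0" "\<bar>a - a0\<bar> < d" "x \<in> {-L..L}" "\<bar>y\<bar> < R" for a x y
  proof -
    have "\<bar>a0\<bar> / 2 \<le> \<bar>a\<bar>" using that(2) d(3) by linarith
    then have "\<bar>a - a0\<bar> / \<bar>a\<bar> \<le> d / (\<bar>a0\<bar> / 2)" using that(2) a0 d(1) by (intro frac_le) auto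
    then have "\<bar>1 - rad a0 (v a0 b0 (x, y)) y / rad a (v a0 b0 (x, y)) y\<bar> \<le> d / (\<bar>a0\<bar> / 2)"
      using rad_ratio_defect[OF that(1), of a0 "v a0 b0 (x, y)" y] by linarith
    moreover have "\<bar>?q (x, y)\<bar> \<le> K" by (rule K(2)) (use that in auto)
    ultimately have "\<bar>?q (x, y) * (1 - rad a0 (v a0 b0 (x, y)) y / rad a (v a0 b0 (x, y)) y)\<bar> \<le> K * (d / (\<bar>a0\<bar> / 2))"
      unfolding abs_mult using K(1) by (intro mult_mono) auto
    also have "\<dots> \<le> \<epsilon>" using d(4) K(1) a0 by (simp add: field_simps)
    finally show ?thesis .
  qed
  show ?thesis
  proof (intro exI[of _ d] conjI d(1) allI impI)
    fix a b x y assume a: "a \<noteq> 0" "\<bar>a - a0\<bar> < d" and "\<bar>b - b0\<bar> < d" "\<bar>x - x0\<bar> < d" "\<bar>y - y0\<bar> < d"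
    then have ranges: "\<bar>a - a0\<bar> < d0" "\<bar>b - b0\<bar> < d0" "\<bar>x - x0\<bar> < d0" "\<bar>y - y0\<bar> < d0" using d(2) by linarith+
    show "\<bar>v a b (x, y) - v a0 b0 (x0, y0)\<bar> < \<eta>" "\<bar>u a b (x, y) - u a0 b0 (x0, y0)\<bar> < \<eta>"
      using controls[OF a(1) ranges(1,2) C1 continuous_strip(2) _ defect[OF a] ranges(3,4)] \<epsilon> by simp_all
  qed
qed

lemma convergence_at_zero:
  assumes y0: "\<bar>y0\<bar> < R" and \<eta>: "0 < \<eta>"
  shows "\<exists>d>0. \<forall>a b x y. a \<noteq> 0 \<longrightarrow> \<bar>a\<bar> < d \<longrightarrow> \<bar>b - b0\<bar> < d \<longrightarrow> \<bar>x - x0\<bar> < d \<longrightarrow> \<bar>y - y0\<bar> < d \<longrightarrow>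
    \<bar>v a b (x, y) - v 0 b0 (x0, y0)\<bar> < \<eta> \<and> \<bar>u a b (x, y) - u 0 b0 (x0, y0)\<bar> < \<eta>"
proof -
  obtain L \<epsilon> d0 where \<epsilon>: "0 < \<epsilon>" and d0: "0 < d0" and "controlled_by_regular_solutions 0 b0 x0 y0 \<eta> L \<epsilon> d0"
    using exists_controlled_by_regular_solutions[OF y0 \<eta>] by blast
  note controls = this(3)[unfolded controlled_by_regular_solutions_def, rule_format]
  have "singular_sol R (u 0 b0) (v 0 b0)" using sol[of 0 b0] by (simp add: assoc_sol_def)
  then obtain U V where UV: "\<And>b. b > 0 \<Longrightarrow> Ck_strip R 2 (U b) \<and> Ck_strip R 2 (V b) \<and> dagger_on_strip R b (U b) (V b)"
    and limits: "uniform_limit (strip R) U (u 0 b0) (at_right 0)" "uniform_limit (strip R) V (v 0 b0) (at_right 0)"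
    unfolding singular_sol_def by blast
  have "\<forall>\<^sub>F b in at_right 0. \<forall>z\<in>strip R. \<bar>U b z - u 0 b0 z\<bar> < \<epsilon> \<and> \<bar>V b z - v 0 b0 z\<bar> < \<epsilon>"
    using uniform_limitD[OF limits(1) \<epsilon>] uniform_limitD[OF limits(2) \<epsilon>] by eventually_elim (auto simp: dist_real_def)
  then obtain d1 where d1: "0 < d1"
    "\<And>b. 0 < b \<Longrightarrow> b < d1 \<Longrightarrow> \<forall>z\<in>strip R. \<bar>U b z - u 0 b0 z\<bar> < \<epsilon> \<and> \<bar>V b z - v 0 b0 z\<bar> < \<epsilon>"
    unfolding eventually_at_right_field by blast
  show ?thesis
  proof (intro exI[of _ "min d0 d1"] conjI allI impI)
    fix a b x y assume a: "a \<noteq> 0" "\<bar>a\<bar> < min d0 d1"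
      and ranges: "\<bar>b - b0\<bar> < min d0 d1" "\<bar>x - x0\<bar> < min d0 d1" "\<bar>y - y0\<bar> < min d0 d1"
    have "dagger_C2 R \<bar>a\<bar> (U \<bar>a\<bar>) (V \<bar>a\<bar>) (px (U \<bar>a\<bar>)) (pyS R (U \<bar>a\<bar>)) (px (pyS R (U \<bar>a\<bar>))) (px (px (U \<bar>a\<bar>)))"
      using UV a(1) by (intro dagger_on_strip_imp_dagger_C2) auto
    then have C1: "dagger_C1 R \<bar>a\<bar> (U \<bar>a\<bar>) (V \<bar>a\<bar>) (px (U \<bar>a\<bar>)) (pyS R (U \<bar>a\<bar>))" by (simp add: dagger_C2_def)
    have cont_V: "continuous_on (strip R) (V \<bar>a\<bar>)"
      using Ck_strip_continuous[of R 2 "V \<bar>a\<bar>" "[]"] UV[of "\<bar>a\<bar>"] a(1) by simp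
    have close: "\<forall>z\<in>strip R. \<bar>U \<bar>a\<bar> z - u 0 b0 z\<bar> < \<epsilon> \<and> \<bar>V \<bar>a\<bar> z - v 0 b0 z\<bar> < \<epsilon>"
      using d1(2)[of "\<bar>a\<bar>"] a by simp
    have "rad \<bar>a\<bar> t y = rad a t y" for t y by (simp add: rad_def)
    then have defect: "\<bar>pyS R (U \<bar>a\<bar>) (x, y) * (1 - rad \<bar>a\<bar> (V \<bar>a\<bar> (x, y)) y / rad a (V \<bar>a\<bar> (x, y)) y)\<bar> \<le> \<epsilon>" for x y
      using rad_pos[OF a(1), of "V \<bar>a\<bar> (x, y)" y] \<epsilon> by simp
    show "\<bar>v a b (x, y) - v 0 b0 (x0, y0)\<bar> < \<eta>" "\<bar>u a b (x, y) - u 0 b0 (x0, y0)\<bar> < \<eta>"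
      using controls[OF a(1) _ _ C1 cont_V _ defect, of b x y] a(2) ranges close by simp_all
  qed (use d0 d1 in simp)
qed

text \<open>Only parameters \<open>a \<noteq> 0\<close> need to be controlled, since they are dense.\<close>

lemma continuous_on_family:
  "continuous_on (UNIV \<times> UNIV \<times> open_strip R) (\<lambda>q. u (fst q) (fst (snd q)) (snd (snd q)))"
  "continuous_on (UNIV \<times> UNIV \<times> open_strip R) (\<lambda>q. v (fst q) (fst (snd q)) (snd (snd q)))"
proof -
  let ?D = "(- {0}) \<times> UNIV :: (real \<times> real \<times> real \<times> real) set"
  have dense: "UNIV \<times> UNIV \<times> open_strip R \<subseteq> closure ?D"
    by (simp add: closure_Times closure_complement)
  have close: "\<forall>\<^sub>F q in nhds (a0, b0, x0, y0). q \<in> ?D \<longrightarrow>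
      \<bar>v (fst q) (fst (snd q)) (snd (snd q)) - v a0 b0 (x0, y0)\<bar> < e \<and>
      \<bar>u (fst q) (fst (snd q)) (snd (snd q)) - u a0 b0 (x0, y0)\<bar> < e"
    if y0: "\<bar>y0\<bar> < R" and e: "0 < e" for a0 b0 x0 y0 e
  proof -
    obtain d where d: "0 < d" "\<And>a b x y. a \<noteq> 0 \<Longrightarrow> \<bar>a - a0\<bar> < d \<Longrightarrow> \<bar>b - b0\<bar> < d \<Longrightarrow> \<bar>x - x0\<bar> < d \<Longrightarrow> \<bar>y - y0\<bar> < d \<Longrightarrow>
        \<bar>v a b (x, y) - v a0 b0 (x0, y0)\<bar> < e \<and> \<bar>u a b (x, y) - u a0 b0 (x0, y0)\<bar> < e"
      using convergence_at_nonzero[OF _ y0 e, of a0 b0 x0] convergence_at_zero[OF y0 e, of b0 x0] by (cases "a0 = 0") auto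
    have "\<bar>a - a0\<bar> < d \<and> \<bar>b - b0\<bar> < d \<and> \<bar>x - x0\<bar> < d \<and> \<bar>y - y0\<bar> < d"
      if "dist (a, b, x, y) (a0, b0, x0, y0) < d" for a b x y
      using that dist_fst_le[of "(a, b, x, y)" "(a0, b0, x0, y0)"] dist_snd_le[of "(a, b, x, y)" "(a0, b0, x0, y0)"]
        dist_fst_le[of "(b, x, y)" "(b0, x0, y0)"] dist_snd_le[of "(b, x, y)" "(b0, x0, y0)"]
        dist_fst_le[of "(x, y)" "(x0, y0)"] dist_snd_le[of "(x, y)" "(x0, y0)"] by (simp add: dist_real_def)
    then show ?thesis unfolding eventually_nhds_metric using d by (intro exI[of _ d]) auto
  qed
  show "continuous_on (UNIV \<times> UNIV \<times> open_strip R) (\<lambda>q. u (fst q) (fst (snd q)) (snd (snd q)))"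
    "continuous_on (UNIV \<times> UNIV \<times> open_strip R) (\<lambda>q. v (fst q) (fst (snd q)) (snd (snd q)))"
    by (rule continuous_on_of_dense[OF dense]; clarify; rule eventually_mono[OF close]; auto simp: dist_real_def open_strip_def)+
qed

lemma continuous_on_uv:
  fixes A B X Y :: "'z::topological_space \<Rightarrow> real"
  assumes "continuous_on S A" "continuous_on S B" "continuous_on S X" "continuous_on S Y"
    and "\<And>z. z \<in> S \<Longrightarrow> \<bar>Y z\<bar> < R"
  shows "continuous_on S (\<lambda>z. u (A z) (B z) (X z, Y z))" "continuous_on S (\<lambda>z. v (A z) (B z) (X z, Y z))"
proof -
  have "continuous_on S (\<lambda>z. (A z, B z, X z, Y z))" using assms by (intro continuous_intros)
  moreover have "(\<lambda>z. (A z, B z, X z, Y z)) ` S \<subseteq> UNIV \<times> UNIV \<times> open_strip R"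
    using assms(5) by (auto simp: open_strip_def)
  ultimately show "continuous_on S (\<lambda>z. u (A z) (B z) (X z, Y z))" "continuous_on S (\<lambda>z. v (A z) (B z) (X z, Y z))"
    using continuous_on_compose2[OF continuous_on_family(1)] continuous_on_compose2[OF continuous_on_family(2)] by fastforce+
qed

lemma v_order_translated:
  assumes less: "\<And>x. \<phi>p a b x < \<phi>p a b' (x + t) \<and> \<phi>m a b x < \<phi>m a b' (x + t)" and y: "\<bar>y\<bar> < R"
  shows "v a b (x, y) \<le> v a b' (x + t, y)"
proof (rule le_of_eventually_le[where F = "\<lambda>a. v a b (x, y)" and G = "\<lambda>a. v a b' (x + t, y)"])
  show "continuous_on UNIV (\<lambda>a. v a b (x, y))" "continuous_on UNIV (\<lambda>a. v a b' (x + t, y))"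
    by (intro continuous_on_uv continuous_intros y)+
  have shift_limit: "uniform_limit UNIV (\<lambda>a x. f a (x + t)) (\<lambda>x. f a (x + t)) (at a)"
    if "uniform_limit UNIV f (f a) (at a)" for f :: "real \<Rightarrow> real \<Rightarrow> real"
    using that by (auto simp: uniform_limit_iff elim!: eventually_mono)
  have shift: "continuous_on UNIV (\<lambda>x. f (x + t))" if "continuous_on UNIV f" for f :: "real \<Rightarrow> real"
    by (rule continuous_on_compose2[OF that]) (auto intro!: continuous_intros)
  have shift_periodic: "f (x + P + t) = f (x + t)" if "\<And>x. f (x + P) = f x" for f :: "real \<Rightarrow> real" and x
    using that[of "x + t"] by (simp add: add_ac)
  have "\<forall>\<^sub>F a' in at a. \<forall>x. \<phi>p a' b x < \<phi>p a' b' (x + t)" "\<forall>\<^sub>F a' in at a. \<forall>x. \<phi>m a' b x < \<phi>m a' b' (x + t)"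
    by (rule eventually_less_of_uniform_limit[OF \<phi>_uniform_limit_at(1) shift_limit[OF \<phi>_uniform_limit_at(1)] P_pos
          \<phi>_continuous(1) shift[OF \<phi>_continuous(1)]]
        eventually_less_of_uniform_limit[OF \<phi>_uniform_limit_at(2) shift_limit[OF \<phi>_uniform_limit_at(2)] P_pos
          \<phi>_continuous(2) shift[OF \<phi>_continuous(2)]]; use per shift_periodic less in blast)+
  then show "\<forall>\<^sub>F a' in at a. v a' b (x, y) \<le> v a' b' (x + t, y)"
    using eventually_neq_at_within[of 0 a UNIV] by eventually_elim (use v_order_translated_nonzero[OF _ y] in blast)
qed

lemma v_mono: "b < b' \<Longrightarrow> \<bar>y\<bar> < R \<Longrightarrow> v a b (x, y) \<le> v a b' (x, y)"
  using v_order_translated[of a b b' 0 y x] mono by simp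

lemma v_le_const:
  assumes less: "\<And>x. \<phi>p a b x < c \<and> \<phi>m a b x < c" and y: "\<bar>y\<bar> < R"
  shows "v a b (x, y) \<le> c"
proof (rule le_of_eventually_le[where F = "\<lambda>a. v a b (x, y)" and G = "\<lambda>_. c"])
  show "continuous_on UNIV (\<lambda>a. v a b (x, y))" by (intro continuous_on_uv continuous_intros y)
  have "\<forall>\<^sub>F a' in at a. \<forall>x. \<phi>p a' b x < c" "\<forall>\<^sub>F a' in at a. \<forall>x. \<phi>m a' b x < c"
    by (rule eventually_less_of_uniform_limit[OF \<phi>_uniform_limit_at(1) uniform_limit_const P_pos \<phi>_continuous(1)]
        eventually_less_of_uniform_limit[OF \<phi>_uniform_limit_at(2) uniform_limit_const P_pos \<phi>_continuous(2)];
        use per less in \<open>auto intro!: continuous_intros\<close>)+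
  then show "\<forall>\<^sub>F a' in at a. v a' b (x, y) \<le> c"
    using eventually_neq_at_within[of 0 a UNIV] by eventually_elim (use v_le_const_nonzero[OF _ y] in blast)
qed auto

lemma v_ge_const:
  assumes less: "\<And>x. c < \<phi>p a b x \<and> c < \<phi>m a b x" and y: "\<bar>y\<bar> < R"
  shows "c \<le> v a b (x, y)"
proof (rule le_of_eventually_le[where F = "\<lambda>_. c" and G = "\<lambda>a. v a b (x, y)"])
  show "continuous_on UNIV (\<lambda>a. v a b (x, y))" by (intro continuous_on_uv continuous_intros y)
  have "\<forall>\<^sub>F a' in at a. \<forall>x. c < \<phi>p a' b x" "\<forall>\<^sub>F a' in at a. \<forall>x. c < \<phi>m a' b x"
    by (rule eventually_less_of_uniform_limit[OF uniform_limit_const \<phi>_uniform_limit_at(1) P_pos _ \<phi>_continuous(1)]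
        eventually_less_of_uniform_limit[OF uniform_limit_const \<phi>_uniform_limit_at(2) P_pos _ \<phi>_continuous(2)];
        use per less in \<open>auto intro!: continuous_intros\<close>)+
  then show "\<forall>\<^sub>F a' in at a. c \<le> v a' b (x, y)"
    using eventually_neq_at_within[of 0 a UNIV] by eventually_elim (use v_ge_const_nonzero[OF _ y] in blast)
qed auto

context
  fixes b1 b2 x0 t :: real
  assumes b: "b1 < b2" and t: "0 < t"
begin

definition gap_average :: "real \<Rightarrow> real \<Rightarrow> real" where
  "gap_average a = bump_average x0 t (\<lambda>z. v a b2 z - v a b1 z)"

definition gap_average' :: "real \<Rightarrow> real \<Rightarrow> real" where
  "gap_average' a = bump_average' x0 t (\<lambda>z. u a b2 z - u a b1 z)"

lemma gap_average_nonneg: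
  assumes y: "\<bar>y\<bar> < R"
  shows "0 \<le> gap_average a y"
  unfolding gap_average_def bump_average_def
proof (rule Henstock_Kurzweil_Integration.integral_nonneg)
  show "(\<lambda>x. (v a b2 (x, y) - v a b1 (x, y)) * bump x0 t x) integrable_on {x0-t..x0+t}"
    by (intro integrable_continuous_real continuous_intros continuous_on_uv y)
  show "0 \<le> (v a b2 (x, y) - v a b1 (x, y)) * bump x0 t x" for x
    using v_mono[OF b y, of a x] bump_nonneg[of x0 t x] by simp
qed

lemma continuous_on_gap_averages:
  fixes A Y :: "'c::euclidean_space \<Rightarrow> real"
  assumes AY: "continuous_on S A" "continuous_on S Y" and inside: "\<And>z. z \<in> S \<Longrightarrow> \<bar>Y z\<bar> < R"
  shows "continuous_on S (\<lambda>z. gap_average (A z) (Y z))" "continuous_on S (\<lambda>z. gap_average' (A z) (Y z))"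
proof -
  have fst_snd: "continuous_on (S \<times> cbox (x0-t) (x0+t)) (\<lambda>w. A (fst w))" "continuous_on (S \<times> cbox (x0-t) (x0+t)) (\<lambda>w. Y (fst w))"
    by (rule continuous_on_compose2[OF AY(1)] continuous_on_compose2[OF AY(2)]; auto intro!: continuous_intros)+
  have "continuous_on (S \<times> cbox (x0-t) (x0+t))
      (\<lambda>(z, x). (v (A z) b2 (x, Y z) - v (A z) b1 (x, Y z)) * bump x0 t x)"
    unfolding case_prod_unfold by (intro continuous_intros continuous_on_uv fst_snd) (use inside in auto)
  from integral_continuous_on_param[OF this] show "continuous_on S (\<lambda>z. gap_average (A z) (Y z))"
    by (simp add: gap_average_def bump_average_def)
  have "continuous_on (S \<times> cbox (x0-t) (x0+t))
      (\<lambda>(z, x). (u (A z) b2 (x, Y z) - u (A z) b1 (x, Y z)) * bump' x0 t x)"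
    unfolding case_prod_unfold by (intro continuous_intros continuous_on_uv fst_snd) (use inside in auto)
  from continuous_on_minus[OF integral_continuous_on_param[OF this]]
  show "continuous_on S (\<lambda>z. gap_average' (A z) (Y z))"
    by (simp add: gap_average'_def bump_average'_def)
qed

lemma continuous_on_integral_gap_averages:
  assumes y: "-R < y1" "y2 < R" and w: "continuous_on {y1..y2} w"
  shows "continuous_on UNIV (\<lambda>a. integral {y1..y2} (\<lambda>s. w s * gap_average a s))"
    "continuous_on UNIV (\<lambda>a. integral {y1..y2} (gap_average' a))"
proof -
  have "continuous_on (UNIV \<times> {y1..y2}) (\<lambda>z. w (snd z))"
    by (rule continuous_on_compose2[OF w]) (auto intro!: continuous_intros)
  then have "continuous_on (UNIV \<times> {y1..y2}) (\<lambda>z::real \<times> real. w (snd z) * gap_average (fst z) (snd z))"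
    using y by (intro continuous_intros continuous_on_gap_averages) auto
  from continuous_on_integral_snd[OF this]
  show "continuous_on UNIV (\<lambda>a. integral {y1..y2} (\<lambda>s. w s * gap_average a s))" by simp
  have "continuous_on (UNIV \<times> {y1..y2}) (\<lambda>z::real \<times> real. gap_average' (fst z) (snd z))"
    using y by (intro continuous_intros continuous_on_gap_averages) auto
  from continuous_on_integral_snd[OF this]
  show "continuous_on UNIV (\<lambda>a. integral {y1..y2} (gap_average' a))" by simp
qed

lemma gap_average_growth_nonzero:
  assumes a: "a \<noteq> 0" and y: "-R < y1" "y1 \<le> y2" "y2 < R"
  shows "gap_average a y2 - gap_average a y1 = integral {y1..y2} (gap_average' a)"
    "0 \<notin> {y1..y2} \<Longrightarrow> gap_average' a y2 - gap_average' a y1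
      \<le> integral {y1..y2} (\<lambda>s. (pi / t)\<^sup>2 / 2 / \<bar>s\<bar> * gap_average a s)"
proof -
  obtain p1 q1 p2 q2 where C1: "dagger_C1 R a (u a b1) (v a b1) p1 q1" "dagger_C1 R a (u a b2) (v a b2) p2 q2"
    using periodic_solution_uv[OF a, of b1] periodic_solution_uv[OF a, of b2]
    by (auto simp: periodic_solution_def dagger_C2_def)
  interpret ordered_solutions R a "u a b1" "v a b1" p1 q1 "u a b2" "v a b2" p2 q2 x0 t
    by (rule ordered_solutions.intro[OF C1], unfold_locales) (use a t v_mono[OF b] in auto)
  show "gap_average a y2 - gap_average a y1 = integral {y1..y2} (gap_average' a)"
    using average_increment[OF y] by (simp add: gap_average_def gap_average'_def)
  show "gap_average' a y2 - gap_average' a y1 \<le> integral {y1..y2} (\<lambda>s. (pi / t)\<^sup>2 / 2 / \<bar>s\<bar> * gap_average a s)"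
    if "0 \<notin> {y1..y2}"
    using average_slope_growth[OF y that] by (simp add: gap_average_def gap_average'_def)
qed

lemma degenerate_growth_gap_average: "degenerate_growth R ((pi / t)\<^sup>2 / 2) (gap_average a) (gap_average' a)"
proof
  have nonzero: "\<forall>\<^sub>F a' in at a. a' \<noteq> 0" by (rule eventually_neq_at_within)
  fix y1 y2 assume y: "-R < y1" "y1 \<le> y2" "y2 < R"
  then have inside: "\<bar>y1\<bar> < R" "\<bar>y2\<bar> < R" by auto
  have cont: "continuous_on UNIV (\<lambda>a. gap_average a y2 - gap_average a y1)"
    "continuous_on UNIV (\<lambda>a. gap_average' a y2 - gap_average' a y1)"
    by (intro continuous_intros continuous_on_gap_averages inside)+
  show "gap_average a y2 - gap_average a y1 = integral {y1..y2} (gap_average' a)"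
  proof (rule antisym)
    have equal: "\<forall>\<^sub>F a' in at a. gap_average a' y2 - gap_average a' y1 = integral {y1..y2} (gap_average' a')"
      using nonzero by eventually_elim (rule gap_average_growth_nonzero(1)[OF _ y])
    note cont_integral = continuous_on_integral_gap_averages(2)[OF y(1,3) continuous_on_const[of _ 0]]
    show "gap_average a y2 - gap_average a y1 \<le> integral {y1..y2} (gap_average' a)"
      by (rule le_of_eventually_le[OF cont(1) cont_integral]) (use equal in eventually_elim, simp)
    show "integral {y1..y2} (gap_average' a) \<le> gap_average a y2 - gap_average a y1"
      by (rule le_of_eventually_le[OF cont_integral cont(1)]) (use equal in eventually_elim, simp)
  qed
  assume zero: "0 \<notin> {y1..y2}"
  then have "continuous_on {y1..y2} (\<lambda>s. (pi / t)\<^sup>2 / 2 / \<bar>s\<bar>)" by (intro continuous_intros) auto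
  note limit = le_of_eventually_le[OF cont(2) continuous_on_integral_gap_averages(1)[OF y(1,3) this]]
  show "gap_average' a y2 - gap_average' a y1 \<le> integral {y1..y2} (\<lambda>s. (pi / t)\<^sup>2 / 2 / \<bar>s\<bar> * gap_average a s)"
    by (rule limit, rule eventually_mono[OF nonzero]) (rule gap_average_growth_nonzero(2)[OF _ y zero])
next
  show "continuous_on {-R<..<R} (gap_average a)" "continuous_on {-R<..<R} (gap_average' a)"
    by (rule continuous_on_gap_averages(1)[OF continuous_on_const continuous_on_id]
        continuous_on_gap_averages(2)[OF continuous_on_const continuous_on_id]; auto)+
qed (use gap_average_nonneg t in auto)

lemma gap_average_edge_pos: "0 < gap_average a R"
proof -
  let ?f = "\<lambda>x. (\<phi>p a b2 x - \<phi>p a b1 x) * bump x0 t x"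
  have cont: "continuous_on {x0-t..x0+t} ?f"
    by (intro continuous_intros continuous_on_subset[OF \<phi>_continuous(1)]) auto
  have nonneg: "0 \<le> ?f x" for x
    using mono[OF b, of a x] bump_nonneg[of x0 t x] by simp
  have "integral {x0-t..x0+t} ?f \<noteq> 0"
  proof
    assume "integral {x0-t..x0+t} ?f = 0"
    then have "?f x0 = 0" using integral_eq_0_iff[OF cont _ nonneg] t by simp
    then show False using mono[OF b, of a x0] by (simp add: bump_center)
  qed
  moreover have "0 \<le> integral {x0-t..x0+t} ?f"
    by (intro Henstock_Kurzweil_Integration.integral_nonneg integrable_continuous_real cont nonneg)
  ultimately show ?thesis by (simp add: gap_average_def bump_average_def v_edge)
qed

lemma gap_average_nonzero:
  assumes y: "\<bar>y\<bar> < R"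
  shows "gap_average a y \<noteq> 0"
proof
  assume zero: "gap_average a y = 0"
  have vanishes: "gap_average a s = 0" if "s \<in> {-R<..<R}" for s
    by (rule degenerate_growth.vanishes[OF degenerate_growth_gap_average _ zero that]) (use y in auto)
  have cont_v: "continuous_on ({x0-t..x0+t} \<times> {-R..R}) (v a b)" for b
    by (rule continuous_on_subset[OF continuous_strip(2)]) (auto simp: strip_def)
  have "continuous_on ({x0-t..x0+t} \<times> {-R..R}) (\<lambda>z. (v a b2 z - v a b1 z) * bump x0 t (fst z))"
    by (intro continuous_intros cont_v)
  from continuous_on_integral_fst[OF this] have "continuous_on {-R..R} (gap_average a)"
    by (simp add: gap_average_def bump_average_def[abs_def])
  moreover have closure: "closure {-R<..<R} = {-R..R}" using R_pos by (simp add: closure_greaterThanLessThan)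
  ultimately have "continuous_on (closure {-R<..<R}) (gap_average a)" by simp
  then have "gap_average a R = 0"
    by (rule continuous_constant_on_closure[OF _ vanishes]) (use closure R_pos in simp_all)
  then show False using gap_average_edge_pos[of a] by simp
qed

end

lemma exists_order_translated:
  assumes "b < b'"
  shows "\<exists>r>0. \<forall>x y s. \<bar>s\<bar> < r \<longrightarrow> \<bar>y\<bar> < R \<longrightarrow> v a b (x, y) \<le> v a b' (x + s, y)"
proof -
  have translation: "uniform_limit UNIV (\<lambda>s x. f (x + s)) f (nhds 0)" if "C3a \<alpha> f" for f
    using C3a_lipschitz[OF that] uniform_limit_translation[of f] by blast
  have "\<forall>\<^sub>F s in nhds 0. \<forall>x. \<phi>p a b x < \<phi>p a b' (x + s)" "\<forall>\<^sub>F s in nhds 0. \<forall>x. \<phi>m a b x < \<phi>m a b' (x + s)"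
    by (rule eventually_less_of_uniform_limit[OF uniform_limit_const translation P_pos]; use per mono[OF assms] reg \<phi>_continuous in blast)+
  then have "\<forall>\<^sub>F s in nhds 0. \<forall>x. \<phi>p a b x < \<phi>p a b' (x + s) \<and> \<phi>m a b x < \<phi>m a b' (x + s)"
    by eventually_elim blast
  then obtain r where "0 < r" "\<And>s x. \<bar>s\<bar> < r \<Longrightarrow> \<phi>p a b x < \<phi>p a b' (x + s) \<and> \<phi>m a b x < \<phi>m a b' (x + s)"
    unfolding eventually_nhds_metric by (auto simp: dist_real_def)
  then show ?thesis using v_order_translated by blast
qed

lemma touching_imp_constant_between:
  assumes b: "b < c" "c < b'" and y: "\<bar>y0\<bar> < R" and touch: "v a b (x0, y0) = v a b' (x0, y0)"
  shows "\<exists>r>0. \<forall>x. \<bar>x - x0\<bar> < r \<longrightarrow> v a c (x, y0) = v a b (x0, y0)"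
proof -
  obtain r1 where r1: "0 < r1" "\<And>x s. \<bar>s\<bar> < r1 \<Longrightarrow> v a b (x, y0) \<le> v a c (x + s, y0)"
    using exists_order_translated[OF b(1), of a] y by blast
  obtain r2 where r2: "0 < r2" "\<And>x s. \<bar>s\<bar> < r2 \<Longrightarrow> v a c (x, y0) \<le> v a b' (x + s, y0)"
    using exists_order_translated[OF b(2), of a] y by blast
  have "v a c (x, y0) = v a b (x0, y0)" if "\<bar>x - x0\<bar> < min r1 r2" for x
    using r1(2)[of "x - x0" x0] r2(2)[of "x0 - x" x] that touch by (simp add: abs_minus_commute)
  then show ?thesis using r1(1) r2(1) by (intro exI[of _ "min r1 r2"]) simp
qed

theorem v_strict_mono:
  assumes b: "b < b'" and y0: "\<bar>y0\<bar> < R"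
  shows "v a b (x0, y0) < v a b' (x0, y0)"
proof (rule ccontr)
  assume "\<not> ?thesis"
  then have touch: "v a b (x0, y0) = v a b' (x0, y0)" using v_mono[OF b y0, of a x0] by simp
  obtain c1 where c1: "b < c1" "c1 < b'" using dense[OF b] by blast
  obtain c2 where c2: "c1 < c2" "c2 < b'" using dense[OF c1(2)] by blast
  obtain r1 where r1: "0 < r1" "\<And>x. \<bar>x - x0\<bar> < r1 \<Longrightarrow> v a c1 (x, y0) = v a b (x0, y0)"
    using touching_imp_constant_between[OF c1 y0 touch] by blast
  obtain r2 where r2: "0 < r2" "\<And>x. \<bar>x - x0\<bar> < r2 \<Longrightarrow> v a c2 (x, y0) = v a b (x0, y0)"
    using touching_imp_constant_between[OF less_trans[OF c1(1) c2(1)] c2(2) y0 touch] by blast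
  define t where "t = min r1 r2 / 2"
  have t: "0 < t" "t < r1" "t < r2" using r1(1) r2(1) by (auto simp: t_def min_def)
  have "v a c2 (x, y0) - v a c1 (x, y0) = 0" if "x \<in> {x0-t..x0+t}" for x
    using r1(2)[of x] r2(2)[of x] that t by (simp add: abs_less_iff)
  then have "integral {x0-t..x0+t} (\<lambda>x. (v a c2 (x, y0) - v a c1 (x, y0)) * bump x0 t x) = integral {x0-t..x0+t} (\<lambda>_. 0)"
    by (intro integral_cong) simp
  then have "gap_average c1 c2 x0 t a y0 = 0" by (simp add: gap_average_def[OF c2(1) t(1)] bump_average_def)
  then show False using gap_average_nonzero[OF c2(1) t(1) y0] by blast
qed

lemma v_attains:
  assumes y: "\<bar>y\<bar> < R" shows "\<exists>b. v a b (x, y) = t"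
proof -
  have "\<forall>\<^sub>F b in at_top. \<forall>x. t < \<phi>p a b x" "\<forall>\<^sub>F b in at_top. \<forall>x. t < \<phi>m a b x"
    by (rule eventually_uniformly_large[OF P_pos]; use per mono lim_p lim_m \<phi>_continuous in auto)+
  then have "\<forall>\<^sub>F b in at_top. t \<le> v a b (x, y)" by eventually_elim (blast intro: v_ge_const[OF _ y])
  then obtain b1 where b1: "t \<le> v a b1 (x, y)" by (auto simp: eventually_at_top_linorder)
  have "\<forall>\<^sub>F b in at_bot. \<forall>x. \<phi>p a b x < t" "\<forall>\<^sub>F b in at_bot. \<forall>x. \<phi>m a b x < t"
    by (rule eventually_uniformly_small[OF P_pos]; use per mono lim_p lim_m \<phi>_continuous in auto)+
  then have "\<forall>\<^sub>F b in at_bot. v a b (x, y) \<le> t" by eventually_elim (blast intro: v_le_const[OF _ y])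
  then obtain b2 where b2: "v a b2 (x, y) \<le> t" by (auto simp: eventually_at_bot_linorder)
  have "continuous_on UNIV (\<lambda>b. v a b (x, y))" by (intro continuous_on_uv continuous_intros y)
  note connected_continuous_image[OF this connected_UNIV]
  from connectedD_interval[OF this, of "v a b2 (x, y)" "v a b1 (x, y)" t] show ?thesis using b1 b2 by auto
qed

end

section \<open>The fibration\<close>

lemma exists_moment_product:
  fixes a :: real and w :: complex
  shows "\<exists>z1 z2. (cmod z1)\<^sup>2 - (cmod z2)\<^sup>2 = 2 * a \<and> z1 * z2 = w"
proof -
  define D where "D = sqrt (a\<^sup>2 + (cmod w)\<^sup>2)"
  have D: "D\<^sup>2 = a\<^sup>2 + (cmod w)\<^sup>2" "\<bar>a\<bar> \<le> D" by (auto simp: D_def intro: real_le_rsqrt)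
  show ?thesis
  proof (cases "a + D = 0")
    case True
    then have "D\<^sup>2 = a\<^sup>2" "a \<le> 0" using D(2) by (auto simp: eq_neg_iff_add_eq_0[symmetric] add.commute)
    then have "w = 0" "(sqrt (- 2 * a))\<^sup>2 = - 2 * a" using D(1) by simp_all
    then show ?thesis by (intro exI[of _ 0] exI[of _ "complex_of_real (sqrt (- 2 * a))"]) simp
  next
    case False
    define \<rho> where "\<rho> = sqrt (a + D)"
    have \<rho>: "0 < \<rho>" "\<rho>\<^sup>2 = a + D" using False D(2) by (auto simp: \<rho>_def)
    have "(cmod w)\<^sup>2 = (D - a) * \<rho>\<^sup>2" unfolding \<rho>(2) using D(1) by (simp add: algebra_simps power2_eq_square)
    then have "(cmod w)\<^sup>2 / \<rho>\<^sup>2 = D - a" using \<rho>(1) by simp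
    then have "(cmod (of_real \<rho>))\<^sup>2 - (cmod (w / of_real \<rho>))\<^sup>2 = 2 * a"
      using \<rho> by (simp add: norm_divide power_divide)
    moreover have "of_real \<rho> * (w / of_real \<rho>) = w" using \<rho>(1) by simp
    ultimately show ?thesis by blast
  qed
qed

context sl_family begin

definition boundary_parameter :: "real \<Rightarrow> real \<Rightarrow> real \<Rightarrow> real \<Rightarrow> real" where
  "boundary_parameter a x y t = (THE b. v a b (x, y) = t)"

lemma v_less_iff: "\<bar>y\<bar> < R \<Longrightarrow> v a b (x, y) < v a b' (x, y) \<longleftrightarrow> b < b'"
  using v_strict_mono[of b b' y a x] v_strict_mono[of b' b y a x] by (cases b b' rule: linorder_cases) auto

lemma boundary_parameter_v:
  assumes y: "\<bar>y\<bar> < R"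
  shows "boundary_parameter a x y (v a b (x, y)) = b"
  unfolding boundary_parameter_def
proof (rule the_equality)
  fix b' assume "v a b' (x, y) = v a b (x, y)"
  then show "b' = b" using v_less_iff[OF y, of a b' x b] v_less_iff[OF y, of a b x b'] by simp
qed simp

lemma v_boundary_parameter: "\<bar>y\<bar> < R \<Longrightarrow> v a (boundary_parameter a x y t) (x, y) = t"
  using v_attains[of y a x t] boundary_parameter_v by metis

lemma boundary_parameter_less_iff: "\<bar>y\<bar> < R \<Longrightarrow> boundary_parameter a x y t < b \<longleftrightarrow> t < v a b (x, y)"
  using v_less_iff[of y a "boundary_parameter a x y t" x b] by (simp add: v_boundary_parameter)

lemma less_boundary_parameter_iff: "\<bar>y\<bar> < R \<Longrightarrow> b < boundary_parameter a x y t \<longleftrightarrow> v a b (x, y) < t"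
  using v_less_iff[of y a b x "boundary_parameter a x y t"] by (simp add: v_boundary_parameter)

lemma uv_plus_of_int:
  assumes y: "\<bar>y\<bar> < R"
  shows "u a b (x + of_int n * P, y) = u a b (x, y)" "v a b (x + of_int n * P, y) = v a b (x, y)"
proof -
  interpret u: periodic_fun_simple "\<lambda>x. u a b (x, y)" P by unfold_locales (use periodic_uv y in auto)
  interpret v: periodic_fun_simple "\<lambda>x. v a b (x, y)" P by unfold_locales (use periodic_uv y in auto)
  show "u a b (x + of_int n * P, y) = u a b (x, y)" by (rule u.plus_of_int)
  show "v a b (x + of_int n * P, y) = v a b (x, y)" by (rule v.plus_of_int)
qed

lemma boundary_parameter_plus_of_int:
  "\<bar>y\<bar> < R \<Longrightarrow> boundary_parameter a (x + of_int n * P) y t = boundary_parameter a x y t"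
  by (simp add: boundary_parameter_def uv_plus_of_int)

lemma continuous_on_boundary_parameter:
  fixes A X Y T :: "'z::topological_space \<Rightarrow> real"
  assumes cont: "continuous_on S A" "continuous_on S X" "continuous_on S Y" "continuous_on S T"
    and Y: "\<And>z. z \<in> S \<Longrightarrow> \<bar>Y z\<bar> < R"
  shows "continuous_on S (\<lambda>z. boundary_parameter (A z) (X z) (Y z) (T z))"
  unfolding continuous_on_def
proof (intro ballI order_tendstoI)
  fix z0 b assume z0: "z0 \<in> S"
  have "continuous_on S (\<lambda>z. v (A z) b (X z, Y z) - T z)"
    by (intro continuous_intros continuous_on_uv cont Y)
  then have lim: "((\<lambda>z. v (A z) b (X z, Y z) - T z) \<longlongrightarrow> v (A z0) b (X z0, Y z0) - T z0) (at z0 within S)"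
    using z0 by (simp add: continuous_on_def)
  have inside: "\<forall>\<^sub>F z in at z0 within S. z \<in> S" by (simp add: eventually_at_filter)
  {
    assume "b < boundary_parameter (A z0) (X z0) (Y z0) (T z0)"
    then have "v (A z0) b (X z0, Y z0) - T z0 < 0" by (simp add: less_boundary_parameter_iff Y[OF z0])
    from order_tendstoD(2)[OF lim this] inside
    show "\<forall>\<^sub>F z in at z0 within S. b < boundary_parameter (A z) (X z) (Y z) (T z)"
      by eventually_elim (simp add: less_boundary_parameter_iff Y)
  next
    assume "boundary_parameter (A z0) (X z0) (Y z0) (T z0) < b"
    then have "0 < v (A z0) b (X z0, Y z0) - T z0" by (simp add: boundary_parameter_less_iff Y[OF z0])
    from order_tendstoD(1)[OF lim this] inside
    show "\<forall>\<^sub>F z in at z0 within S. boundary_parameter (A z) (X z) (Y z) (T z) < b"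
      by eventually_elim (simp add: boundary_parameter_less_iff Y)
  }
qed

fun fibration :: "complex \<times> complex \<times> complex \<Rightarrow> real \<times> real \<times> real" where
  "fibration (z1, z2, z3) =
    (let a = ((cmod z1)\<^sup>2 - (cmod z2)\<^sup>2) / 2; y = Im (z1 * z2); b = boundary_parameter a (Re z3) y (Re (z1 * z2))
     in (a, b, Im z3 - u a b (Re z3, y)))"

lemma continuous_on_fibration: "continuous_on (V_lift R) fibration"
proof -
  let ?a = "\<lambda>z :: complex \<times> complex \<times> complex. ((cmod (fst z))\<^sup>2 - (cmod (fst (snd z)))\<^sup>2) / 2"
  let ?w = "\<lambda>z :: complex \<times> complex \<times> complex. fst z * fst (snd z)"
  let ?b = "\<lambda>z. boundary_parameter (?a z) (Re (snd (snd z))) (Im (?w z)) (Re (?w z))"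
  have inside: "\<bar>Im (?w z)\<bar> < R" if "z \<in> V_lift R" for z
    using that by (auto simp: V_lift_def case_prod_unfold)
  have a: "continuous_on (V_lift R) ?a" by (intro continuous_intros) auto
  have b: "continuous_on (V_lift R) ?b"
    by (intro continuous_on_boundary_parameter a inside continuous_intros)
  have "continuous_on (V_lift R) (\<lambda>z. (?a z, ?b z, Im (snd (snd z)) - u (?a z) (?b z) (Re (snd (snd z)), Im (?w z))))"
    by (intro continuous_on_Pair continuous_on_diff continuous_on_uv a b inside continuous_intros)
  moreover have "fibration = (\<lambda>z. (?a z, ?b z, Im (snd (snd z)) - u (?a z) (?b z) (Re (snd (snd z)), Im (?w z))))"
    by (auto simp: Let_def)
  ultimately show ?thesis by simp
qed

lemma fibration_Zshift:
  assumes "z \<in> V_lift R" shows "fibration (Zshift P n z) = fibration z"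
proof -
  obtain z1 z2 z3 where z: "z = (z1, z2, z3)" by (cases z)
  then have "\<bar>Im (z1 * z2)\<bar> < R" using assms by (simp add: V_lift_def)
  moreover have "Re (of_int n * complex_of_real P) = of_int n * P" "Im (of_int n * complex_of_real P) = 0" by simp_all
  ultimately show ?thesis
    by (simp add: z Zshift_def Let_def boundary_parameter_plus_of_int uv_plus_of_int del: times_complex.simps)
qed

theorem fibration_fiber: "{z \<in> V_lift R. fibration z = (a, b, c)} = N_lift R (u a b) (v a b) a c"
proof (intro equalityI subsetI)
  fix z assume "z \<in> {z \<in> V_lift R. fibration z = (a, b, c)}"
  moreover obtain z1 z2 z3 where z: "z = (z1, z2, z3)" by (cases z)
  ultimately have y: "\<bar>Im (z1 * z2)\<bar> < R" and a: "(cmod z1)\<^sup>2 - (cmod z2)\<^sup>2 = 2 * a"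
    and b: "boundary_parameter a (Re z3) (Im (z1 * z2)) (Re (z1 * z2)) = b"
    and c: "Im z3 = u a b (Re z3, Im (z1 * z2)) + c"
    by (auto simp: V_lift_def Let_def simp del: times_complex.simps)
  have "v a b (Re z3, Im (z1 * z2)) = Re (z1 * z2)" unfolding b[symmetric] by (rule v_boundary_parameter[OF y])
  then show "z \<in> N_lift R (u a b) (v a b) a c"
    unfolding N_lift_def z using a c y
    by (auto simp: abs_less_iff complex_eq_iff simp del: times_complex.simps
        intro!: exI[of _ "Re z3"] exI[of _ "Im (z1 * z2)"])
next
  fix z assume "z \<in> N_lift R (u a b) (v a b) a c"
  then obtain z1 z2 z3 x y where z: "z = (z1, z2, z3)" and a: "(cmod z1)\<^sup>2 - (cmod z2)\<^sup>2 = 2 * a" and y: "-R < y" "y < R"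
    and w: "z1 * z2 = complex_of_real (v a b (x, y)) + \<i> * complex_of_real y"
    and z3: "z3 = complex_of_real x + \<i> * complex_of_real (u a b (x, y)) + \<i> * complex_of_real c"
    unfolding N_lift_def by blast
  have parts: "Re (z1 * z2) = v a b (x, y)" "Im (z1 * z2) = y" "Re z3 = x" "Im z3 = u a b (x, y) + c"
    unfolding w z3 by simp_all
  have "\<bar>y\<bar> < R" using y by (simp add: abs_less_iff)
  then show "z \<in> {z \<in> V_lift R. fibration z = (a, b, c)}"
    using a parts by (simp add: z V_lift_def Let_def boundary_parameter_v del: times_complex.simps)
qed

lemma N_lift_nonempty: "N_lift R (u a b) (v a b) a c \<noteq> {}"
proof -
  obtain z1 z2 where "(cmod z1)\<^sup>2 - (cmod z2)\<^sup>2 = 2 * a"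
    "z1 * z2 = complex_of_real (v a b (0, 0)) + \<i> * complex_of_real 0"
    using exists_moment_product by blast
  then have "(z1, z2, complex_of_real 0 + \<i> * complex_of_real (u a b (0, 0)) + \<i> * complex_of_real c)
      \<in> N_lift R (u a b) (v a b) a c"
    unfolding N_lift_def using R_pos by force
  then show ?thesis by blast
qed

lemma fibration_surj: "fibration ` V_lift R = UNIV"
proof -
  have "(a, b, c) \<in> fibration ` V_lift R" for a b c
    using N_lift_nonempty[of a b c] unfolding fibration_fiber[symmetric] by (blast intro: rev_image_eqI[OF _ sym])
  then show ?thesis by auto
qed

lemma N_lift_disjoint:
  assumes "N_lift R (u a b) (v a b) a c \<noteq> N_lift R (u a' b') (v a' b') a' c'"
  shows "N_lift R (u a b) (v a b) a c \<inter> N_lift R (u a' b') (v a' b') a' c' = {}"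
  using assms unfolding fibration_fiber[symmetric] by auto

end

theorem theorem7p5:
  fixes R P \<alpha> :: real
    and \<phi>p \<phi>m :: "real \<Rightarrow> real \<Rightarrow> real \<Rightarrow> real"
    and u v :: "real \<Rightarrow> real \<Rightarrow> real \<times> real \<Rightarrow> real"
  assumes R_pos: "R > 0" and P_pos: "P > 0"
    and alpha: "0 < \<alpha>" "\<alpha> < 1"
    and reg: "\<And>a b. C3a \<alpha> (\<phi>p a b) \<and> C3a \<alpha> (\<phi>m a b)"
    and cont_p: "\<And>a b e. e > 0 \<Longrightarrow> \<exists>d>0. \<forall>a' b'. dist (a', b') (a, b) < d \<longrightarrow>
                   c3a_norm \<alpha> (\<lambda>x. \<phi>p a' b' x - \<phi>p a b x) < e"
    and cont_m: "\<And>a b e. e > 0 \<Longrightarrow> \<exists>d>0. \<forall>a' b'. dist (a', b') (a, b) < d \<longrightarrow>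
                   c3a_norm \<alpha> (\<lambda>x. \<phi>m a' b' x - \<phi>m a b x) < e"
    and per: "\<And>a b x. \<phi>p a b (x + P) = \<phi>p a b x \<and> \<phi>m a b (x + P) = \<phi>m a b x"
    and int_eq: "\<And>a b. integral {0..P} (\<phi>p a b) = integral {0..P} (\<phi>m a b)"
    and mono: "\<And>a b b' x. b < b' \<Longrightarrow> \<phi>p a b x < \<phi>p a b' x \<and> \<phi>m a b x < \<phi>m a b' x"
    and lim_p: "\<And>a x. filterlim (\<lambda>b. \<phi>p a b x) at_top at_top \<and>
                        filterlim (\<lambda>b. \<phi>p a b x) at_bot at_bot"
    and lim_m: "\<And>a x. filterlim (\<lambda>b. \<phi>m a b x) at_top at_top \<and>
                        filterlim (\<lambda>b. \<phi>m a b x) at_bot at_bot"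
    and sol: "\<And>a b. assoc_sol R P \<alpha> a (\<phi>p a b) (\<phi>m a b) (u a b) (v a b)"
  shows "(\<forall>a b c a' b' c'.
            N_lift R (u a b) (v a b) a c \<noteq> N_lift R (u a' b') (v a' b') a' c' \<longrightarrow>
            N_lift R (u a b) (v a b) a c \<inter> N_lift R (u a' b') (v a' b') a' c' = {}) \<and>
         (\<exists>F :: complex \<times> complex \<times> complex \<Rightarrow> real \<times> real \<times> real.
            continuous_on (V_lift R) F \<and>
            (\<forall>z\<in>V_lift R. \<forall>n. F (Zshift P n z) = F z) \<and>
            F ` V_lift R = UNIV \<and>
            (\<forall>a b c. {z \<in> V_lift R. F z = (a, b, c)} = N_lift R (u a b) (v a b) a c))"
proof -
  interpret sl_family R P \<alpha> \<phi>p \<phi>m u v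
    by unfold_locales (fact R_pos P_pos reg cont_p cont_m per mono lim_p lim_m sol)+
  show ?thesis
    using N_lift_disjoint continuous_on_fibration fibration_Zshift fibration_surj fibration_fiber by blast
qed

end
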